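(* Let $p\in(1,\infty)$, let $(K,d,m)$ be the Sierpiński carpet, and let $\mathcal E_p,\mathcal F_p,\rho(p)$ be the $p$-energy, Sobolev space and scaling constant described in the context. Let $\mathscr F_p$ be a subspace of $L^p(K,m)$ and let $\mathscr E_p:\mathscr F_p\to[0,\infty)$ be a functional. Suppose that: (a) $\{f\in\mathscr F_p:\mathscr E_p(f)=0\}=\{f\in L^p(K,m): f\text{ is constant }m\text{-a.e.}\}$, and for any $a\in\mathbb R$ and $f\in\mathscr F_p$, $\mathscr E_p(f+a\mathbf 1_K)=\mathscr E_p(f)$ and $\mathscr E_p(af)=|a|^p\mathscr E_p(f)$. (b) $f\mapsto\mathscr E_p(f)^{1/p}$ satisfies the triangle inequality on $\mathscr F_p$; in addition, $\|f\|_{\mathscr F_p}:=(\|f\|_{L^p(m)}^p+\mathscr E_p(f))^{1/p}$ is a norm on $\mathscr F_p$ and $(\mathscr F_p,\|\cdot\|_{\mathscr F_p})$ is a uniformly convex Banach space. (c) (Regularity) $\mathscr F_p\cap C(K)$ is dense in $C(K)$ with respect to the uniform norm and is dense in the Banach space $(\mathscr F_p,\|\cdot\|_{\mathscr F_p})$. (d) (Symmetry) For every $\Phi\in D_4$ and all $f\in\mathscr F_p$, $f\circ\Phi\in\mathscr F_p$ and $\mathscr E_p(f\circ\Phi)=\mathscr E_p(f)$. (e) (Self-similarity) There exists $\widetilde\rho\in(0,\infty)$ such that for every $f\in\mathscr F_p$, $i\in S$ we have $f\circ F_i\in\mathscr F_p$, and $\widetilde\rho\sum_{i\in S}\mathscr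 E_p(f\circ F_i)=\mathscr E_p(f)$. Furthermore, $\mathscr F_p\cap C(K)=\{f\in C(K): f\circ F_i\in\mathscr F_p\text{ for all }i\in S\}$. (f) (Unit contractivity) $f^+\wedge1\in\mathscr F_p$ for all $f\in\mathscr F_p$ and $\mathscr E_p(f^+\wedge1)\le\mathscr E_p(f)$. (g) (Spectral gap) There exists $C_{\mathrm{gap}}\in(0,\infty)$ such that $\|f-f_K\|_{L^p(m)}^p\le C_{\mathrm{gap}}\mathscr E_p(f)$ for all $f\in\mathscr F_p$, where $f_K=\int_Kf\,dm$. Then $\widetilde\rho=\rho(p)$, $\mathcal F_p=\mathscr F_p$, and there exists $C\in[1,\infty)$ such that $C^{-1}\mathcal E_p(f)\le\mathscr E_p(f)\le C\,\mathcal E_p(f)$ for all $f\in\mathcal F_p=\mathscr F_p$.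
   Context: Sierpiński carpet: let $q_1=(-1,-1)$, $q_2=(0,-1)$, $q_3=(1,-1)$, $q_4=(1,0)$, $q_5=(1,1)$, $q_6=(0,1)$, $q_7=(-1,1)$, $q_8=(-1,0)$ in $\mathbb R^2$, $S=\{1,\dots,8\}$, $f_i(x)=\frac13(x-q_i)+q_i$. $K$ is the unique non-empty compact subset of $\mathbb R^2$ with $K=\bigcup_{i\in S}f_i(K)$; $F_i:=f_i|_K$; $F_w:=F_{w_1}\circ\cdots\circ F_{w_n}$ for $w\in S^n$. $d$ is the Euclidean metric on $K$ and $m$ the self-similar Borel probability measure with $m(F_w(K))=8^{-n}$ for $w\in S^n$. $\mathbb N$ = positive integers. $\mathbb G_n=(V_n,E_n)$: $V_n=S^n$, $E_n=\{\{u,v\}:u\ne v\in V_n,\ F_u(K)\cap F_v(K)\ne\emptyset\}$, with graph distance $d_n$; $\mathcal E_p^{\mathbb G_n}(g)=\sum_{\{u,v\}\in E_n}|g(u)-g(v)|^p$; $(M_nf)(u)=\frac1{m(F_u(K))}\int_{F_u(K)}f\,dm$. $D_4$ is the order-$8$ dihedral group of linear symmetries of $[-1,1]^2$ (they preserve $K$). $f^+=\max(f,0)$, $a\wedge b=\min(a,b)$. Scaling constant: for $m,n\in\mathbb N$ and $w\in V_m$ let $S^n(w)\subset V_{n+m}$ be the words whose first $m$ letters form $w$. Let $c_n(w)=\inf\{\mathcal E_p^{\mathbb G_{n+m}}(g): g=0\text{ on }S^n(w),\ g=1\text{ on }V_{n+m}\setminus\bigcup_{v\in V_m,\,d_m(v,w)\le1}S^n(v)\}$,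 $\mathcal C_p^{(n)}=\sup_{m\in\mathbb N,w\in V_m}c_n(w)$, and $\rho(p):=\lim_{n\to\infty}(\mathcal C_p^{(n)})^{-1/n}\in(0,\infty)$ (the limit exists). Sobolev space: $|f|_{\mathcal F_p}=(\sup_{n\in\mathbb N}\rho(p)^n\mathcal E_p^{\mathbb G_n}(M_nf))^{1/p}$, $\mathcal F_p=\{f\in L^p(K,m):|f|_{\mathcal F_p}<\infty\}$. Self-similar $p$-energy: $\mathcal E_p:\mathcal F_p\to[0,\infty)$ is a fixed functional with the following properties, for some $C_0\ge1$ (such a functional exists): $\mathcal E_p^{1/p}$ is a uniformly convex semi-norm with $C_0^{-1}|f|_{\mathcal F_p}\le\mathcal E_p(f)^{1/p}\le C_0|f|_{\mathcal F_p}$; for $1$-Lipschitz $\varphi:\mathbb R\to\mathbb R$, $\varphi\circ f\in\mathcal F_p$ and $\mathcal E_p(\varphi\circ f)\le\mathcal E_p(f)$; $\|f-\int_Kf\,dm\|_{L^p}^p\le C_0\mathcal E_p(f)$, and $\mathcal E_p(f)=0$ iff $f$ is constant $m$-a.e.; $\mathcal E_p(f+g+h)+\mathcal E_p(h)=\mathcal E_p(f+h)+\mathcal E_p(g+h)$ whenever the supports of $f\,dm$ and $(g-a)\,dm$ are disjoint for some $a\in\mathbb R$; $f\circ F_i\in\mathcal F_p$ and $\mathcal E_p(f)=\rho(p)\sum_{i\in S}\mathcal E_p(f\circ F_i)$, and $\mathcal F_p\cap C(K)=\{f\in C(K):f\circ F_i\in\mathcal F_p\ \forall i\in S\}$; $f\circ\Phi\in\mathcal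 F_p$ and $\mathcal E_p(f\circ\Phi)=\mathcal E_p(f)$ for $\Phi\in D_4$. *)

theory Defs
  imports "HOL-Probability.Probability"
begin

type_synonym plane = "real \<times> real"

section \<open>The carpet and its self-similar measure\<close>

definition carpet_pt :: "nat \<Rightarrow> plane" where
  "carpet_pt i = [(-1,-1), (0,-1), (1,-1), (1,0), (1,1), (0,1), (-1,1), (-1,0)] ! (i - 1)"

definition carpet_letters :: "nat set" where
  "carpet_letters = {1..8}"

definition carpet_map :: "nat \<Rightarrow> plane \<Rightarrow> plane" where
  "carpet_map i x = (1/3) *\<^sub>R (x - carpet_pt i) + carpet_pt i"

definition carpet_word_map :: "nat list \<Rightarrow> plane \<Rightarrow> plane" where
  "carpet_word_map w = foldr (\<lambda>i g. carpet_map i \<circ> g) w id"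

text \<open>By Hutchinson's theorem the next predicate has exactly one solution \<open>K\<close>, and
  \<open>is_carpet_measure K\<close> below exactly one solution \<open>m\<close>; the restriction of \<open>carpet_word_map w\<close>
  to \<open>K\<close> is \<open>F\<^sub>w\<close>.\<close>

definition is_carpet :: "plane set \<Rightarrow> bool" where
  "is_carpet K \<longleftrightarrow> compact K \<and> K \<noteq> {} \<and> K = (\<Union>i\<in>carpet_letters. carpet_map i ` K)"

definition carpet_words :: "nat \<Rightarrow> nat list set" where
  "carpet_words n = {w. length w = n \<and> set w \<subseteq> carpet_letters}"

abbreviation carpet_cell :: "plane set \<Rightarrow> nat list \<Rightarrow> plane set" where
  "carpet_cell K w \<equiv> carpet_word_map w ` K"

definition is_carpet_measure :: "plane set \<Rightarrow> plane measure \<Rightarrow> bool" where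
  "is_carpet_measure K m \<longleftrightarrow>
     sets m = sets (restrict_space borel K) \<and> prob_space m \<and>
     (\<forall>A\<in>sets m. measure m A = (1/8) * (\<Sum>i\<in>carpet_letters. measure m (carpet_map i -` A \<inter> K))) \<and>
     (\<forall>n. \<forall>w\<in>carpet_words n. measure m (carpet_cell K w) = (1/8) ^ n)"

definition carpet_symmetries :: "(plane \<Rightarrow> plane) set" where
  "carpet_symmetries =
     {\<Phi>. orthogonal_transformation \<Phi> \<and> \<Phi> ` cbox (-1,-1) (1,1) = cbox (-1,-1) (1,1)}"

section \<open>The graph approximations and the scaling constant\<close>

text \<open>Adjacency in the \<open>n\<close>-th graph, as a symmetric relation: every undirected edge occurs in both
  orientations, whence the factor 1/2 in the energy.\<close>

definition carpet_adj :: "plane set \<Rightarrow> nat \<Rightarrow> (nat list \<times> nat list) set" where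
  "carpet_adj K n =
     {(u, v). u \<in> carpet_words n \<and> v \<in> carpet_words n \<and> u \<noteq> v \<and>
              carpet_cell K u \<inter> carpet_cell K v \<noteq> {}}"

definition carpet_dist :: "plane set \<Rightarrow> nat \<Rightarrow> nat list \<Rightarrow> nat list \<Rightarrow> enat" where
  "carpet_dist K n u v = (INF k\<in>{k. (u, v) \<in> carpet_adj K n ^^ k}. enat k)"

definition graph_energy :: "plane set \<Rightarrow> real \<Rightarrow> nat \<Rightarrow> (nat list \<Rightarrow> real) \<Rightarrow> real" where
  "graph_energy K p n g = (1/2) * (\<Sum>(u, v)\<in>carpet_adj K n. \<bar>g u - g v\<bar> powr p)"

definition carpet_descendants :: "nat \<Rightarrow> nat list \<Rightarrow> nat list set" where
  "carpet_descendants n w =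
     {v \<in> carpet_words (length w + n). take (length w) v = w}"

text \<open>In the next two definitions the infimum is over a nonempty set of nonnegative reals, and the
  supremum over a set bounded by \<open>8 * 8 ^ n\<close> (test functions \<open>g\<close> vanishing exactly on
  the descendants of \<open>w\<close>, and vertex degrees at most 8), so real-valued \<open>Inf\<close> and \<open>Sup\<close> are safe.\<close>

definition carpet_conductance :: "plane set \<Rightarrow> real \<Rightarrow> nat \<Rightarrow> nat list \<Rightarrow> real" where
  "carpet_conductance K p n w =
     Inf {graph_energy K p (length w + n) g | g.
            (\<forall>v\<in>carpet_descendants n w. g v = 0) \<and>
            (\<forall>v\<in>carpet_words (length w + n) -
                 (\<Union>u\<in>{u \<in> carpet_words (length w). carpet_dist K (length w) u w \<le> 1}.
                    carpet_descendants n u). g v = 1)}"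

definition carpet_conductance_sup :: "plane set \<Rightarrow> real \<Rightarrow> nat \<Rightarrow> real" where
  "carpet_conductance_sup K p n =
     (SUP w\<in>(\<Union>l\<in>{1..}. carpet_words l). carpet_conductance K p n w)"

text \<open>\<open>\<rho>\<close> is the limit \<open>\<rho>(p)\<close>; that the limit exists and is positive is part of the predicate.\<close>

definition is_scaling_constant :: "plane set \<Rightarrow> real \<Rightarrow> real \<Rightarrow> bool" where
  "is_scaling_constant K p \<rho> \<longleftrightarrow>
     0 < \<rho> \<and> (\<lambda>n. carpet_conductance_sup K p n powr (- 1 / real n)) \<longlonglongrightarrow> \<rho>"

section \<open>Subspaces of \<open>L^p\<close> and functionals on them\<close>

text \<open>Elements of \<open>L^p(K,m)\<close> are represented by functions on the plane of which only the values
  on \<open>space m = K\<close> matter. A subspace of \<open>L^p\<close> is a set of representatives that is closed under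
  a.e. equality, and a functional on it must not distinguish a.e. equal functions; so equality of
  two such subspaces, as sets of functions, is equality of the subspaces of classes.\<close>

definition Lp :: "'a measure \<Rightarrow> real \<Rightarrow> ('a \<Rightarrow> real) set" where
  "Lp m p = {f \<in> borel_measurable m. integrable m (\<lambda>x. \<bar>f x\<bar> powr p)}"

definition Lp_norm :: "'a measure \<Rightarrow> real \<Rightarrow> ('a \<Rightarrow> real) \<Rightarrow> real" where
  "Lp_norm m p f = (\<integral>x. \<bar>f x\<bar> powr p \<partial>m) powr (1 / p)"

definition Lp_subspace :: "'a measure \<Rightarrow> real \<Rightarrow> ('a \<Rightarrow> real) set \<Rightarrow> bool" where
  "Lp_subspace m p F \<longleftrightarrow>
     F \<subseteq> Lp m p \<and> (\<lambda>x. 0) \<in> F \<and>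
     (\<forall>f\<in>F. \<forall>g\<in>F. (\<lambda>x. f x + g x) \<in> F) \<and>
     (\<forall>a. \<forall>f\<in>F. (\<lambda>x. a * f x) \<in> F) \<and>
     (\<forall>f\<in>F. \<forall>g\<in>Lp m p. (AE x in m. f x = g x) \<longrightarrow> g \<in> F)"

definition nonneg_functional :: "'a measure \<Rightarrow> ('a \<Rightarrow> real) set \<Rightarrow> (('a \<Rightarrow> real) \<Rightarrow> real) \<Rightarrow> bool" where
  "nonneg_functional m F E \<longleftrightarrow>
     (\<forall>f\<in>F. 0 \<le> E f) \<and>
     (\<forall>f\<in>F. \<forall>g\<in>F. (AE x in m. f x = g x) \<longrightarrow> E f = E g)"

definition triangle_on :: "('a \<Rightarrow> real) set \<Rightarrow> (('a \<Rightarrow> real) \<Rightarrow> real) \<Rightarrow> bool" where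
  "triangle_on F N \<longleftrightarrow> (\<forall>f\<in>F. \<forall>g\<in>F. N (\<lambda>x. f x + g x) \<le> N f + N g)"

definition seminorm_on :: "'a measure \<Rightarrow> ('a \<Rightarrow> real) set \<Rightarrow> (('a \<Rightarrow> real) \<Rightarrow> real) \<Rightarrow> bool" where
  "seminorm_on m F N \<longleftrightarrow>
     nonneg_functional m F N \<and> triangle_on F N \<and>
     (\<forall>a. \<forall>f\<in>F. N (\<lambda>x. a * f x) = \<bar>a\<bar> * N f)"

definition norm_on :: "'a measure \<Rightarrow> ('a \<Rightarrow> real) set \<Rightarrow> (('a \<Rightarrow> real) \<Rightarrow> real) \<Rightarrow> bool" where
  "norm_on m F N \<longleftrightarrow>
     seminorm_on m F N \<and> (\<forall>f\<in>F. N f = 0 \<longrightarrow> (AE x in m. f x = 0))"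

definition uniformly_convex_on :: "('a \<Rightarrow> real) set \<Rightarrow> (('a \<Rightarrow> real) \<Rightarrow> real) \<Rightarrow> bool" where
  "uniformly_convex_on F N \<longleftrightarrow>
     (\<forall>\<epsilon>>0. \<exists>\<delta>>0. \<forall>f\<in>F. \<forall>g\<in>F.
        N f = 1 \<and> N g = 1 \<and> N (\<lambda>x. f x - g x) \<ge> \<epsilon> \<longrightarrow> N (\<lambda>x. f x + g x) \<le> 2 * (1 - \<delta>))"

definition complete_norm_on :: "('a \<Rightarrow> real) set \<Rightarrow> (('a \<Rightarrow> real) \<Rightarrow> real) \<Rightarrow> bool" where
  "complete_norm_on F N \<longleftrightarrow>
     (\<forall>f. (\<forall>n. f n \<in> F) \<and>
          (\<forall>\<epsilon>>0. \<exists>M::nat. \<forall>i\<ge>M. \<forall>j\<ge>M. N (\<lambda>x. f i x - f j x) < \<epsilon>) \<longrightarrow>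
        (\<exists>g\<in>F. (\<lambda>n. N (\<lambda>x. f n x - g x)) \<longlonglongrightarrow> 0))"

definition energy_norm ::
    "'a measure \<Rightarrow> real \<Rightarrow> (('a \<Rightarrow> real) \<Rightarrow> real) \<Rightarrow> ('a \<Rightarrow> real) \<Rightarrow> real" where
  "energy_norm m p E f = (Lp_norm m p f powr p + E f) powr (1 / p)"

definition ae_constant :: "'a measure \<Rightarrow> ('a \<Rightarrow> real) \<Rightarrow> bool" where
  "ae_constant m f \<longleftrightarrow> (\<exists>c. AE x in m. f x = c)"

text \<open>The support of the signed measure \<open>f dm\<close>.\<close>

definition density_support :: "'a::topological_space measure \<Rightarrow> ('a \<Rightarrow> real) \<Rightarrow> 'a set" where
  "density_support m f =
     {x \<in> space m. \<forall>U. open U \<and> x \<in> U \<longrightarrow> \<not> (AE y in m. y \<in> U \<longrightarrow> f y = 0)}"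

section \<open>The Sobolev space and the self-similar energy\<close>

definition cell_average :: "plane set \<Rightarrow> plane measure \<Rightarrow> (plane \<Rightarrow> real) \<Rightarrow> nat list \<Rightarrow> real" where
  "cell_average K m f u =
     (1 / measure m (carpet_cell K u)) * (LINT x:carpet_cell K u|m. f x)"

definition scaled_energy ::
    "plane set \<Rightarrow> plane measure \<Rightarrow> real \<Rightarrow> real \<Rightarrow> (plane \<Rightarrow> real) \<Rightarrow> nat \<Rightarrow> real" where
  "scaled_energy K m p \<rho> f n = \<rho> ^ n * graph_energy K p n (cell_average K m f)"

text \<open>The supremum below is real-valued; it is only used for \<open>f\<close> in the Sobolev space, where it is
  finite.\<close>

definition sobolev_seminorm ::
    "plane set \<Rightarrow> plane measure \<Rightarrow> real \<Rightarrow> real \<Rightarrow> (plane \<Rightarrow> real) \<Rightarrow> real" where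
  "sobolev_seminorm K m p \<rho> f = (SUP n\<in>{1..}. scaled_energy K m p \<rho> f n) powr (1 / p)"

definition sobolev_space ::
    "plane set \<Rightarrow> plane measure \<Rightarrow> real \<Rightarrow> real \<Rightarrow> (plane \<Rightarrow> real) set" where
  "sobolev_space K m p \<rho> = {f \<in> Lp m p. bdd_above (scaled_energy K m p \<rho> f ` {1..})}"

definition symmetry_invariant ::
    "(plane \<Rightarrow> real) set \<Rightarrow> ((plane \<Rightarrow> real) \<Rightarrow> real) \<Rightarrow> bool" where
  "symmetry_invariant F E \<longleftrightarrow>
     (\<forall>\<Phi>\<in>carpet_symmetries. \<forall>f\<in>F. f \<circ> \<Phi> \<in> F \<and> E (f \<circ> \<Phi>) = E f)"

definition self_similar_energy ::
    "plane set \<Rightarrow> (plane \<Rightarrow> real) set \<Rightarrow> ((plane \<Rightarrow> real) \<Rightarrow> real) \<Rightarrow> real \<Rightarrow> bool" where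
  "self_similar_energy K F E r \<longleftrightarrow>
     (\<forall>f\<in>F. \<forall>i\<in>carpet_letters. f \<circ> carpet_map i \<in> F) \<and>
     (\<forall>f\<in>F. r * (\<Sum>i\<in>carpet_letters. E (f \<circ> carpet_map i)) = E f) \<and>
     {f \<in> F. continuous_on K f} =
       {f. continuous_on K f \<and> (\<forall>i\<in>carpet_letters. f \<circ> carpet_map i \<in> F)}"

definition is_carpet_p_energy ::
    "plane set \<Rightarrow> plane measure \<Rightarrow> real \<Rightarrow> real \<Rightarrow> ((plane \<Rightarrow> real) \<Rightarrow> real) \<Rightarrow> bool" where
  "is_carpet_p_energy K m p \<rho> E \<longleftrightarrow>
     (let F = sobolev_space K m p \<rho> in
      nonneg_functional m F E \<and>
      seminorm_on m F (\<lambda>f. E f powr (1 / p)) \<and>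
      uniformly_convex_on F (\<lambda>f. E f powr (1 / p)) \<and>
      (\<forall>\<phi>. 1-lipschitz_on UNIV \<phi> \<longrightarrow> (\<forall>f\<in>F. \<phi> \<circ> f \<in> F \<and> E (\<phi> \<circ> f) \<le> E f)) \<and>
      (\<forall>f\<in>F. E f = 0 \<longleftrightarrow> ae_constant m f) \<and>
      (\<forall>f\<in>F. \<forall>g\<in>F. \<forall>h\<in>F.
         (\<exists>a. density_support m f \<inter> density_support m (\<lambda>x. g x - a) = {}) \<longrightarrow>
         E (\<lambda>x. f x + g x + h x) + E h = E (\<lambda>x. f x + h x) + E (\<lambda>x. g x + h x)) \<and>
      self_similar_energy K F E \<rho> \<and>
      symmetry_invariant F E \<and>
      (\<exists>C\<ge>1.
         (\<forall>f\<in>F. sobolev_seminorm K m p \<rho> f / C \<le> E f powr (1 / p) \<and>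
                 E f powr (1 / p) \<le> C * sobolev_seminorm K m p \<rho> f) \<and>
         (\<forall>f\<in>F. Lp_norm m p (\<lambda>x. f x - (\<integral>y. f y \<partial>m)) powr p \<le> C * E f)))"

end

theory Submission
  imports Defs
begin

text \<open>Up to the factor \<open>r ^ n\<close>, the discrete energies \<open>r ^ n * graph_energy K p n (cell_average K m f)\<close> are
  defined by \<open>K\<close>, \<open>m\<close> and \<open>p\<close> alone. The point is that \<^emph>\<open>any\<close>
  functional \<open>Es\<close> as in the theorem, with scaling factor \<open>r\<close>, is
  comparable with their supremum over \<open>n\<close>. Once this is known for \<open>r\<close>, and \<open>r\<close> is identified with
  \<open>\<rho>\<close>, the domain of \<open>Es\<close> is the Sobolev space and \<open>Es\<close> is comparable with the Sobolev seminorm, hence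
  with every energy \<open>Ep\<close> that is comparable with that seminorm.

  \<^emph>\<open>Discrete energies are bounded by \<open>Es\<close>\<close> (\<open>graph_energy_le_Es\<close>). By density \<open>f\<close> may be taken continuous,
  and by self-similarity it suffices to bound
  the difference of the averages of \<open>f\<close> over two cells that share an edge by the energies of
  \<open>f\<close> on these two cells. Let \<open>g\<close> and \<open>h\<close> be the two rescaled pieces; they agree along the common
  edge. Put \<open>g\<close> on the first column of the eight cells of level one and \<open>h\<close> on the remaining cells,
  each reflected where necessary so that neighbouring pieces fit. The result is continuous, so it
  lies in the domain, and its energy is at most a multiple of \<open>Es g + Es h\<close>. The spectral gap for this single
  function compares the average of \<open>g\<close> with that of \<open>h\<close>. Cells that share
  only a corner have a common edge neighbour.

  \<^emph>\<open>\<open>Es\<close> is bounded by the discrete energies\<close> (\<open>bounded_discrete_energies\<close>). Regularity, contraction and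
  symmetry produce one bump function at a corner of the square whose four reflections sum to 1
  and which vanishes on the two sides away from it. With rescaled copies of it, values on the cells
  of level \<open>n\<close> are interpolated to a continuous function whose energy is at most a constant times
  the discrete one (\<open>discrete_interpolation\<close>). The interpolations of the cell averages of \<open>f\<close> converge
  to \<open>f\<close> in \<open>L\<^sup>1\<close>, and uniform convexity together with completeness turns an \<open>L\<^sup>1\<close> limit
  of functions bounded in the energy norm into an element of the domain (\<open>mem_Fs_of_L1_limit\<close>).

  \<^emph>\<open>The scaling factor\<close> (\<open>scaling_constant_unique\<close>). Cell averages of interpolated cutoff functions show that
  the conductances are at most a constant times \<open>r\<close> to the power \<open>-n\<close>. Conversely, the interpolation of any
  test function for the cell 1 is 0 on the cell 11 and 1 on the cell 55, so that the spectral gap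
  bounds its energy from below. Both bounds together give \<open>r = \<rho>\<close>.\<close>

section \<open>Grid positions of the cells\<close>

definition letter_x :: "nat \<Rightarrow> int" where
  "letter_x i = [-1, 0, 1, 1, 1, 0, -1, -1] ! (i - 1)"

definition letter_y :: "nat \<Rightarrow> int" where
  "letter_y i = [-1, -1, -1, 0, 1, 1, 1, 0] ! (i - 1)"

lemma carpet_letters_eq: "carpet_letters = {1, 2, 3, 4, 5, 6, 7, 8}"
  by (auto simp: carpet_letters_def)

lemma finite_carpet_letters [simp]: "finite carpet_letters"
  by (simp add: carpet_letters_def)

lemma card_carpet_letters [simp]: "card carpet_letters = 8"
  by (simp add: carpet_letters_def)

lemma carpet_letters_cases:
  assumes "i \<in> carpet_letters"
  obtains "i = 1" | "i = 2" | "i = 3" | "i = 4" | "i = 5" | "i = 6" | "i = 7" | "i = 8"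
  using assms by (auto simp: carpet_letters_eq)

lemma letter_coordinates:
  "letter_x (Suc 0) = -1" "letter_x 2 = 0" "letter_x 3 = 1" "letter_x 4 = 1"
  "letter_x 5 = 1" "letter_x 6 = 0" "letter_x 7 = -1" "letter_x 8 = -1"
  "letter_y (Suc 0) = -1" "letter_y 2 = -1" "letter_y 3 = -1" "letter_y 4 = 0"
  "letter_y 5 = 1" "letter_y 6 = 1" "letter_y 7 = 1" "letter_y 8 = 0"
  by (simp_all add: letter_x_def letter_y_def)

lemma carpet_pt_letter:
  "i \<in> carpet_letters \<Longrightarrow> carpet_pt i = (of_int (letter_x i), of_int (letter_y i))"
  by (elim carpet_letters_cases) (simp_all add: carpet_pt_def letter_coordinates)

lemma letter_bounds:
  assumes "i \<in> carpet_letters"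
  shows "letter_x i \<in> {-1, 0, 1}" "letter_y i \<in> {-1, 0, 1}"
    "letter_x i \<noteq> 0 \<or> letter_y i \<noteq> 0"
  using assms by (elim carpet_letters_cases; simp add: letter_coordinates)+

lemma letter_exists:
  assumes "a \<in> {-1, 0, 1}" "b \<in> {-1, 0, 1}" "a \<noteq> 0 \<or> b \<noteq> 0"
  obtains i where "i \<in> carpet_letters" "letter_x i = a" "letter_y i = b"
proof -
  have "\<exists>i\<in>carpet_letters. letter_x i = a \<and> letter_y i = b"
    using assms by (auto simp: carpet_letters_eq letter_coordinates)
  then show ?thesis using that by blast
qed

lemma letter_inj:
  assumes "i \<in> carpet_letters" "j \<in> carpet_letters"
    "letter_x i = letter_x j" "letter_y i = letter_y j"
  shows "i = j"
  using assms by (elim carpet_letters_cases; simp add: letter_coordinates)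

lemma carpet_map_letter:
  "i \<in> carpet_letters \<Longrightarrow>
     carpet_map i z = ((fst z + 2 * letter_x i) / 3, (snd z + 2 * letter_y i) / 3)"
  by (cases z) (simp add: carpet_map_def carpet_pt_letter field_simps)

subsection \<open>Words and their positions on the grid\<close>

text \<open>The cell of a word of length \<open>n\<close> is the carpet scaled by \<open>3\<close> to the power \<open>-n\<close> and shifted by
  twice an integer vector in that scale. The coordinates of this vector are the balanced
  ternary numbers with the coordinates of the letters as digits, which turns all questions on
  incidence of cells into integer arithmetic.\<close>

primrec word_pos :: "(nat \<Rightarrow> int) \<Rightarrow> nat list \<Rightarrow> int" where
  "word_pos c [] = 0"
| "word_pos c (i # w) = 3 ^ length w * c i + word_pos c w"

abbreviation "word_x \<equiv> word_pos letter_x"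
abbreviation "word_y \<equiv> word_pos letter_y"

lemma word_pos_append: "word_pos c (u @ v) = 3 ^ length v * word_pos c u + word_pos c v"
  by (induction u) (simp_all add: algebra_simps power_add)

lemma word_pos_snoc: "word_pos c (w @ [i]) = 3 * word_pos c w + c i"
  by (simp add: word_pos_append)

lemma carpet_words_0 [simp]: "carpet_words 0 = {[]}"
  by (auto simp: carpet_words_def)

lemma finite_carpet_words [simp]: "finite (carpet_words n)"
  using finite_lists_length_eq[OF finite_carpet_letters, of n]
  by (simp add: carpet_words_def conj_commute)

lemma card_carpet_words: "card (carpet_words n) = 8 ^ n"
  using card_lists_length_eq[OF finite_carpet_letters, of n]
  by (simp add: carpet_words_def conj_commute)

lemma carpet_words_Suc: "carpet_words (Suc n) = (\<lambda>(i, w). i # w) ` (carpet_letters \<times> carpet_words n)"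
  by (auto simp: carpet_words_def length_Suc_conv image_iff)

lemma Cons_carpet_words [simp]:
  "i # w \<in> carpet_words (Suc n) \<longleftrightarrow> i \<in> carpet_letters \<and> w \<in> carpet_words n"
  by (auto simp: carpet_words_def)

lemma append_carpet_words:
  "u \<in> carpet_words m \<Longrightarrow> v \<in> carpet_words n \<Longrightarrow> u @ v \<in> carpet_words (m + n)"
  by (auto simp: carpet_words_def)

lemma snoc_carpet_words [simp]:
  "w @ [i] \<in> carpet_words (Suc n) \<longleftrightarrow> i \<in> carpet_letters \<and> w \<in> carpet_words n"
  by (auto simp: carpet_words_def)

lemma carpet_words_snocE:
  assumes "w \<in> carpet_words (Suc n)"
  obtains w' i where "w = w' @ [i]" "i \<in> carpet_letters" "w' \<in> carpet_words n"
  using assms by (cases w rule: rev_cases) (auto simp: carpet_words_def)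

lemma length_carpet_words: "w \<in> carpet_words n \<Longrightarrow> length w = n"
  by (simp add: carpet_words_def)

lemma sum_carpet_words_Suc:
  "(\<Sum>w\<in>carpet_words (Suc n). h w) = (\<Sum>i\<in>carpet_letters. \<Sum>w\<in>carpet_words n. h (i # w))"
proof -
  have "inj_on (\<lambda>(i, w). i # w) (carpet_letters \<times> carpet_words n)"
    by (auto simp: inj_on_def)
  then show ?thesis
    by (simp add: carpet_words_Suc sum.reindex sum.cartesian_product comp_def case_prod_unfold)
qed

lemma word_pos_inj:
  "u \<in> carpet_words n \<Longrightarrow> v \<in> carpet_words n \<Longrightarrow> word_x u = word_x v \<Longrightarrow> word_y u = word_y v
     \<Longrightarrow> u = v"
proof (induction n arbitrary: u v)
  case (Suc n)
  obtain u' i where u: "u = u' @ [i]" "i \<in> carpet_letters" "u' \<in> carpet_words n"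
    using Suc.prems by (auto elim: carpet_words_snocE)
  obtain v' j where v: "v = v' @ [j]" "j \<in> carpet_letters" "v' \<in> carpet_words n"
    using Suc.prems by (auto elim: carpet_words_snocE)
  have *: "a = b \<and> c = d" if "3 * a + c = 3 * b + d" "c \<in> {-1, 0, 1}" "d \<in> {-1, 0, 1}" for a b c d :: int
  proof -
    have "a - b \<le> 0" "b - a \<le> 0" using that by auto
    then show ?thesis using that(1) by simp
  qed
  have x: "word_x u' = word_x v'" "letter_x i = letter_x j"
    using *[of "word_x u'" "letter_x i"] Suc.prems(3) letter_bounds(1)[OF u(2)] letter_bounds(1)[OF v(2)]
    unfolding u(1) v(1) word_pos_snoc by blast+
  have y: "word_y u' = word_y v'" "letter_y i = letter_y j"
    using *[of "word_y u'" "letter_y i"] Suc.prems(4) letter_bounds(2)[OF u(2)] letter_bounds(2)[OF v(2)]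
    unfolding u(1) v(1) word_pos_snoc by blast+
  show ?case
    unfolding u(1) v(1)
    using Suc.IH[OF u(3) v(3) x(1) y(1)] letter_inj[OF u(2) v(2) x(2) y(2)] by simp
qed auto

lemma carpet_word_map_Nil [simp]: "carpet_word_map [] = id"
  by (simp add: carpet_word_map_def)

lemma carpet_word_map_Cons: "carpet_word_map (i # w) = carpet_map i \<circ> carpet_word_map w"
  by (simp add: carpet_word_map_def)

lemma carpet_word_map_append:
  "carpet_word_map (u @ v) = carpet_word_map u \<circ> carpet_word_map v"
  by (induction u) (simp_all add: carpet_word_map_Cons comp_assoc)

lemma carpet_word_map_pos:
  "w \<in> carpet_words n \<Longrightarrow>
     carpet_word_map w z = ((fst z + 2 * word_x w) / 3 ^ n, (snd z + 2 * word_y w) / 3 ^ n)"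
proof (induction n arbitrary: w)
  case (Suc n)
  then obtain i w' where w: "w = i # w'" "i \<in> carpet_letters" "w' \<in> carpet_words n"
    by (auto simp: carpet_words_Suc)
  have "length w' = n" using w(3) by (rule length_carpet_words)
  then show ?case
    using Suc.IH[OF w(3)] w(2) by (simp add: w(1) carpet_word_map_Cons carpet_map_letter field_simps)
qed (auto)

definition near_words :: "nat list \<Rightarrow> nat list \<Rightarrow> bool" where
  "near_words u v \<longleftrightarrow> \<bar>word_x u - word_x v\<bar> \<le> 1 \<and> \<bar>word_y u - word_y v\<bar> \<le> 1"

lemma near_words_refl [simp]: "near_words u u"
  by (simp add: near_words_def)

lemma near_words_sym: "near_words u v \<longleftrightarrow> near_words v u"
  by (auto simp: near_words_def)

lemma card_near_words:
  "card {v \<in> carpet_words n. near_words u v} \<le> 9"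
proof -
  let ?S = "{v \<in> carpet_words n. near_words u v}"
  let ?B = "{word_x u - 1..word_x u + 1} \<times> {word_y u - 1..word_y u + 1}"
  have "inj_on (\<lambda>v. (word_x v, word_y v)) ?S"
    using word_pos_inj by (auto simp: inj_on_def)
  moreover have "(\<lambda>v. (word_x v, word_y v)) ` ?S \<subseteq> ?B"
    by (auto simp: near_words_def)
  ultimately have "card ?S \<le> card ?B"
    by (intro card_inj_on_le) auto
  also have "card ?B = 9" by (simp add: card_cartesian_product)
  finally show ?thesis .
qed

lemma ternary_step:
  fixes a s x y :: int
  assumes "3 * a + y - x = s" "s = 1 \<or> s = -1" "x \<in> {-1, 0, 1}" "y \<in> {-1, 0, 1}"
  shows "(a = 0 \<and> y = x + s) \<or> (a = s \<and> x = s \<and> y = - s)"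
proof -
  have "a = -1 \<or> a = 0 \<or> a = 1" using assms by auto
  then show ?thesis using assms by auto
qed

text \<open>Two cells may meet in a single point, and points can have zero capacity, so averages over
  such cells are compared through a third cell. It exists because of the position of the holes:
  descending to the last letter, either both cells lie in the same or in edge-adjacent parents,
  where one of the two candidate positions carries a letter as only the centre of a parent is
  missing, or the parents themselves meet diagonally, and the common neighbour of the parents
  has a suitable boundary child.\<close>

lemma corner_common_neighbour:
  assumes "u \<in> carpet_words n" "v \<in> carpet_words n" "\<bar>s\<bar> = 1" "\<bar>t\<bar> = 1"
    "word_x v = word_x u + s" "word_y v = word_y u + t"
  shows "\<exists>w\<in>carpet_words n. (word_x w = word_x u + s \<and> word_y w = word_y u) \<or>
                            (word_x w = word_x u \<and> word_y w = word_y u + t)"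
  using assms
proof (induction n arbitrary: u v)
  case (Suc n)
  obtain u' i where u: "u = u' @ [i]" "i \<in> carpet_letters" "u' \<in> carpet_words n"
    using Suc.prems by (auto elim: carpet_words_snocE)
  obtain v' j where v: "v = v' @ [j]" "j \<in> carpet_letters" "v' \<in> carpet_words n"
    using Suc.prems by (auto elim: carpet_words_snocE)
  note bi = letter_bounds[OF u(2)] and bj = letter_bounds[OF v(2)]
  have st: "s = 1 \<or> s = -1" "t = 1 \<or> t = -1" using Suc.prems by auto
  have mem: "s \<in> {-1, 0, 1}" "- s \<in> {-1, 0, 1}" "s \<noteq> 0" "- s \<noteq> 0"
    "t \<in> {-1, 0, 1}" "- t \<in> {-1, 0, 1}" "t \<noteq> 0" "- t \<noteq> 0" using st by auto
  define a where "a = word_x v' - word_x u'"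
  define b where "b = word_y v' - word_y u'"
  have a: "word_x v' = word_x u' + a" and b: "word_y v' = word_y u' + b"
    by (simp_all add: a_def b_def)
  have ax: "3 * a + letter_x j - letter_x i = s" and bx: "3 * b + letter_y j - letter_y i = t"
    using Suc.prems(5,6) by (simp_all add: u v word_pos_snoc a b)
  have ca: "(a = 0 \<and> letter_x j = letter_x i + s) \<or> (a = s \<and> letter_x i = s \<and> letter_x j = -s)"
    using ternary_step[OF ax st(1) bi(1) bj(1)] .
  have cb: "(b = 0 \<and> letter_y j = letter_y i + t) \<or> (b = t \<and> letter_y i = t \<and> letter_y j = -t)"
    using ternary_step[OF bx st(2) bi(2) bj(2)] .
  have *: ?case if "w' \<in> carpet_words n" "k \<in> carpet_letters"
    "(3 * word_x w' + letter_x k = 3 * word_x u' + letter_x i + s \<and>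
      3 * word_y w' + letter_y k = 3 * word_y u' + letter_y i) \<or>
     (3 * word_x w' + letter_x k = 3 * word_x u' + letter_x i \<and>
      3 * word_y w' + letter_y k = 3 * word_y u' + letter_y i + t)" for w' k
    using that by (intro bexI[of _ "w' @ [k]"]) (auto simp: u word_pos_snoc)
  consider "a = 0" "b = 0" | "a = s" "b = 0" | "a = 0" "b = t" | "a = s" "b = t"
    using ca cb by blast
  then show ?case
  proof cases
    case 1
    then have e: "letter_x j = letter_x i + s" "letter_y j = letter_y i + t"
      using ca cb st by auto
    show ?thesis
    proof (cases "letter_x j = 0 \<and> letter_y i = 0")
      case False
      then obtain k where "k \<in> carpet_letters" "letter_x k = letter_x j" "letter_y k = letter_y i"
        using letter_exists[of "letter_x j" "letter_y i"] bi bj by blast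
      then show ?thesis using *[OF u(3), of k] e by auto
    next
      case True
      then have "letter_x i \<noteq> 0" using bi by auto
      then obtain k where "k \<in> carpet_letters" "letter_x k = letter_x i" "letter_y k = letter_y j"
        using letter_exists[of "letter_x i" "letter_y j"] bi bj by blast
      then show ?thesis using *[OF u(3), of k] e by auto
    qed
  next
    case 2
    then have e: "letter_x i = s" using ca st by auto
    obtain k where "k \<in> carpet_letters" "letter_x k = - s" "letter_y k = letter_y i"
      using letter_exists[of "-s" "letter_y i"] bi mem by blast
    then show ?thesis using *[OF v(3), of k] e 2 a b by auto
  next
    case 3
    then have e: "letter_y i = t" using cb st by auto
    obtain k where "k \<in> carpet_letters" "letter_y k = - t" "letter_x k = letter_x i"
      using letter_exists[of "letter_x i" "-t"] bi mem by blast
    then show ?thesis using *[OF v(3), of k] e 3 a b by auto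
  next
    case 4
    then have e: "letter_x i = s" "letter_y i = t" using ca cb st by auto
    obtain w' where w': "w' \<in> carpet_words n"
      "(word_x w' = word_x u' + s \<and> word_y w' = word_y u') \<or>
       (word_x w' = word_x u' \<and> word_y w' = word_y u' + t)"
      using Suc.IH[OF u(3) v(3)] Suc.prems(3,4) a b 4 by auto
    obtain k where k: "k \<in> carpet_letters" "letter_x k = - s" "letter_y k = t"
      using letter_exists[of "-s" t] mem by blast
    obtain l where l: "l \<in> carpet_letters" "letter_x l = s" "letter_y l = - t"
      using letter_exists[of s "-t"] mem by blast
    show ?thesis
      using *[OF w'(1) k(1)] *[OF w'(1) l(1)] w'(2) k l e by auto
  qed
qed auto

section \<open>The carpet as a set\<close>

lemma dist_carpet_map: "dist (carpet_map i a) (carpet_map i b) = dist a b / 3"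
  by (simp add: carpet_map_def dist_norm flip: scaleR_diff_right)

lemma continuous_on_carpet_map [continuous_intros]: "continuous_on A (carpet_map i)"
  unfolding carpet_map_def[abs_def] by (intro continuous_intros)

lemma continuous_on_carpet_word_map: "continuous_on A (carpet_word_map w)"
proof (induction w arbitrary: A)
  case (Cons i w)
  show ?case
    unfolding carpet_word_map_Cons by (intro continuous_on_compose Cons.IH continuous_intros)
qed (simp add: continuous_on_id')

text \<open>A point of \<open>A\<close> at maximal distance from \<open>B\<close> is the image of another point of \<open>A\<close> under a
  contraction that preserves \<open>B\<close>; so the maximal distance is at most a third of itself. This one
  argument locates the carpet inside the square, puts the corners of the square into
  the carpet, and shows its symmetry.\<close>

lemma self_covered_subset_of_invariant:
  assumes A: "compact A" "A \<subseteq> (\<Union>i\<in>carpet_letters. carpet_map i ` A)"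
    and B: "closed B" "B \<noteq> {}" "\<And>i. i \<in> carpet_letters \<Longrightarrow> carpet_map i ` B \<subseteq> B"
  shows "A \<subseteq> B"
proof (cases "A = {}")
  case False
  have "continuous_on A (\<lambda>x. infdist x B)" by (intro continuous_intros)
  then obtain x where x: "x \<in> A" "\<And>y. y \<in> A \<Longrightarrow> infdist y B \<le> infdist x B"
    using continuous_attains_sup[OF A(1) False] by blast
  obtain i z where z: "i \<in> carpet_letters" "z \<in> A" "x = carpet_map i z"
    using x(1) A(2) by blast
  obtain b where b: "b \<in> B" "infdist z B = dist z b"
    using infdist_attains_inf[OF B(1,2)] by blast
  have "infdist x B \<le> dist x (carpet_map i b)"
    using B(3)[OF z(1)] b(1) by (intro infdist_le) auto
  also have "\<dots> = infdist z B / 3" by (simp add: z(3) dist_carpet_map b(2))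
  also have "\<dots> \<le> infdist x B / 3" using x(2)[OF z(2)] by simp
  finally have "infdist x B = 0" using infdist_nonneg[of x B] by linarith
  then have "infdist y B = 0" if "y \<in> A" for y
    using x(2)[OF that] infdist_nonneg[of y B] by linarith
  then show ?thesis using in_closed_iff_infdist_zero[OF B(1,2)] by blast
qed auto

definition reflect_x :: "plane \<Rightarrow> plane" where "reflect_x z = (- fst z, snd z)"
definition reflect_y :: "plane \<Rightarrow> plane" where "reflect_y z = (fst z, - snd z)"
definition swap_axes :: "plane \<Rightarrow> plane" where "swap_axes z = (snd z, fst z)"

lemma reflect_simps [simp]:
  "reflect_x (a, b) = (- a, b)" "reflect_y (a, b) = (a, - b)" "swap_axes (a, b) = (b, a)"
  by (simp_all add: reflect_x_def reflect_y_def swap_axes_def)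

lemma box_preserving:
  fixes \<Phi> :: "plane \<Rightarrow> plane"
  assumes inv: "\<And>z. \<Phi> (\<Phi> z) = z" and sub: "\<Phi> ` cbox (-1,-1) (1,1) \<subseteq> cbox (-1,-1) (1,1)"
  shows "\<Phi> ` cbox (-1,-1) (1,1) = cbox (-1,-1) (1,1)"
proof -
  have "z \<in> \<Phi> ` cbox (-1,-1) (1,1)" if "z \<in> cbox (-1,-1) (1,1)" for z
  proof -
    have "\<Phi> z \<in> cbox (-1,-1) (1,1)" using that sub by blast
    then show ?thesis using inv[of z] by (metis imageI)
  qed
  then show ?thesis using sub by blast
qed

lemma plane_box_iff: "z \<in> cbox (-1,-1) (1,1) \<longleftrightarrow> \<bar>fst z\<bar> \<le> 1 \<and> \<bar>snd z\<bar> \<le> 1"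
  for z :: plane
  by (cases z) (auto simp: cbox_Pair_eq cbox_interval)

lemma carpet_symmetries_generators:
  "reflect_x \<in> carpet_symmetries" "reflect_y \<in> carpet_symmetries" "swap_axes \<in> carpet_symmetries"
proof -
  have *: "\<Phi> \<in> carpet_symmetries"
    if "linear \<Phi>" "\<And>z. norm (\<Phi> z) = norm z" "\<And>z. \<Phi> (\<Phi> z) = z"
      "\<And>z. \<bar>fst z\<bar> \<le> 1 \<and> \<bar>snd z\<bar> \<le> 1 \<Longrightarrow> \<bar>fst (\<Phi> z)\<bar> \<le> 1 \<and> \<bar>snd (\<Phi> z)\<bar> \<le> 1" for \<Phi>
    using that box_preserving[of \<Phi>]
    by (auto simp: carpet_symmetries_def orthogonal_transformation plane_box_iff image_subset_iff)
  have lin: "linear reflect_x" "linear reflect_y" "linear swap_axes"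
    by (auto intro!: linearI simp: reflect_x_def reflect_y_def swap_axes_def)
  show "reflect_x \<in> carpet_symmetries"
    using lin by (intro *) (auto simp: norm_prod_def reflect_x_def)
  show "reflect_y \<in> carpet_symmetries"
    using lin by (intro *) (auto simp: norm_prod_def reflect_y_def)
  show "swap_axes \<in> carpet_symmetries"
    using lin by (intro *) (auto simp: norm_prod_def swap_axes_def add.commute)
qed

locale carpet =
  fixes K :: "plane set"
  assumes is_carpet: "is_carpet K"
begin

lemma compact_K: "compact K" and K_nonempty: "K \<noteq> {}"
  and K_eq: "K = (\<Union>i\<in>carpet_letters. carpet_map i ` K)"
  using is_carpet unfolding is_carpet_def by blast+

lemma closed_K: "closed K"
  by (rule compact_imp_closed[OF compact_K])

lemma carpet_map_in_K: "i \<in> carpet_letters \<Longrightarrow> x \<in> K \<Longrightarrow> carpet_map i x \<in> K"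
  using K_eq by blast

lemma carpet_word_map_in_K: "w \<in> carpet_words n \<Longrightarrow> x \<in> K \<Longrightarrow> carpet_word_map w x \<in> K"
proof (induction n arbitrary: w)
  case (Suc n)
  then show ?case
    by (auto simp: carpet_words_Suc carpet_word_map_Cons intro!: carpet_map_in_K)
qed auto

lemma K_cells: "K = (\<Union>w\<in>carpet_words n. carpet_cell K w)"
proof (induction n)
  case (Suc n)
  have "(\<Union>w\<in>carpet_words (Suc n). carpet_cell K w) =
      (\<Union>i\<in>carpet_letters. \<Union>w\<in>carpet_words n. carpet_cell K (i # w))"
    by (auto simp: carpet_words_Suc)
  also have "\<dots> = (\<Union>i\<in>carpet_letters. \<Union>w\<in>carpet_words n. carpet_map i ` carpet_cell K w)"
    by (simp add: carpet_word_map_Cons image_comp)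
  also have "\<dots> = (\<Union>i\<in>carpet_letters. carpet_map i ` K)"
    by (subst (2) Suc.IH) (simp add: image_UN)
  finally show ?case using K_eq by simp
qed auto

lemma K_cellE:
  assumes "x \<in> K"
  obtains w a where "w \<in> carpet_words n" "a \<in> K" "x = carpet_word_map w a"
  using assms K_cells[of n] by blast

lemma K_subset_box:
  assumes "z \<in> K"
  shows "\<bar>fst z\<bar> \<le> 1" "\<bar>snd z\<bar> \<le> 1"
proof -
  have box: "carpet_map i ` cbox (-1,-1) (1,1) \<subseteq> cbox (-1,-1) (1,1)" if "i \<in> carpet_letters" for i
  proof (rule image_subsetI)
    fix z :: plane assume "z \<in> cbox (-1,-1) (1,1)"
    then have "\<bar>fst z\<bar> \<le> 1" "\<bar>snd z\<bar> \<le> 1" by (simp_all add: plane_box_iff)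
    moreover have "\<bar>real_of_int (letter_x i)\<bar> \<le> 1" "\<bar>real_of_int (letter_y i)\<bar> \<le> 1"
      using letter_bounds(1,2)[OF that] by auto
    ultimately have "\<bar>(fst z + 2 * real_of_int (letter_x i)) / 3\<bar> \<le> 1"
      "\<bar>(snd z + 2 * real_of_int (letter_y i)) / 3\<bar> \<le> 1"
      by (simp_all add: abs_le_iff)
    then show "carpet_map i z \<in> cbox (-1,-1) (1,1)"
      by (simp add: plane_box_iff carpet_map_letter[OF that])
  qed
  have "K \<subseteq> cbox (-1,-1) (1,1)"
    by (rule self_covered_subset_of_invariant[OF compact_K equalityD1[OF K_eq] closed_cbox _ box])
       (simp_all add: plane_box_iff cbox_Pair_eq)
  then show "\<bar>fst z\<bar> \<le> 1" "\<bar>snd z\<bar> \<le> 1" using assms plane_box_iff by blast+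
qed

lemma self_covered_subset_K:
  assumes "compact A" "A \<subseteq> (\<Union>i\<in>carpet_letters. carpet_map i ` A)"
  shows "A \<subseteq> K"
  by (rule self_covered_subset_of_invariant[OF assms closed_K K_nonempty]) (use carpet_map_in_K in auto)

lemma corner_in_K:
  assumes "s \<in> {-1, 1}" "t \<in> {-1, 1}"
  shows "(s, t) \<in> K"
proof -
  have fl: "\<lfloor>- 1 :: real\<rfloor> = - 1" by linarith
  have s: "s = real_of_int \<lfloor>s\<rfloor>" "\<lfloor>s\<rfloor> \<in> {-1, 0, 1}" "\<lfloor>s\<rfloor> \<noteq> 0"
    using assms(1) fl by auto
  have t: "t = real_of_int \<lfloor>t\<rfloor>" "\<lfloor>t\<rfloor> \<in> {-1, 0, 1}"
    using assms(2) fl by auto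
  obtain i where i: "i \<in> carpet_letters" "letter_x i = \<lfloor>s\<rfloor>" "letter_y i = \<lfloor>t\<rfloor>"
    using letter_exists[OF s(2) t(2)] s(3) by blast
  then have "real_of_int (letter_x i) = s" "real_of_int (letter_y i) = t" using s(1) t(1) by simp_all
  then have "carpet_map i (s, t) = (s, t)"
    using carpet_map_letter[OF i(1), of "(s, t)"] by simp
  then have "(s, t) \<in> carpet_map i ` {(s, t)}" by simp
  then have "{(s, t)} \<subseteq> K"
    using i(1) by (intro self_covered_subset_K compact_sing) blast
  then show ?thesis by simp
qed

lemma symmetric_K:
  assumes \<Phi>: "continuous_on K \<Phi>"
    and perm: "\<And>i. i \<in> carpet_letters \<Longrightarrow> \<exists>j\<in>carpet_letters. \<forall>z. \<Phi> (carpet_map i z) = carpet_map j (\<Phi> z)"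
    and x: "x \<in> K"
  shows "\<Phi> x \<in> K"
proof -
  have "\<Phi> ` K \<subseteq> K"
  proof (rule self_covered_subset_K)
    show "compact (\<Phi> ` K)" by (rule compact_continuous_image[OF \<Phi> compact_K])
    show "\<Phi> ` K \<subseteq> (\<Union>i\<in>carpet_letters. carpet_map i ` \<Phi> ` K)"
    proof (rule image_subsetI)
      fix x assume "x \<in> K"
      then obtain i z where "i \<in> carpet_letters" "z \<in> K" "x = carpet_map i z" using K_eq by blast
      then show "\<Phi> x \<in> (\<Union>i\<in>carpet_letters. carpet_map i ` \<Phi> ` K)" using perm[of i] by blast
    qed
  qed
  then show ?thesis using x by blast
qed

lemma continuous_on_reflections:
  "continuous_on A reflect_x" "continuous_on A reflect_y" "continuous_on A swap_axes"
  unfolding reflect_x_def[abs_def] reflect_y_def[abs_def] swap_axes_def[abs_def]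
  by (intro continuous_intros)+

lemma reflect_in_K:
  assumes "z \<in> K"
  shows "reflect_x z \<in> K" "reflect_y z \<in> K" "swap_axes z \<in> K"
proof -
  show "reflect_x z \<in> K"
  proof (rule symmetric_K[OF _ _ assms])
    fix i assume i: "i \<in> carpet_letters"
    obtain j where j: "j \<in> carpet_letters" "letter_x j = - letter_x i" "letter_y j = letter_y i"
      using letter_exists[of "- letter_x i" "letter_y i"] letter_bounds[OF i] by auto
    then show "\<exists>j\<in>carpet_letters. \<forall>z. reflect_x (carpet_map i z) = carpet_map j (reflect_x z)"
      by (intro bexI[of _ j]) (auto simp: carpet_map_letter i field_simps)
  qed (rule continuous_on_reflections)
  show "reflect_y z \<in> K"
  proof (rule symmetric_K[OF _ _ assms])
    fix i assume i: "i \<in> carpet_letters"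
    obtain j where j: "j \<in> carpet_letters" "letter_x j = letter_x i" "letter_y j = - letter_y i"
      using letter_exists[of "letter_x i" "- letter_y i"] letter_bounds[OF i] by auto
    then show "\<exists>j\<in>carpet_letters. \<forall>z. reflect_y (carpet_map i z) = carpet_map j (reflect_y z)"
      by (intro bexI[of _ j]) (auto simp: carpet_map_letter i field_simps)
  qed (rule continuous_on_reflections)
  show "swap_axes z \<in> K"
  proof (rule symmetric_K[OF _ _ assms])
    fix i assume i: "i \<in> carpet_letters"
    obtain j where j: "j \<in> carpet_letters" "letter_x j = letter_y i" "letter_y j = letter_x i"
      using letter_exists[of "letter_y i" "letter_x i"] letter_bounds[OF i] by auto
    then show "\<exists>j\<in>carpet_letters. \<forall>z. swap_axes (carpet_map i z) = carpet_map j (swap_axes z)"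
      by (intro bexI[of _ j]) (auto simp: carpet_map_letter i field_simps)
  qed (rule continuous_on_reflections)
qed

lemma cells_meet_iff:
  assumes u: "u \<in> carpet_words n" and v: "v \<in> carpet_words n"
  shows "carpet_word_map u a = carpet_word_map v b \<longleftrightarrow>
     fst a + 2 * word_x u = fst b + 2 * word_x v \<and> snd a + 2 * word_y u = snd b + 2 * word_y v"
  by (simp add: carpet_word_map_pos[OF u] carpet_word_map_pos[OF v])

text \<open>As the carpet contains the four corners of the square, two closed cells that occupy
  neighbouring positions do meet, and adjacency is a condition on positions.\<close>

lemma carpet_adj_iff:
  "(u, v) \<in> carpet_adj K n \<longleftrightarrow>
     u \<in> carpet_words n \<and> v \<in> carpet_words n \<and> u \<noteq> v \<and> near_words u v"
proof -
  have "carpet_cell K u \<inter> carpet_cell K v \<noteq> {} \<longleftrightarrow> near_words u v"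
    if u: "u \<in> carpet_words n" and v: "v \<in> carpet_words n"
  proof
    assume "carpet_cell K u \<inter> carpet_cell K v \<noteq> {}"
    then obtain a b where ab: "a \<in> K" "b \<in> K" "carpet_word_map u a = carpet_word_map v b" by blast
    then have e: "fst a + 2 * word_x u = fst b + 2 * word_x v" "snd a + 2 * word_y u = snd b + 2 * word_y v"
      using cells_meet_iff[OF u v] by blast+
    have "\<bar>real_of_int (word_x u) - real_of_int (word_x v)\<bar> \<le> 1"
      using e(1) K_subset_box(1)[OF ab(1)] K_subset_box(1)[OF ab(2)] by (simp add: abs_le_iff)
    moreover have "\<bar>real_of_int (word_y u) - real_of_int (word_y v)\<bar> \<le> 1"
      using e(2) K_subset_box(2)[OF ab(1)] K_subset_box(2)[OF ab(2)] by (simp add: abs_le_iff)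
    ultimately show "near_words u v"
      unfolding near_words_def by (simp add: flip: of_int_diff of_int_abs)
  next
    assume n: "near_words u v"
    have *: "\<exists>s t. s \<in> {-1, 1::real} \<and> t \<in> {-1, 1} \<and> s + 2 * real_of_int k = t + 2 * real_of_int l"
      if "\<bar>k - l\<bar> \<le> 1" for k l
    proof -
      consider "k = l" | "k = l + 1" | "l = k + 1" using \<open>\<bar>k - l\<bar> \<le> 1\<close> by linarith
      then show ?thesis
      proof cases
        case 1 then show ?thesis by (intro exI[of _ 1]) simp
      next
        case 2 then show ?thesis by (intro exI[of _ "-1"] exI[of _ 1]) simp
      next
        case 3 then show ?thesis by (intro exI[of _ 1] exI[of _ "-1"]) simp
      qed
    qed
    have n': "\<bar>word_x u - word_x v\<bar> \<le> 1" "\<bar>word_y u - word_y v\<bar> \<le> 1"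
      using n by (simp_all add: near_words_def)
    obtain s t :: real where st: "s \<in> {-1,1}" "t \<in> {-1,1}" "s + 2 * real_of_int (word_x u) = t + 2 * real_of_int (word_x v)"
      using *[OF n'(1)] by (elim exE conjE) (rule that)
    obtain s' t' :: real where st': "s' \<in> {-1,1}" "t' \<in> {-1,1}" "s' + 2 * real_of_int (word_y u) = t' + 2 * real_of_int (word_y v)"
      using *[OF n'(2)] by (elim exE conjE) (rule that)
    have "carpet_word_map u (s, s') = carpet_word_map v (t, t')"
      using st(3) st'(3) by (simp add: cells_meet_iff[OF u v])
    moreover have "(s, s') \<in> K" "(t, t') \<in> K"
      by (rule corner_in_K[OF st(1) st'(1)], rule corner_in_K[OF st(2) st'(2)])
    ultimately show "carpet_cell K u \<inter> carpet_cell K v \<noteq> {}" by (metis IntI empty_iff imageI)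
  qed
  then show ?thesis unfolding carpet_adj_def by auto
qed

lemma finite_carpet_adj [simp]: "finite (carpet_adj K n)"
  by (rule finite_subset[of _ "carpet_words n \<times> carpet_words n"]) (auto simp: carpet_adj_iff)

lemma carpet_dist_le_1_iff:
  assumes "u \<in> carpet_words n" "v \<in> carpet_words n"
  shows "carpet_dist K n u v \<le> 1 \<longleftrightarrow> near_words u v"
proof
  assume "near_words u v"
  then have "(u, v) \<in> carpet_adj K n ^^ 0 \<or> (u, v) \<in> carpet_adj K n ^^ 1"
    using assms by (auto simp: carpet_adj_iff)
  then show "carpet_dist K n u v \<le> 1"
  proof
    assume "(u, v) \<in> carpet_adj K n ^^ 0"
    then have "carpet_dist K n u v \<le> enat 0" unfolding carpet_dist_def by (intro INF_lower) simp
    then show ?thesis by (simp flip: zero_enat_def)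
  next
    assume "(u, v) \<in> carpet_adj K n ^^ 1"
    then have "carpet_dist K n u v \<le> enat 1" unfolding carpet_dist_def by (intro INF_lower) simp
    then show ?thesis by (simp add: one_enat_def)
  qed
next
  assume "carpet_dist K n u v \<le> 1"
  then have "carpet_dist K n u v < enat 2" 
    by (rule le_less_trans) (simp add: one_enat_def)
  then obtain k where k: "(u, v) \<in> carpet_adj K n ^^ k" "enat k < enat 2"
    unfolding carpet_dist_def INF_less_iff by blast
  then have "k = 0 \<or> k = 1" by auto
  then show "near_words u v" using k by (auto simp: carpet_adj_iff)
qed

lemma compact_carpet_cell: "compact (carpet_cell K w)"
  by (rule compact_continuous_image[OF continuous_on_carpet_word_map compact_K])

lemma continuous_on_comp_K:
  assumes "continuous_on K f" "continuous_on K \<Phi>" "\<And>z. z \<in> K \<Longrightarrow> \<Phi> z \<in> K"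
  shows "continuous_on K (f \<circ> \<Phi>)"
  by (rule continuous_on_compose[OF assms(2)], rule continuous_on_subset[OF assms(1)])
     (use assms(3) in blast)

lemma continuous_on_comp_word_map:
  "continuous_on K f \<Longrightarrow> w \<in> carpet_words n \<Longrightarrow> continuous_on K (f \<circ> carpet_word_map w)"
  by (rule continuous_on_comp_K[OF _ continuous_on_carpet_word_map]) (simp_all add: carpet_word_map_in_K)

lemma continuous_on_comp_carpet_map:
  "continuous_on K f \<Longrightarrow> i \<in> carpet_letters \<Longrightarrow> continuous_on K (f \<circ> carpet_map i)"
  by (rule continuous_on_comp_K[OF _ continuous_on_carpet_map]) (simp_all add: carpet_map_in_K)

lemma continuous_on_comp_symmetry:
  assumes "continuous_on K f"
  shows "continuous_on K (f \<circ> reflect_x)" "continuous_on K (f \<circ> reflect_y)"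
    "continuous_on K (f \<circ> swap_axes)"
  by (rule continuous_on_comp_K[OF assms continuous_on_reflections(1)],
      erule reflect_in_K,
      rule continuous_on_comp_K[OF assms continuous_on_reflections(2)],
      erule reflect_in_K,
      rule continuous_on_comp_K[OF assms continuous_on_reflections(3)],
      erule reflect_in_K)

lemma glue_continuous:
  fixes g :: "nat list \<Rightarrow> plane \<Rightarrow> real"
  assumes cont: "\<And>w. w \<in> carpet_words n \<Longrightarrow> continuous_on K (g w)"
    and compat: "\<And>u v a b. u \<in> carpet_words n \<Longrightarrow> v \<in> carpet_words n \<Longrightarrow> a \<in> K \<Longrightarrow> b \<in> K \<Longrightarrow>
        carpet_word_map u a = carpet_word_map v b \<Longrightarrow> g u a = g v b"
  obtains G where "continuous_on K G"
    "\<And>w x. w \<in> carpet_words n \<Longrightarrow> x \<in> K \<Longrightarrow> G (carpet_word_map w x) = g w x"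
proof -
  define G where "G y = (THE r. \<exists>w\<in>carpet_words n. \<exists>x\<in>K. y = carpet_word_map w x \<and> r = g w x)" for y
  have G: "G (carpet_word_map w x) = g w x" if "w \<in> carpet_words n" "x \<in> K" for w x
    unfolding G_def
  proof (rule the_equality)
    show "\<exists>v\<in>carpet_words n. \<exists>y\<in>K. carpet_word_map w x = carpet_word_map v y \<and> g w x = g v y"
      using that by blast
    fix r assume "\<exists>v\<in>carpet_words n. \<exists>y\<in>K. carpet_word_map w x = carpet_word_map v y \<and> r = g v y"
    then obtain v y where "v \<in> carpet_words n" "y \<in> K" "carpet_word_map w x = carpet_word_map v y" "r = g v y"
      by (elim bexE conjE) (rule that)
    then show "r = g w x" using compat[OF that(1) _ that(2)] by simp
  qed
  have "continuous_on (\<Union>w\<in>carpet_words n. carpet_cell K w) G"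
  proof (rule continuous_on_closed_Union)
    fix w assume w: "w \<in> carpet_words n"
    show "closed (carpet_cell K w)" by (rule compact_imp_closed[OF compact_carpet_cell])
    define inv :: "plane \<Rightarrow> plane" where
      "inv y = (3 ^ n * fst y - 2 * word_x w, 3 ^ n * snd y - 2 * word_y w)" for y
    have inv: "inv (carpet_word_map w x) = x" for x
      by (simp add: inv_def carpet_word_map_pos[OF w])
    have "continuous_on (carpet_cell K w) inv"
      unfolding inv_def by (intro continuous_intros)
    moreover have "inv ` carpet_cell K w = K" by (simp add: image_image inv)
    ultimately have "continuous_on (carpet_cell K w) (g w \<circ> inv)"
      using cont[OF w] by (intro continuous_on_compose) simp_all
    then show "continuous_on (carpet_cell K w) G"
      by (rule continuous_on_eq) (auto simp: G[OF w] inv)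
  qed simp
  then have "continuous_on K G" using K_cells[of n] by simp
  then show ?thesis using G that by blast
qed

end

section \<open>Convexity of powers and Jensen's inequality\<close>

lemma powr_add_le:
  fixes a b :: real
  assumes "0 < p"
  shows "\<bar>a + b\<bar> powr p \<le> 2 powr p * (\<bar>a\<bar> powr p + \<bar>b\<bar> powr p)"
proof -
  have "\<bar>a + b\<bar> powr p \<le> (2 * max \<bar>a\<bar> \<bar>b\<bar>) powr p"
    using assms by (intro powr_mono2) (auto simp: max_def)
  also have "\<dots> = 2 powr p * max \<bar>a\<bar> \<bar>b\<bar> powr p" by (simp add: powr_mult)
  also have "max \<bar>a\<bar> \<bar>b\<bar> powr p \<le> \<bar>a\<bar> powr p + \<bar>b\<bar> powr p" by (simp add: max_def)
  finally show ?thesis by (simp add: mult_left_mono)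
qed

lemma powr_convex_nonneg:
  assumes p: "1 \<le> p" and t: "0 < t" "t < 1" and xy: "0 \<le> x" "0 \<le> (y::real)"
  shows "((1 - t) * x + t * y) powr p \<le> (1 - t) * x powr p + t * y powr p"
proof -
  have le: "(s * z) powr p \<le> s * z powr p" if "0 < s" "s < 1" for s z :: real
  proof -
    have "s powr p \<le> s powr 1" using that p by (intro powr_mono') auto
    then show ?thesis using that by (simp add: powr_mult mult_right_mono)
  qed
  consider "x = 0" | "y = 0" | "0 < x" "0 < y" using xy by linarith
  then show ?thesis
  proof cases
    case 1
    then show ?thesis using le[OF t] p by simp
  next
    case 2
    then show ?thesis using le[of "1 - t" x] t p by simp
  next
    case 3
    then show ?thesis
      using convex_onD[OF powr_convex[OF p], of t x y] t by simp
  qed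
qed

lemma convex_on_abs_powr:
  assumes p: "1 \<le> p"
  shows "convex_on UNIV (\<lambda>x::real. \<bar>x\<bar> powr p)"
proof (rule convex_onI)
  fix t x y :: real assume t: "0 < t" "t < 1"
  have "\<bar>(1 - t) *\<^sub>R x + t *\<^sub>R y\<bar> \<le> (1 - t) * \<bar>x\<bar> + t * \<bar>y\<bar>"
    using t abs_triangle_ineq[of "(1 - t) * x" "t * y"] by (simp add: abs_mult)
  then have "\<bar>(1 - t) *\<^sub>R x + t *\<^sub>R y\<bar> powr p \<le> ((1 - t) * \<bar>x\<bar> + t * \<bar>y\<bar>) powr p"
    using p by (intro powr_mono2) auto
  also have "\<dots> \<le> (1 - t) * \<bar>x\<bar> powr p + t * \<bar>y\<bar> powr p"
    using powr_convex_nonneg[OF p t] by simp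
  finally show "\<bar>(1 - t) *\<^sub>R x + t *\<^sub>R y\<bar> powr p \<le> (1 - t) * \<bar>x\<bar> powr p + t * \<bar>y\<bar> powr p" .
qed simp

lemma Lp_integrable:
  assumes "prob_space m" "1 \<le> p" "f \<in> Lp m p"
  shows "integrable m f" "integrable m (\<lambda>x. \<bar>f x\<bar> powr p)"
proof -
  interpret prob_space m by fact
  show i: "integrable m (\<lambda>x. \<bar>f x\<bar> powr p)" using assms(3) by (simp add: Lp_def)
  have f: "f \<in> borel_measurable m" using assms(3) by (simp add: Lp_def)
  show "integrable m f"
  proof (rule Bochner_Integration.integrable_bound[OF _ f])
    show "integrable m (\<lambda>x. 1 + \<bar>f x\<bar> powr p)" using i by simp
    have "\<bar>f x\<bar> \<le> 1 + \<bar>f x\<bar> powr p" for x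
    proof (cases "\<bar>f x\<bar> \<le> 1")
      case True
      then show ?thesis using powr_ge_zero[of "\<bar>f x\<bar>" p] by linarith
    next
      case False
      then have "\<bar>f x\<bar> powr 1 \<le> \<bar>f x\<bar> powr p" using assms(2) by (intro powr_mono) auto
      then show ?thesis using False by simp
    qed
    then show "AE x in m. norm (f x) \<le> norm (1 + \<bar>f x\<bar> powr p)" by simp
  qed
qed

lemma Lp_jensen:
  assumes "prob_space m" "1 \<le> p" "f \<in> Lp m p"
  shows "\<bar>\<integral>x. f x \<partial>m\<bar> powr p \<le> (\<integral>x. \<bar>f x\<bar> powr p \<partial>m)"
proof -
  interpret prob_space m by fact
  show ?thesis
    by (rule jensens_inequality[OF Lp_integrable(1)[OF assms] _ _ Lp_integrable(2)[OF assms]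
          convex_on_abs_powr[OF assms(2)]]) auto
qed

section \<open>The self-similar measure\<close>

locale carpet_measure = carpet +
  fixes m :: "plane measure"
  assumes is_carpet_measure: "is_carpet_measure K m"
begin

lemma sets_m: "sets m = sets (restrict_space borel K)"
  and prob_m: "prob_space m"
  and self_similar_m: "A \<in> sets m \<Longrightarrow>
    measure m A = (1/8) * (\<Sum>i\<in>carpet_letters. measure m (carpet_map i -` A \<inter> K))"
  and measure_cell: "w \<in> carpet_words n \<Longrightarrow> measure m (carpet_cell K w) = (1/8) ^ n"
  using is_carpet_measure unfolding is_carpet_measure_def by blast+

sublocale prob_space m by (rule prob_m)

lemma space_m [simp]: "space m = K"
  using sets_eq_imp_space_eq[OF sets_m] by (simp add: space_restrict_space)

lemma closed_in_sets: "closed A \<Longrightarrow> A \<subseteq> K \<Longrightarrow> A \<in> sets m"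
  unfolding sets_m sets_restrict_space by (rule image_eqI[of _ _ A]) auto

lemma cell_in_sets: "w \<in> carpet_words n \<Longrightarrow> carpet_cell K w \<in> sets m"
  by (intro closed_in_sets compact_imp_closed compact_carpet_cell) (auto simp: carpet_word_map_in_K)

lemma continuous_measurable: "continuous_on K f \<Longrightarrow> f \<in> borel_measurable m"
  using borel_measurable_continuous_on_restrict[of K f] measurable_cong_sets[OF sets_m refl, of borel]
  by blast

lemma continuous_map_measurable:
  assumes "continuous_on K \<Phi>" "\<And>z. z \<in> K \<Longrightarrow> \<Phi> z \<in> K"
  shows "\<Phi> \<in> measurable m m"
proof -
  have "\<Phi> \<in> measurable m (restrict_space borel K)"
    using assms(2) by (intro measurable_restrict_space2 continuous_measurable[OF assms(1)]) auto
  then show ?thesis using measurable_cong_sets[OF refl sets_m, of m] by blast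
qed

lemma carpet_map_measurable: "i \<in> carpet_letters \<Longrightarrow> carpet_map i \<in> measurable m m"
  by (intro continuous_map_measurable continuous_on_carpet_map carpet_map_in_K)

lemma continuous_bounded:
  assumes "continuous_on K f"
  obtains B where "\<And>x. x \<in> K \<Longrightarrow> \<bar>f x\<bar> \<le> (B::real)"
proof -
  have "bounded (f ` K)" by (intro compact_imp_bounded compact_continuous_image assms compact_K)
  then obtain B where "\<forall>y\<in>f ` K. norm y \<le> B" by (auto simp: bounded_iff)
  then show ?thesis using that by auto
qed

lemma continuous_integrable:
  assumes "continuous_on K (f :: plane \<Rightarrow> real)"
  shows "integrable m f"
proof -
  obtain B where "\<And>x. x \<in> K \<Longrightarrow> \<bar>f x\<bar> \<le> B" using continuous_bounded[OF assms] by blast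
  then show ?thesis
    by (intro integrable_const_bound[of _ B] continuous_measurable[OF assms]) auto
qed

lemma continuous_Lp:
  assumes f: "continuous_on K f" and p: "0 < p"
  shows "f \<in> Lp m p"
proof -
  have "continuous_on K (\<lambda>x. \<bar>f x\<bar> powr p)"
    using p by (intro continuous_on_powr' continuous_intros f) auto
  then show ?thesis unfolding Lp_def using continuous_integrable continuous_measurable[OF f] by blast
qed

text \<open>The self-similarity of measures of sets passes to integrals at once when it is read as an
  equation between measures: the image of eight copies of \<open>m\<close> under the eight maps is \<open>8 m\<close>.\<close>

lemma nn_integral_self_similar:
  assumes f: "f \<in> borel_measurable m"
  shows "(\<Sum>i\<in>carpet_letters. \<integral>\<^sup>+x. f (carpet_map i x) \<partial>m) = 8 * (\<integral>\<^sup>+x. f x \<partial>m)"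
proof -
  let ?P = "count_space carpet_letters \<Otimes>\<^sub>M m"
  let ?F = "\<lambda>(i, x). carpet_map i x"
  have F: "?F \<in> measurable ?P m"
    by (rule measurable_pair_measure_countable1)
       (use carpet_map_measurable in \<open>simp_all add: countable_finite\<close>)
  have distr: "(\<integral>\<^sup>+x. g x \<partial>distr ?P m ?F) = (\<Sum>i\<in>carpet_letters. \<integral>\<^sup>+x. g (carpet_map i x) \<partial>m)"
    if g: "g \<in> borel_measurable m" for g :: "plane \<Rightarrow> ennreal"
  proof -
    have "(\<integral>\<^sup>+x. g x \<partial>distr ?P m ?F) = (\<integral>\<^sup>+z. g (?F z) \<partial>?P)"
      by (rule nn_integral_distr[OF F]) (use g in simp)
    also have "\<dots> = (\<integral>\<^sup>+i. \<integral>\<^sup>+x. g (?F (i, x)) \<partial>m \<partial>count_space carpet_letters)"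
      using measurable_compose[OF F g] by (intro nn_integral_fst[symmetric]) simp
    finally show ?thesis by (simp add: nn_integral_count_space_finite)
  qed
  have "distr ?P m ?F = scale_measure 8 m"
  proof (rule measure_eqI)
    fix A assume "A \<in> sets (distr ?P m ?F)"
    then have A: "A \<in> sets m" by simp
    have "emeasure (distr ?P m ?F) A = (\<Sum>i\<in>carpet_letters. \<integral>\<^sup>+x. indicator A (carpet_map i x) \<partial>m)"
      using distr[of "indicator A"] A by simp
    also have "\<dots> = (\<Sum>i\<in>carpet_letters. emeasure m (carpet_map i -` A \<inter> K))"
    proof (rule sum.cong[OF refl])
      fix i assume i: "i \<in> carpet_letters"
      have "carpet_map i -` A \<inter> K \<in> sets m"
        using measurable_sets[OF carpet_map_measurable[OF i] A] by simp
      moreover have "(\<integral>\<^sup>+x. indicator A (carpet_map i x) \<partial>m) =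
          (\<integral>\<^sup>+x. indicator (carpet_map i -` A \<inter> K) x \<partial>m)"
        by (intro nn_integral_cong) (auto simp: indicator_def)
      ultimately show "(\<integral>\<^sup>+x. indicator A (carpet_map i x) \<partial>m) = emeasure m (carpet_map i -` A \<inter> K)"
        by simp
    qed
    also have "\<dots> = ennreal (\<Sum>i\<in>carpet_letters. measure m (carpet_map i -` A \<inter> K))"
      by (simp add: emeasure_eq_measure)
    also have "\<dots> = ennreal (8 * measure m A)" by (simp add: self_similar_m[OF A])
    also have "\<dots> = emeasure (scale_measure 8 m) A"
      by (simp add: emeasure_eq_measure ennreal_mult')
    finally show "emeasure (distr ?P m ?F) A = emeasure (scale_measure 8 m) A" .
  qed simp
  then show ?thesis using distr[OF f] nn_integral_scale_measure[OF f, of 8] by simp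
qed

lemma integrable_comp_carpet_map:
  assumes f: "integrable m (f :: plane \<Rightarrow> real)" and i: "i \<in> carpet_letters"
  shows "integrable m (f \<circ> carpet_map i)"
proof -
  have "(\<lambda>x. ennreal \<bar>f x\<bar>) \<in> borel_measurable m" using f by simp
  from nn_integral_self_similar[OF this]
  have "(\<integral>\<^sup>+x. ennreal \<bar>f (carpet_map i x)\<bar> \<partial>m) \<le> 8 * (\<integral>\<^sup>+x. ennreal \<bar>f x\<bar> \<partial>m)"
    using member_le_sum[of i carpet_letters "\<lambda>i. \<integral>\<^sup>+x. ennreal \<bar>f (carpet_map i x)\<bar> \<partial>m"] i by simp
  also have "\<dots> < \<infinity>" using f by (simp add: integrable_iff_bounded ennreal_mult_less_top)
  finally show ?thesis
    using measurable_compose[OF carpet_map_measurable[OF i], of f borel] f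
    by (simp add: integrable_iff_bounded comp_def)
qed

lemma integral_self_similar:
  assumes f: "integrable m (f :: plane \<Rightarrow> real)"
  shows "(\<integral>x. f x \<partial>m) = (1/8) * (\<Sum>i\<in>carpet_letters. \<integral>x. f (carpet_map i x) \<partial>m)"
proof -
  have nonneg: "8 * (\<integral>x. g x \<partial>m) = (\<Sum>i\<in>carpet_letters. \<integral>x. g (carpet_map i x) \<partial>m)"
    if g: "integrable m g" "\<And>x. 0 \<le> g x" for g :: "plane \<Rightarrow> real"
  proof -
    have gi: "integrable m (\<lambda>x. g (carpet_map i x))" if "i \<in> carpet_letters" for i
      using integrable_comp_carpet_map[OF g(1) that] by (simp add: comp_def)
    have "ennreal (8 * (\<integral>x. g x \<partial>m)) = 8 * (\<integral>\<^sup>+x. ennreal (g x) \<partial>m)"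
      using g by (simp add: nn_integral_eq_integral ennreal_mult')
    also have "\<dots> = (\<Sum>i\<in>carpet_letters. \<integral>\<^sup>+x. ennreal (g (carpet_map i x)) \<partial>m)"
      using nn_integral_self_similar[of "\<lambda>x. ennreal (g x)"] g(1) by simp
    also have "\<dots> = (\<Sum>i\<in>carpet_letters. ennreal (\<integral>x. g (carpet_map i x) \<partial>m))"
      by (intro sum.cong refl nn_integral_eq_integral gi) (simp_all add: g(2))
    also have "\<dots> = ennreal (\<Sum>i\<in>carpet_letters. \<integral>x. g (carpet_map i x) \<partial>m)"
      using g(2) by (simp add: sum_ennreal)
    finally show ?thesis
      using g(2) by (subst (asm) ennreal_inj) (simp_all add: sum_nonneg del: split_paired_All)
  qed
  define P N where "P x = max (f x) 0" and "N x = max (- f x) 0" for x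
  have PN: "integrable m P" "integrable m N" "\<And>x. 0 \<le> P x" "\<And>x. 0 \<le> N x"
    using f unfolding P_def N_def by auto
  have fPN: "f x = P x - N x" for x by (simp add: P_def N_def)
  have "(\<Sum>i\<in>carpet_letters. \<integral>x. f (carpet_map i x) \<partial>m) =
      (\<Sum>i\<in>carpet_letters. (\<integral>x. P (carpet_map i x) \<partial>m) - (\<integral>x. N (carpet_map i x) \<partial>m))"
    unfolding fPN using PN(1,2) integrable_comp_carpet_map
    by (intro sum.cong refl Bochner_Integration.integral_diff) (auto simp: comp_def)
  also have "\<dots> = 8 * (\<integral>x. P x \<partial>m) - 8 * (\<integral>x. N x \<partial>m)"
    using nonneg[OF PN(1,3)] nonneg[OF PN(2,4)] by (simp add: sum_subtractf)
  also have "\<dots> = 8 * (\<integral>x. f x \<partial>m)" unfolding fPN using PN(1,2) by simp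
  finally show ?thesis by simp
qed

lemma integrable_comp_word_map:
  "integrable m f \<Longrightarrow> w \<in> carpet_words n \<Longrightarrow> integrable m (f \<circ> carpet_word_map w)"
  for f :: "plane \<Rightarrow> real"
proof (induction n arbitrary: f w)
  case (Suc n)
  then obtain i v where w: "w = i # v" "i \<in> carpet_letters" "v \<in> carpet_words n"
    by (auto simp: carpet_words_Suc)
  show ?case
    using Suc.IH[OF integrable_comp_carpet_map[OF Suc.prems(1) w(2)] w(3)]
    by (simp add: w(1) carpet_word_map_Cons comp_assoc)
qed simp

lemma integral_words:
  "integrable m f \<Longrightarrow> (\<integral>x. f x \<partial>m) = (1/8) ^ n * (\<Sum>w\<in>carpet_words n. \<integral>x. f (carpet_word_map w x) \<partial>m)"
  for f :: "plane \<Rightarrow> real"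
proof (induction n arbitrary: f)
  case (Suc n)
  have "(\<integral>x. f x \<partial>m) = (1/8) * (\<Sum>i\<in>carpet_letters. \<integral>x. f (carpet_map i x) \<partial>m)"
    by (rule integral_self_similar[OF Suc.prems])
  also have "(\<Sum>i\<in>carpet_letters. \<integral>x. f (carpet_map i x) \<partial>m) =
      (\<Sum>i\<in>carpet_letters. (1/8) ^ n * (\<Sum>w\<in>carpet_words n. \<integral>x. f (carpet_map i (carpet_word_map w x)) \<partial>m))"
    using Suc.IH[OF integrable_comp_carpet_map[OF Suc.prems]] by (intro sum.cong) (auto simp: comp_def)
  finally show ?case
    by (simp add: sum_carpet_words_Suc carpet_word_map_Cons sum_distrib_left mult.assoc)
qed simp

text \<open>The measure of the cell of \<open>u\<close> is an average over \<open>w\<close> of the measures of its preimages. The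
  term \<open>w = u\<close> alone accounts for the prescribed value, so nothing is left for the others. In
  particular the overlaps of cells are null sets.\<close>

lemma preimage_cell_null:
  assumes u: "u \<in> carpet_words n" and w: "w \<in> carpet_words n" and "u \<noteq> w"
  shows "AE x in m. carpet_word_map w x \<notin> carpet_cell K u"
proof -
  let ?A = "carpet_cell K u"
  let ?I = "\<lambda>v. \<integral>x. indicat_real ?A (carpet_word_map v x) \<partial>m"
  have A: "?A \<in> sets m" by (rule cell_in_sets[OF u])
  have int: "integrable m (indicat_real ?A)"
    using A by (intro integrable_real_indicator) (simp_all add: emeasure_eq_measure)
  have int_w: "integrable m (\<lambda>x. indicat_real ?A (carpet_word_map v x))" if "v \<in> carpet_words n" for v
    using integrable_comp_word_map[OF int that] by (simp add: comp_def)
  have "(\<integral>x. indicat_real ?A x \<partial>m) = (1/8) ^ n"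
    using A measure_cell[OF u] sets.sets_into_space[OF A] by (simp add: Int_absorb2)
  then have "(\<Sum>v\<in>carpet_words n. ?I v) = 1"
    using integral_words[OF int, of n] by simp
  moreover have "?I u = 1"
  proof -
    have "?I u = (\<integral>x. 1 \<partial>m)" by (rule Bochner_Integration.integral_cong) auto
    then show ?thesis using prob_space by simp
  qed
  moreover have nn: "0 \<le> ?I v" for v by simp
  moreover have "?I u + ?I w \<le> (\<Sum>v\<in>carpet_words n. ?I v)"
    using sum_mono2[of "carpet_words n" "{u, w}" ?I] u w \<open>u \<noteq> w\<close> nn by simp
  ultimately have "?I w = 0" by (intro antisym) linarith+
  then have "AE x in m. indicat_real ?A (carpet_word_map w x) = 0"
    using integral_nonneg_eq_0_iff_AE[OF int_w[OF w]] by simp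
  then show ?thesis by eventually_elim (simp add: indicator_def split: if_splits)
qed

lemma cell_average_eq:
  assumes f: "integrable m f" and u: "u \<in> carpet_words n"
  shows "cell_average K m f u = (\<integral>x. f (carpet_word_map u x) \<partial>m)"
proof -
  let ?A = "carpet_cell K u"
  let ?g = "\<lambda>x. indicat_real ?A x * f x"
  have "(LINT x:?A|m. f x) = (\<integral>x. ?g x \<partial>m)" by (simp add: set_lebesgue_integral_def)
  also have "\<dots> = (1/8) ^ n * (\<Sum>w\<in>carpet_words n. \<integral>x. ?g (carpet_word_map w x) \<partial>m)"
    using integrable_mult_indicator[OF cell_in_sets[OF u] f] by (intro integral_words) simp
  also have "(\<Sum>w\<in>carpet_words n. \<integral>x. ?g (carpet_word_map w x) \<partial>m) =
      (\<Sum>w\<in>carpet_words n. if w = u then \<integral>x. f (carpet_word_map u x) \<partial>m else 0)"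
  proof (rule sum.cong[OF refl])
    fix w assume w: "w \<in> carpet_words n"
    show "(\<integral>x. ?g (carpet_word_map w x) \<partial>m) = (if w = u then \<integral>x. f (carpet_word_map u x) \<partial>m else 0)"
    proof (cases "w = u")
      case True
      then show ?thesis by (auto intro!: Bochner_Integration.integral_cong)
    next
      case False
      have "AE x in m. ?g (carpet_word_map w x) = 0"
        using preimage_cell_null[OF u w] False by (auto elim!: eventually_mono)
      then show ?thesis using False by (simp add: integral_eq_zero_AE)
    qed
  qed
  also have "\<dots> = (\<integral>x. f (carpet_word_map u x) \<partial>m)" using u by simp
  finally show ?thesis by (simp add: cell_average_def measure_cell[OF u] power_one_over)
qed

text \<open>Inner regularity of the image of \<open>m\<close> on the plane gives compact sets inside the set and inside
  its complement that miss only little mass; Urysohn's lemma separates them.\<close>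

lemma continuous_approximates_indicator:
  assumes A: "A \<in> sets m" and e: "0 < \<epsilon>"
  shows "\<exists>g. continuous_on K g \<and> (\<integral>x. \<bar>indicat_real A x - g x\<bar> \<partial>m) < \<epsilon>"
proof -
  define M where "M = distr m borel (\<lambda>x. x)"
  have id: "(\<lambda>x. x) \<in> measurable m borel" by (intro continuous_measurable continuous_intros)
  interpret M: prob_space M unfolding M_def by (rule prob_space_distr[OF id])
  have M: "sets M = sets borel" by (simp add: M_def)
  obtain B where B: "B \<in> sets borel" "A = K \<inter> B"
    using A unfolding sets_m sets_restrict_space by blast
  \<comment> \<open>inner regularity, to be used for the set and for its complement\<close>
  have inner: "\<exists>C. C \<subseteq> S \<and> compact C \<and> measure M S - \<epsilon> / 4 < measure M C" if S: "S \<in> sets borel" for S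
  proof -
    have "ennreal (measure M S - \<epsilon> / 4) < emeasure M S \<or> measure M S = 0"
    proof (rule disjCI)
      assume "measure M S \<noteq> 0"
      then have "0 < measure M S" using measure_nonneg[of M S] by linarith
      then have "ennreal (measure M S - \<epsilon> / 4) < ennreal (measure M S)"
        using e by (intro ennreal_lessI) simp_all
      then show "ennreal (measure M S - \<epsilon> / 4) < emeasure M S"
        by (simp only: M.emeasure_eq_measure)
    qed
    then show ?thesis
    proof
      assume "ennreal (measure M S - \<epsilon> / 4) < emeasure M S"
      also have "emeasure M S = (SUP C\<in>{C. C \<subseteq> S \<and> compact C}. emeasure M C)"
        using M S by (intro inner_regular) (auto simp: M.emeasure_eq_measure)
      finally obtain C where C: "C \<subseteq> S" "compact C" "ennreal (measure M S - \<epsilon> / 4) < emeasure M C"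
        unfolding less_SUP_iff by blast
      then have "measure M S - \<epsilon> / 4 < measure M C"
        by (cases "measure M S - \<epsilon> / 4 < 0")
           (auto simp: M.emeasure_eq_measure ennreal_less_iff intro: less_le_trans[OF _ measure_nonneg])
      then show ?thesis using C by blast
    qed (use e in \<open>auto intro!: exI[of _ "{}"]\<close>)
  qed
  have nB: "- B \<in> sets borel" using B(1) by auto
  obtain C where C: "C \<subseteq> B" "compact C" "measure M B - \<epsilon> / 4 < measure M C"
    using inner[OF B(1)] by blast
  obtain D where D: "D \<subseteq> - B" "compact D" "measure M (- B) - \<epsilon> / 4 < measure M D"
    using inner[OF nB] by blast
  have CD: "C \<inter> D = {}" using C D by blast
  obtain g :: "plane \<Rightarrow> real" where g: "continuous_on UNIV g" "\<And>x. g x \<in> closed_segment 1 0"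
      "\<And>x. x \<in> C \<Longrightarrow> g x = 1" "\<And>x. x \<in> D \<Longrightarrow> g x = 0"
    using Urysohn[OF compact_imp_closed[OF C(2)] compact_imp_closed[OF D(2)] CD, of 1 0] by blast
  have g01: "0 \<le> g x" "g x \<le> 1" for x using g(2)[of x] by (auto simp: closed_segment_eq_real_ivl)
  have gK: "continuous_on K g" using g(1) by (rule continuous_on_subset) simp
  have sets: "C \<in> sets borel" "D \<in> sets borel" using C(2) D(2) by (auto intro: borel_compact)
  have KB: "K \<inter> (- (C \<union> D)) \<in> sets m"
    unfolding sets_m sets_restrict_space using sets by (intro imageI borel_comp sets.Un)
  have "(\<integral>x. \<bar>indicat_real A x - g x\<bar> \<partial>m) \<le> (\<integral>x. indicat_real (K \<inter> (- (C \<union> D))) x \<partial>m)"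
  proof (rule integral_mono')
    show "integrable m (indicat_real (K \<inter> (- (C \<union> D))))"
      using KB by (intro integrable_real_indicator) (simp_all add: emeasure_eq_measure)
    fix x assume "x \<in> space m"
    then have x: "x \<in> K" by simp
    consider "x \<in> C" | "x \<in> D" | "x \<notin> C \<union> D" by blast
    then show "\<bar>indicat_real A x - g x\<bar> \<le> indicat_real (K \<inter> (- (C \<union> D))) x"
    proof cases
      case 1
      then have "x \<in> B" using C(1) by blast
      then show ?thesis using 1 x g(3) B(2) by simp
    next
      case 2
      then have "x \<notin> B" using D(1) by blast
      then show ?thesis using 2 x g(4) B(2) by simp
    next
      case 3
      then show ?thesis using x g01[of x] by (simp add: indicator_def)
    qed
  qed simp
  also have "\<dots> = measure M (- (C \<union> D))"
    using KB sets id unfolding M_def by (subst measure_distr) (auto simp: Int_commute)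
  also have "\<dots> = 1 - (measure M C + measure M D)"
    using M.prob_compl[of "C \<union> D"] M.finite_measure_Union[OF _ _ CD] sets M
    by (simp add: M_def Compl_eq_Diff_UNIV)
  also have "\<dots> < 1 - (measure M B + measure M (- B)) + \<epsilon>" using C(3) D(3) e by linarith
  also have "\<dots> = \<epsilon>"
    using M.prob_compl[of B] B(1) M by (simp add: M_def Compl_eq_Diff_UNIV)
  finally show ?thesis using gK by blast
qed

lemma continuous_dense_L1:
  assumes "integrable m (f :: plane \<Rightarrow> real)" "0 < \<epsilon>"
  shows "\<exists>g. continuous_on K g \<and> (\<integral>x. \<bar>f x - g x\<bar> \<partial>m) < \<epsilon>"
  using assms
proof (induction arbitrary: \<epsilon> rule: integrable_induct)
  case (base A c)
  obtain g where g: "continuous_on K g" "(\<integral>x. \<bar>indicat_real A x - g x\<bar> \<partial>m) < \<epsilon> / (\<bar>c\<bar> + 1)"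
    using continuous_approximates_indicator[OF base(1), of "\<epsilon> / (\<bar>c\<bar> + 1)"] base(3) by auto
  have "(\<integral>x. \<bar>indicat_real A x *\<^sub>R c - c * g x\<bar> \<partial>m) = (\<integral>x. \<bar>c\<bar> * \<bar>indicat_real A x - g x\<bar> \<partial>m)"
    by (intro Bochner_Integration.integral_cong refl) (simp add: abs_mult[symmetric] algebra_simps)
  also have "\<dots> = \<bar>c\<bar> * (\<integral>x. \<bar>indicat_real A x - g x\<bar> \<partial>m)" by simp
  also have "\<dots> \<le> \<bar>c\<bar> * (\<epsilon> / (\<bar>c\<bar> + 1))" using g(2) by (intro mult_left_mono) auto
  also have "\<dots> < \<epsilon>" using base(3) by (simp add: field_simps)
  finally show ?case using g(1) by (intro exI[of _ "\<lambda>x. c * g x"] conjI continuous_intros)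
next
  case (add f1 f2)
  obtain g1 where g1: "continuous_on K g1" "(\<integral>x. \<bar>f1 x - g1 x\<bar> \<partial>m) < \<epsilon> / 2"
    using add.IH(1)[of "\<epsilon> / 2"] add.prems by auto
  obtain g2 where g2: "continuous_on K g2" "(\<integral>x. \<bar>f2 x - g2 x\<bar> \<partial>m) < \<epsilon> / 2"
    using add.IH(2)[of "\<epsilon> / 2"] add.prems by auto
  note int = add.hyps(1,2) continuous_integrable[OF g1(1)] continuous_integrable[OF g2(1)]
  have "(\<integral>x. \<bar>f1 x + f2 x - (g1 x + g2 x)\<bar> \<partial>m) \<le> (\<integral>x. \<bar>f1 x - g1 x\<bar> + \<bar>f2 x - g2 x\<bar> \<partial>m)"
    using int by (intro integral_mono) auto
  also have "\<dots> = (\<integral>x. \<bar>f1 x - g1 x\<bar> \<partial>m) + (\<integral>x. \<bar>f2 x - g2 x\<bar> \<partial>m)"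
    using int by (intro Bochner_Integration.integral_add) auto
  also have "\<dots> < \<epsilon>" using g1(2) g2(2) by simp
  finally show ?case using g1(1) g2(1) by (intro exI[of _ "\<lambda>x. g1 x + g2 x"] conjI continuous_intros)
next
  case (lim f s)
  have "(\<lambda>i. \<integral>x. \<bar>s i x - f x\<bar> \<partial>m) \<longlonglongrightarrow> (\<integral>x. 0 \<partial>m)"
  proof (rule integral_dominated_convergence)
    show "integrable m (\<lambda>x. 3 * \<bar>f x\<bar>)" using lim.hyps(4) by simp
    show "AE x in m. (\<lambda>i. \<bar>s i x - f x\<bar>) \<longlonglongrightarrow> 0"
      using lim.hyps(2) by (intro AE_I2 tendsto_rabs_zero) (simp add: LIM_zero)
    show "AE x in m. norm \<bar>s i x - f x\<bar> \<le> 3 * \<bar>f x\<bar>" for i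
    proof (rule AE_I2)
      fix x assume "x \<in> space m"
      then show "norm \<bar>s i x - f x\<bar> \<le> 3 * \<bar>f x\<bar>"
        using lim.hyps(3)[of x i] abs_triangle_ineq4[of "s i x" "f x"] by simp
    qed
    show "(\<lambda>x. \<bar>s i x - f x\<bar>) \<in> borel_measurable m" for i using lim.hyps(1,4) by simp
  qed simp
  then have "eventually (\<lambda>i. (\<integral>x. \<bar>s i x - f x\<bar> \<partial>m) < \<epsilon> / 2) sequentially"
    using lim.prems by (intro order_tendstoD) auto
  then obtain i where i: "(\<integral>x. \<bar>s i x - f x\<bar> \<partial>m) < \<epsilon> / 2" by (auto simp: eventually_sequentially)
  obtain g where g: "continuous_on K g" "(\<integral>x. \<bar>s i x - g x\<bar> \<partial>m) < \<epsilon> / 2"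
    using lim.IH[of "\<epsilon> / 2" i] lim.prems by auto
  note int = lim.hyps(1)[of i] lim.hyps(4) continuous_integrable[OF g(1)]
  have "(\<integral>x. \<bar>f x - g x\<bar> \<partial>m) \<le> (\<integral>x. \<bar>s i x - f x\<bar> + \<bar>s i x - g x\<bar> \<partial>m)"
    using int by (intro integral_mono) auto
  also have "\<dots> = (\<integral>x. \<bar>s i x - f x\<bar> \<partial>m) + (\<integral>x. \<bar>s i x - g x\<bar> \<partial>m)"
    using int by (intro Bochner_Integration.integral_add) auto
  also have "\<dots> < \<epsilon>" using i g(2) by simp
  finally show ?case using g(1) by blast
qed

end

section \<open>Regular self-similar energies\<close>

lemma sum_powr_le:
  fixes a :: "'i \<Rightarrow> real"
  assumes "finite I" "\<And>i. i \<in> I \<Longrightarrow> 0 \<le> a i" "0 < p"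
  shows "(\<Sum>i\<in>I. a i) powr p \<le> real (card I) powr p * (\<Sum>i\<in>I. a i powr p)"
proof (cases "I = {}")
  case False
  define M where "M = Max (a ` I)"
  have le: "a i \<le> M" if "i \<in> I" for i using that assms(1) by (simp add: M_def)
  obtain j where j: "j \<in> I" "M = a j"
    using Max_in[of "a ` I"] False assms(1) unfolding M_def by blast
  have "(\<Sum>i\<in>I. a i) \<le> real (card I) * M" using sum_bounded_above[of I a M] le by simp
  then have "(\<Sum>i\<in>I. a i) powr p \<le> (real (card I) * M) powr p"
    using assms(2,3) by (intro powr_mono2) (auto intro: sum_nonneg)
  also have "\<dots> = real (card I) powr p * a j powr p"
    using j assms(2) by (simp add: powr_mult)
  also have "a j powr p \<le> (\<Sum>i\<in>I. a i powr p)"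
    using assms(1) j by (intro member_le_sum) auto
  finally show ?thesis by (simp add: mult_left_mono)
qed (use assms in simp)

definition reflection :: "bool \<Rightarrow> bool \<Rightarrow> plane \<Rightarrow> plane" where
  "reflection a b z = (if a then - fst z else fst z, if b then - snd z else snd z)"

lemma reflection_cases:
  "reflection a b = (if a then reflect_x else id) \<circ> (if b then reflect_y else id)"
  by (auto simp: reflection_def fun_eq_iff)

text \<open>Translates of \<open>[-1, 1]\<close> by different even integers meet at most in an end point.\<close>

lemma shift_cases:
  fixes a b :: real and k l :: int
  assumes "\<bar>a\<bar> \<le> 1" "\<bar>b\<bar> \<le> 1" "a + 2 * real_of_int k = b + 2 * real_of_int l"
  obtains "k = l" "a = b" | "l = k + 1" "a = 1" "b = -1" | "k = l + 1" "a = -1" "b = 1"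
proof -
  have ab: "a \<le> 1" "- 1 \<le> a" "b \<le> 1" "- 1 \<le> b" using assms by linarith+
  have "real_of_int \<bar>k - l\<bar> \<le> 1" using assms by (simp add: abs_le_iff)
  then consider "k = l" | "k = l + 1" | "l = k + 1" by linarith
  then show ?thesis
  proof cases
    case 1
    then show ?thesis using that(1) assms(3) by simp
  next
    case 2
    then have "b = a + 2" using assms(3) by simp
    then have "a = -1" "b = 1" using ab by linarith+
    then show ?thesis using that(3) 2 by simp
  next
    case 3
    then have "a = b + 2" using assms(3) by simp
    then have "a = 1" "b = -1" using ab by linarith+
    then show ?thesis using that(2) 3 by simp
  qed
qed

text \<open>Reflecting every middle interval unfolds a function on \<open>[-1, 1]\<close> to a continuous function on the
  three adjacent intervals with centres \<open>-2\<close>, \<open>0\<close> and \<open>2\<close>.\<close>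

lemma fold_matches:
  fixes a b :: real and q q' :: int
  assumes "q \<in> {-1, 0, 1}" "q' \<in> {-1, 0, 1}" "\<bar>a\<bar> \<le> 1" "\<bar>b\<bar> \<le> 1"
    "a + 2 * real_of_int q = b + 2 * real_of_int q'"
  shows "(if q = 0 then - a else a) = (if q' = 0 then - b else b)"
  by (rule shift_cases[OF assms(3-5)]) (use assms(1,2) in auto)

text \<open>The same for two functions, one on the left interval and another one that is unfolded from the
  middle to the right interval; the cases are those in which a junction has to be checked.\<close>

lemma fold_matches_across:
  fixes a b :: real and q q' :: int
  assumes q: "q \<in> {-1, 0, 1}" "q' \<in> {-1, 0, 1}"
    and ab: "\<bar>a\<bar> \<le> 1" "\<bar>b\<bar> \<le> 1" "a + 2 * real_of_int q = b + 2 * real_of_int q'"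
  obtains "q = -1" "q' = -1" "a = b" | "q = -1" "q' = 0" "a = 1" "b = -1"
    | "q = 0" "q' = -1" "a = -1" "b = 1"
    | "q \<noteq> -1" "q' \<noteq> -1" "(if q = 1 then - a else a) = (if q' = 1 then - b else b)"
proof (rule shift_cases[OF ab])
  assume e: "q = q'" "a = b"
  show ?thesis
  proof (cases "q = -1")
    case True
    then show ?thesis using that(1) e by simp
  next
    case False
    then show ?thesis using that(4) e by simp
  qed
next
  assume e: "q' = q + 1" "a = 1" "b = -1"
  show ?thesis
  proof (cases "q = -1")
    case True
    then show ?thesis using that(2) e by simp
  next
    case False
    then have "q = 0" "q' = 1" using e(1) q by auto
    then show ?thesis using that(4) e by simp
  qed
next
  assume e: "q = q' + 1" "a = -1" "b = 1"
  show ?thesis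
  proof (cases "q' = -1")
    case True
    then show ?thesis using that(3) e by simp
  next
    case False
    then have "q = 1" "q' = 0" using e(1) q by auto
    then show ?thesis using that(4) e by simp
  qed
qed

text \<open>The hypotheses on \<open>Es\<close>, with scaling factor \<open>r\<close>. The constant of the spectral gap is a parameter
  because all later constants are built from it.\<close>

locale carpet_energy = carpet_measure +
  fixes p r :: real and Es :: "(plane \<Rightarrow> real) \<Rightarrow> real" and Fs :: "(plane \<Rightarrow> real) set" and Cgap :: real
  assumes p: "1 < p"
    and Fs: "Lp_subspace m p Fs"
    and Es: "nonneg_functional m Fs Es"
    and a_const: "{f \<in> Fs. Es f = 0} = {f \<in> Lp m p. ae_constant m f}"
    and a_shift: "\<And>a f. f \<in> Fs \<Longrightarrow> Es (\<lambda>x. f x + a) = Es f"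
    and a_scale: "\<And>a f. f \<in> Fs \<Longrightarrow> Es (\<lambda>x. a * f x) = \<bar>a\<bar> powr p * Es f"
    and b_triangle: "triangle_on Fs (\<lambda>f. Es f powr (1 / p))"
    and b_norm: "norm_on m Fs (energy_norm m p Es)"
    and b_complete: "complete_norm_on Fs (energy_norm m p Es)"
    and b_convex: "uniformly_convex_on Fs (energy_norm m p Es)"
    and c_uniform: "\<And>f \<epsilon>. continuous_on K f \<Longrightarrow> \<epsilon> > 0 \<Longrightarrow>
           \<exists>g\<in>Fs. continuous_on K g \<and> (\<forall>x\<in>K. \<bar>f x - g x\<bar> < \<epsilon>)"
    and c_norm: "\<And>f \<epsilon>. f \<in> Fs \<Longrightarrow> \<epsilon> > 0 \<Longrightarrow>
           \<exists>g\<in>Fs. continuous_on K g \<and> energy_norm m p Es (\<lambda>x. f x - g x) < \<epsilon>"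
    and symmetric: "symmetry_invariant Fs Es"
    and r_pos: "0 < r"
    and self_similar: "self_similar_energy K Fs Es r"
    and contraction: "\<And>f. f \<in> Fs \<Longrightarrow> (\<lambda>x. min (max (f x) 0) 1) \<in> Fs \<and>
           Es (\<lambda>x. min (max (f x) 0) 1) \<le> Es f"
    and Cgap: "0 < Cgap"
    and gap: "\<And>f. f \<in> Fs \<Longrightarrow> Lp_norm m p (\<lambda>x. f x - (\<integral>y. f y \<partial>m)) powr p \<le> Cgap * Es f"
begin

subsection \<open>The domain and the seminorm\<close>

lemma Fs_Lp: "f \<in> Fs \<Longrightarrow> f \<in> Lp m p"
  and Fs_zero: "(\<lambda>x. 0) \<in> Fs"
  and Fs_add: "f \<in> Fs \<Longrightarrow> g \<in> Fs \<Longrightarrow> (\<lambda>x. f x + g x) \<in> Fs"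
  and Fs_scale: "f \<in> Fs \<Longrightarrow> (\<lambda>x. a * f x) \<in> Fs"
  and Fs_ae: "f \<in> Fs \<Longrightarrow> g \<in> Lp m p \<Longrightarrow> AE x in m. f x = g x \<Longrightarrow> g \<in> Fs"
  using Fs unfolding Lp_subspace_def by blast+

lemma Es_nonneg: "f \<in> Fs \<Longrightarrow> 0 \<le> Es f"
  and Es_ae: "f \<in> Fs \<Longrightarrow> g \<in> Fs \<Longrightarrow> AE x in m. f x = g x \<Longrightarrow> Es f = Es g"
  using Es unfolding nonneg_functional_def by blast+

lemma Fs_const: "(\<lambda>x. a) \<in> Fs" and Es_const: "Es (\<lambda>x. a) = 0"
proof -
  have "(\<lambda>x. a) \<in> {f \<in> Lp m p. ae_constant m f}"
    using p continuous_Lp[of "\<lambda>x. a"] by (simp add: ae_constant_def exI[of _ a])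
  then show "(\<lambda>x. a) \<in> Fs" "Es (\<lambda>x. a) = 0" unfolding a_const[symmetric] by simp_all
qed

lemma Fs_diff: "f \<in> Fs \<Longrightarrow> g \<in> Fs \<Longrightarrow> (\<lambda>x. f x - g x) \<in> Fs"
  using Fs_add[OF _ Fs_scale[of g "-1"], of f] by simp

lemma Fs_sum:
  "finite I \<Longrightarrow> (\<And>i. i \<in> I \<Longrightarrow> h i \<in> Fs) \<Longrightarrow> (\<lambda>x. \<Sum>i\<in>I. h i x) \<in> Fs"
  by (induction I rule: finite_induct) (simp_all add: Fs_zero Fs_add)

lemma Fs_integrable: "f \<in> Fs \<Longrightarrow> integrable m f"
  using Lp_integrable(1)[OF prob_m _ Fs_Lp] p by simp

lemma Lp_cong_K:
  assumes "f \<in> Lp m p" "\<And>x. x \<in> K \<Longrightarrow> f x = g x"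
  shows "g \<in> Lp m p"
proof -
  have "g \<in> borel_measurable m \<longleftrightarrow> f \<in> borel_measurable m"
    by (rule measurable_cong) (simp add: assms(2))
  moreover have "integrable m (\<lambda>x. \<bar>g x\<bar> powr p) \<longleftrightarrow> integrable m (\<lambda>x. \<bar>f x\<bar> powr p)"
    by (rule Bochner_Integration.integrable_cong) (simp_all add: assms(2))
  ultimately show ?thesis using assms(1) by (simp add: Lp_def)
qed

lemma Fs_cong_K:
  assumes "f \<in> Fs" "\<And>x. x \<in> K \<Longrightarrow> f x = g x"
  shows "g \<in> Fs" "Es g = Es f"
proof -
  have ae: "AE x in m. f x = g x" by (rule AE_I2) (simp add: assms(2))
  show g: "g \<in> Fs" by (rule Fs_ae[OF assms(1) Lp_cong_K[OF Fs_Lp[OF assms(1)] assms(2)] ae])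
  show "Es g = Es f" using Es_ae[OF assms(1) g ae] by simp
qed

lemma Es_eq_powr: "f \<in> Fs \<Longrightarrow> Es f = (Es f powr (1 / p)) powr p"
  using p Es_nonneg by (simp add: powr_powr)

lemma Es_root_sum:
  "finite I \<Longrightarrow> (\<And>i. i \<in> I \<Longrightarrow> h i \<in> Fs) \<Longrightarrow>
     Es (\<lambda>x. \<Sum>i\<in>I. h i x) powr (1 / p) \<le> (\<Sum>i\<in>I. Es (h i) powr (1 / p))"
proof (induction I rule: finite_induct)
  case (insert j I)
  have "Es (\<lambda>x. h j x + (\<Sum>i\<in>I. h i x)) powr (1 / p) \<le>
      Es (h j) powr (1 / p) + Es (\<lambda>x. \<Sum>i\<in>I. h i x) powr (1 / p)"
    using b_triangle insert.hyps insert.prems Fs_sum[of I h] unfolding triangle_on_def by simp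
  also have "\<dots> \<le> Es (h j) powr (1 / p) + (\<Sum>i\<in>I. Es (h i) powr (1 / p))"
    using insert by simp
  finally show ?case using insert.hyps by simp
qed (simp add: Es_const)

lemma Es_sum_le:
  assumes "finite I" "\<And>i. i \<in> I \<Longrightarrow> h i \<in> Fs"
  shows "Es (\<lambda>x. \<Sum>i\<in>I. h i x) \<le> real (card I) powr p * (\<Sum>i\<in>I. Es (h i))"
proof -
  have "Es (\<lambda>x. \<Sum>i\<in>I. h i x) = (Es (\<lambda>x. \<Sum>i\<in>I. h i x) powr (1 / p)) powr p"
    by (rule Es_eq_powr) (rule Fs_sum[OF assms])
  also have "\<dots> \<le> (\<Sum>i\<in>I. Es (h i) powr (1 / p)) powr p"
    using p Es_root_sum[OF assms] by (intro powr_mono2) auto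
  also have "\<dots> \<le> real (card I) powr p * (\<Sum>i\<in>I. (Es (h i) powr (1 / p)) powr p)"
    using p assms(1) by (intro sum_powr_le) auto
  also have "(\<Sum>i\<in>I. (Es (h i) powr (1 / p)) powr p) = (\<Sum>i\<in>I. Es (h i))"
    using assms(2) Es_eq_powr by (intro sum.cong) auto
  finally show ?thesis .
qed

lemma symmetry_Fs:
  assumes "f \<in> Fs" "\<Phi> \<in> carpet_symmetries"
  shows "f \<circ> \<Phi> \<in> Fs" "Es (f \<circ> \<Phi>) = Es f"
  using symmetric assms unfolding symmetry_invariant_def by blast+

lemma reflection_Fs:
  assumes "f \<in> Fs"
  shows "f \<circ> reflection a b \<in> Fs" "Es (f \<circ> reflection a b) = Es f"
proof -
  have 1: "f \<circ> (if a then reflect_x else id) \<in> Fs" "Es (f \<circ> (if a then reflect_x else id)) = Es f"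
    using assms symmetry_Fs carpet_symmetries_generators by auto
  have 2: "f \<circ> (if a then reflect_x else id) \<circ> (if b then reflect_y else id) \<in> Fs"
    "Es (f \<circ> (if a then reflect_x else id) \<circ> (if b then reflect_y else id)) = Es f"
    using 1 symmetry_Fs[OF 1(1)] carpet_symmetries_generators(2) by auto
  then show "f \<circ> reflection a b \<in> Fs" "Es (f \<circ> reflection a b) = Es f"
    by (simp_all add: reflection_cases comp_assoc)
qed

lemma reflection_in_K: "z \<in> K \<Longrightarrow> reflection a b z \<in> K"
  by (simp add: reflection_cases reflect_in_K)

lemma reflection_continuous:
  assumes "continuous_on K f" shows "continuous_on K (f \<circ> reflection a b)"
proof (rule continuous_on_comp_K[OF assms _ reflection_in_K])
  show "continuous_on K (reflection a b)"
    unfolding reflection_cases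
    by (intro continuous_on_compose)
       (auto intro: continuous_on_reflections continuous_on_id simp: id_def[abs_def])
qed

subsection \<open>Gluing along the cells\<close>

lemma Es_letters:
  "f \<in> Fs \<Longrightarrow> i \<in> carpet_letters \<Longrightarrow> f \<circ> carpet_map i \<in> Fs"
  "f \<in> Fs \<Longrightarrow> Es f = r * (\<Sum>i\<in>carpet_letters. Es (f \<circ> carpet_map i))"
  using self_similar unfolding self_similar_energy_def by (blast, metis)

lemma Fs_from_letters:
  assumes "continuous_on K f" "\<And>i. i \<in> carpet_letters \<Longrightarrow> f \<circ> carpet_map i \<in> Fs"
  shows "f \<in> Fs"
  using self_similar assms unfolding self_similar_energy_def by blast

lemma Fs_word_map: "f \<in> Fs \<Longrightarrow> w \<in> carpet_words n \<Longrightarrow> f \<circ> carpet_word_map w \<in> Fs"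
proof (induction n arbitrary: f w)
  case (Suc n)
  then obtain i v where w: "w = i # v" "i \<in> carpet_letters" "v \<in> carpet_words n"
    by (auto simp: carpet_words_Suc)
  show ?case
    using Suc.IH[OF Es_letters(1)[OF Suc.prems(1) w(2)] w(3)]
    by (simp add: w(1) carpet_word_map_Cons comp_assoc)
qed simp

lemma Es_words: "f \<in> Fs \<Longrightarrow> Es f = r ^ n * (\<Sum>w\<in>carpet_words n. Es (f \<circ> carpet_word_map w))"
proof (induction n arbitrary: f)
  case (Suc n)
  have "Es f = r * (\<Sum>i\<in>carpet_letters. Es (f \<circ> carpet_map i))"
    by (rule Es_letters(2)[OF Suc.prems])
  also have "(\<Sum>i\<in>carpet_letters. Es (f \<circ> carpet_map i)) = (\<Sum>i\<in>carpet_letters. r ^ n *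
      (\<Sum>w\<in>carpet_words n. Es (f \<circ> carpet_map i \<circ> carpet_word_map w)))"
    by (rule sum.cong[OF refl]) (rule Suc.IH[OF Es_letters(1)[OF Suc.prems]])
  finally show ?case
    by (simp only: sum_carpet_words_Suc carpet_word_map_Cons sum_distrib_left comp_assoc
          power_Suc mult.assoc)
qed simp

lemma Fs_from_words:
  "continuous_on K f \<Longrightarrow> (\<And>w. w \<in> carpet_words n \<Longrightarrow> f \<circ> carpet_word_map w \<in> Fs) \<Longrightarrow> f \<in> Fs"
proof (induction n arbitrary: f)
  case (Suc n)
  show ?case
  proof (rule Fs_from_letters[OF Suc.prems(1)])
    fix i assume i: "i \<in> carpet_letters"
    show "f \<circ> carpet_map i \<in> Fs"
    proof (rule Suc.IH[OF continuous_on_comp_carpet_map[OF Suc.prems(1) i]])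
      fix w assume "w \<in> carpet_words n"
      then have "i # w \<in> carpet_words (Suc n)" using i by simp
      from Suc.prems(2)[OF this] show "f \<circ> carpet_map i \<circ> carpet_word_map w \<in> Fs"
        by (simp only: carpet_word_map_Cons comp_assoc)
    qed
  qed
qed simp

lemma glue_Fs:
  fixes g :: "nat list \<Rightarrow> plane \<Rightarrow> real"
  assumes g: "\<And>w. w \<in> carpet_words n \<Longrightarrow> g w \<in> Fs" "\<And>w. w \<in> carpet_words n \<Longrightarrow> continuous_on K (g w)"
    and compat: "\<And>u v a b. u \<in> carpet_words n \<Longrightarrow> v \<in> carpet_words n \<Longrightarrow> a \<in> K \<Longrightarrow> b \<in> K \<Longrightarrow>
        carpet_word_map u a = carpet_word_map v b \<Longrightarrow> g u a = g v b"
  obtains G where "G \<in> Fs" "continuous_on K G"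
    "\<And>w x. w \<in> carpet_words n \<Longrightarrow> x \<in> K \<Longrightarrow> G (carpet_word_map w x) = g w x"
    "Es G = r ^ n * (\<Sum>w\<in>carpet_words n. Es (g w))"
proof -
  obtain G where G: "continuous_on K G"
    "\<And>w x. w \<in> carpet_words n \<Longrightarrow> x \<in> K \<Longrightarrow> G (carpet_word_map w x) = g w x"
    using glue_continuous[of n g, OF g(2) compat] by blast
  have eq: "g w x = (G \<circ> carpet_word_map w) x" if "w \<in> carpet_words n" "x \<in> K" for w x
    using G(2)[OF that] by simp
  have GF: "G \<circ> carpet_word_map w \<in> Fs" "Es (G \<circ> carpet_word_map w) = Es (g w)"
    if "w \<in> carpet_words n" for w
    by (rule Fs_cong_K[OF g(1)[OF that] eq[OF that]], assumption)+
  have "G \<in> Fs" by (rule Fs_from_words[OF G(1) GF(1)])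
  moreover have "Es G = r ^ n * (\<Sum>w\<in>carpet_words n. Es (g w))"
    using Es_words[OF \<open>G \<in> Fs\<close>, of n] GF(2) by simp
  ultimately show ?thesis using G that by blast
qed

subsection \<open>The spectral gap compares averages over adjacent cells\<close>

lemma gap_integral:
  assumes "f \<in> Fs"
  shows "(\<integral>x. \<bar>f x - (\<integral>y. f y \<partial>m)\<bar> powr p \<partial>m) \<le> Cgap * Es f"
proof -
  have "0 \<le> (\<integral>x. \<bar>f x - (\<integral>y. f y \<partial>m)\<bar> powr p \<partial>m)" by (rule Bochner_Integration.integral_nonneg) simp
  then show ?thesis using gap[OF assms] p by (simp add: Lp_norm_def powr_powr)
qed

text \<open>For the glued function, \<open>L\<^sup>p\<close> closeness to its mean on the whole carpet contains
  closeness on each of the eight cells, where Jensen's inequality passes to the averages.\<close>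

lemma averages_of_glued_family:
  fixes h :: "nat \<Rightarrow> plane \<Rightarrow> real"
  assumes h: "\<And>k. k \<in> carpet_letters \<Longrightarrow> h k \<in> Fs" "\<And>k. k \<in> carpet_letters \<Longrightarrow> continuous_on K (h k)"
    and compat: "\<And>k l a b. k \<in> carpet_letters \<Longrightarrow> l \<in> carpet_letters \<Longrightarrow> a \<in> K \<Longrightarrow> b \<in> K \<Longrightarrow>
        carpet_map k a = carpet_map l b \<Longrightarrow> h k a = h l b"
    and ij: "i \<in> carpet_letters" "j \<in> carpet_letters" "i \<noteq> j"
  shows "\<bar>(\<integral>x. h i x \<partial>m) - (\<integral>x. h j x \<partial>m)\<bar> powr p
    \<le> 8 * 2 powr p * Cgap * r * (\<Sum>k\<in>carpet_letters. Es (h k))"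
proof -
  have words1: "carpet_words 1 = (\<lambda>k. [k]) ` carpet_letters"
    using carpet_words_Suc[of 0] by (auto simp: image_iff)
  note words1' = words1[unfolded One_nat_def]
  have hd1: "h (hd w) \<in> Fs" "continuous_on K (h (hd w))" if "w \<in> carpet_words 1" for w
    using that h by (auto simp: words1')
  have compat1: "h (hd u) a = h (hd v) b"
    if uv: "u \<in> carpet_words 1" "v \<in> carpet_words 1" "a \<in> K" "b \<in> K"
      "carpet_word_map u a = carpet_word_map v b" for u v a b
  proof -
    obtain k l where kl: "k \<in> carpet_letters" "u = [k]" "l \<in> carpet_letters" "v = [l]"
      using uv(1,2) by (auto simp: words1')
    then have "carpet_map k a = carpet_map l b" using uv(5) by (simp add: carpet_word_map_Cons)
    then show ?thesis using compat[OF kl(1,3) uv(3,4)] kl by simp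
  qed
  obtain G where G: "G \<in> Fs" "continuous_on K G"
    "\<And>w x. w \<in> carpet_words 1 \<Longrightarrow> x \<in> K \<Longrightarrow> G (carpet_word_map w x) = h (hd w) x"
    "Es G = r ^ 1 * (\<Sum>w\<in>carpet_words 1. Es (h (hd w)))"
    using glue_Fs[of 1 "\<lambda>w. h (hd w)", OF hd1 compat1] by blast
  have G3: "G (carpet_map k x) = h k x" if "k \<in> carpet_letters" "x \<in> K" for k x
    using G(3)[of "[k]" x] that by (simp add: words1' carpet_word_map_Cons)
  have G4: "Es G = r * (\<Sum>k\<in>carpet_letters. Es (h k))"
    using G(4) by (simp add: words1' sum.reindex inj_on_def)
  define a where "a = (\<integral>y. G y \<partial>m)"
  let ?I = "\<lambda>k. \<integral>x. \<bar>h k x - a\<bar> powr p \<partial>m"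
  have int: "integrable m (\<lambda>x. \<bar>G x - a\<bar> powr p)"
    using Lp_integrable(2)[OF prob_m _ Fs_Lp[OF Fs_diff[OF G(1) Fs_const]]] p by simp
  have "(1/8) * (\<Sum>k\<in>carpet_letters. ?I k) = (\<integral>x. \<bar>G x - a\<bar> powr p \<partial>m)"
    unfolding integral_self_similar[OF int]
    by (intro arg_cong[where f="(*) (1/8)"] sum.cong refl Bochner_Integration.integral_cong) (simp_all add: G3)
  also have "\<dots> \<le> Cgap * Es G" using gap_integral[OF G(1)] by (simp add: a_def)
  finally have total: "(\<Sum>k\<in>carpet_letters. ?I k) \<le> 8 * Cgap * r * (\<Sum>k\<in>carpet_letters. Es (h k))"
    by (simp add: G4)
  have pair: "?I i + ?I j \<le> (\<Sum>k\<in>carpet_letters. ?I k)"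
    using sum_mono2[of carpet_letters "{i, j}" ?I] ij by simp
  have jensen: "\<bar>(\<integral>x. h k x \<partial>m) - a\<bar> powr p \<le> ?I k" if "k \<in> carpet_letters" for k
    using Lp_jensen[OF prob_m _ Fs_Lp[OF Fs_diff[OF h(1)[OF that] Fs_const]], of a] p
      Fs_integrable[OF h(1)[OF that]] prob_space by simp
  have "\<bar>(\<integral>x. h i x \<partial>m) - a\<bar> powr p + \<bar>a - (\<integral>x. h j x \<partial>m)\<bar> powr p
      \<le> 8 * Cgap * r * (\<Sum>k\<in>carpet_letters. Es (h k))"
    using total pair jensen[OF ij(1)] jensen[OF ij(2)] unfolding abs_minus_commute[of a] by linarith
  then have "2 powr p * (\<bar>(\<integral>x. h i x \<partial>m) - a\<bar> powr p + \<bar>a - (\<integral>x. h j x \<partial>m)\<bar> powr p)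
      \<le> 2 powr p * (8 * Cgap * r * (\<Sum>k\<in>carpet_letters. Es (h k)))"
    by (intro mult_left_mono) auto
  moreover have "\<bar>(\<integral>x. h i x \<partial>m) - (\<integral>x. h j x \<partial>m)\<bar> powr p
      \<le> 2 powr p * (\<bar>(\<integral>x. h i x \<partial>m) - a\<bar> powr p + \<bar>a - (\<integral>x. h j x \<partial>m)\<bar> powr p)"
    using powr_add_le[of p "(\<integral>x. h i x \<partial>m) - a" "a - (\<integral>x. h j x \<partial>m)"] p by simp
  ultimately show ?thesis by (simp add: algebra_simps)
qed

lemma letters_meet:
  assumes "k \<in> carpet_letters" "l \<in> carpet_letters" "carpet_map k a = carpet_map l b"
  shows "fst a + 2 * real_of_int (letter_x k) = fst b + 2 * real_of_int (letter_x l)"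
    "snd a + 2 * real_of_int (letter_y k) = snd b + 2 * real_of_int (letter_y l)"
  using assms(3) by (simp_all add: carpet_map_letter assms(1,2))

text \<open>The function \<open>g\<close> is unfolded over the column of cells with first coordinate \<open>-1\<close>, and \<open>h\<close> over the
  other two columns. Both unfoldings use the same reflections in the second coordinate, so the
  only junctions not settled by unfolding are those along the edge on which \<open>g\<close> and \<open>h\<close> agree by
  assumption. For \<open>swapped\<close> the roles of the coordinates are exchanged, which deals with cells
  above each other; the cells 1 and \<open>j\<close>, whose averages are compared, carry \<open>g\<close> and \<open>h\<close> unreflected.\<close>

lemma averages_across_edge:
  fixes swapped :: bool
  defines "\<sigma> \<equiv> if swapped then swap_axes else id"
  assumes g: "g \<in> Fs" "continuous_on K g" and h: "h \<in> Fs" "continuous_on K h"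
    and edge: "\<And>y. (1, y) \<in> K \<Longrightarrow> g (\<sigma> (1, y)) = h (\<sigma> (-1, y))"
  shows "\<bar>(\<integral>x. g x \<partial>m) - (\<integral>x. h x \<partial>m)\<bar> powr p \<le> 64 * 2 powr p * Cgap * r * (Es g + Es h)"
proof -
  define X where "X = (if swapped then letter_y else letter_x)"
  define Y where "Y = (if swapped then letter_x else letter_y)"
  have \<sigma>\<sigma>: "\<sigma> (\<sigma> z) = z" for z by (cases z) (simp add: \<sigma>_def)
  have \<sigma>K: "\<sigma> z \<in> K" if "z \<in> K" for z using that reflect_in_K(3) by (simp add: \<sigma>_def)
  have \<sigma>_Fs: "f \<circ> \<sigma> \<in> Fs" "Es (f \<circ> \<sigma>) = Es f" if "f \<in> Fs" for f
    using symmetry_Fs[OF that carpet_symmetries_generators(3)] that unfolding \<sigma>_def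
    by (cases swapped; simp only: if_True if_False comp_id)+
  have \<sigma>_cont: "continuous_on K (f \<circ> \<sigma>)" if "continuous_on K f" for f :: "plane \<Rightarrow> real"
    using continuous_on_comp_symmetry(3)[OF that] that unfolding \<sigma>_def
    by (cases swapped; simp only: if_True if_False comp_id)
  define G where "G k = (if X k = -1 then g \<circ> \<sigma> \<circ> reflection False (Y k = 0) \<circ> \<sigma>
    else h \<circ> \<sigma> \<circ> reflection (X k = 1) (Y k = 0) \<circ> \<sigma>)" for k
  have G: "G k \<in> Fs" "continuous_on K (G k)" "Es (G k) \<le> Es g + Es h" for k
  proof -
    have *: "f \<circ> \<sigma> \<circ> reflection s t \<circ> \<sigma> \<in> Fs" "Es (f \<circ> \<sigma> \<circ> reflection s t \<circ> \<sigma>) = Es f"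
      if "f \<in> Fs" for f s t
      using that by (simp_all only: \<sigma>_Fs reflection_Fs)
    show "G k \<in> Fs" "Es (G k) \<le> Es g + Es h"
      unfolding G_def using *[OF g(1)] *[OF h(1)] Es_nonneg[OF g(1)] Es_nonneg[OF h(1)]
      by (cases "X k = -1"; simp only: if_True if_False simp_thms; linarith)+
    show "continuous_on K (G k)"
      unfolding G_def
      by (cases "X k = -1"; simp only: if_True if_False simp_thms)
         (intro \<sigma>_cont reflection_continuous g(2) h(2))+
  qed
  have compat: "G k a = G l b"
    if k: "k \<in> carpet_letters" and l: "l \<in> carpet_letters" and a: "a \<in> K" and b: "b \<in> K"
      and eq: "carpet_map k a = carpet_map l b" for k l a b
  proof -
    define a' b' where "a' = \<sigma> a" and "b' = \<sigma> b"
    have K': "a' \<in> K" "b' \<in> K" using \<sigma>K a b by (simp_all add: a'_def b'_def)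
    have X: "X k \<in> {-1, 0, 1}" "X l \<in> {-1, 0, 1}" and Y: "Y k \<in> {-1, 0, 1}" "Y l \<in> {-1, 0, 1}"
      unfolding X_def Y_def using letter_bounds[OF k] letter_bounds[OF l] by (cases swapped; simp)+
    have meet: "fst a' + 2 * real_of_int (X k) = fst b' + 2 * real_of_int (X l)"
      "snd a' + 2 * real_of_int (Y k) = snd b' + 2 * real_of_int (Y l)"
      using letters_meet[OF k l eq] by (simp_all add: a'_def b'_def \<sigma>_def X_def Y_def swap_axes_def)
    define c where "c = (if Y k = 0 then - snd a' else snd a')"
    have c: "c = (if Y l = 0 then - snd b' else snd b')"
      unfolding c_def
      by (rule fold_matches[OF Y K_subset_box(2)[OF K'(1)] K_subset_box(2)[OF K'(2)] meet(2)])
    have Gk: "G k a = (if X k = -1 then g (\<sigma> (fst a', c))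
        else h (\<sigma> (if X k = 1 then - fst a' else fst a', c)))"
      by (simp add: G_def reflection_def c_def a'_def)
    have Gl: "G l b = (if X l = -1 then g (\<sigma> (fst b', c))
        else h (\<sigma> (if X l = 1 then - fst b' else fst b', c)))"
      by (simp add: G_def reflection_def c b'_def)
    have ac: "(fst a', c) \<in> K" using reflection_in_K[OF K'(1), of False "Y k = 0"]
      by (simp add: reflection_def c_def)
    have bc: "(fst b', c) \<in> K" using reflection_in_K[OF K'(2), of False "Y l = 0"]
      by (simp add: reflection_def c)
    show ?thesis
    proof (cases rule: fold_matches_across[OF X K_subset_box(1)[OF K'(1)] K_subset_box(1)[OF K'(2)] meet(1)])
      case 1
      then show ?thesis by (simp add: Gk Gl)
    next
      case 2
      then show ?thesis using edge[of c] ac by (simp add: Gk Gl)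
    next
      case 3
      then show ?thesis using edge[of c] bc by (simp add: Gk Gl)
    next
      case 4
      then show ?thesis by (simp add: Gk Gl)
    qed
  qed
  \<comment> \<open>the neighbour of the corner cell 1 across the edge in question\<close>
  define j :: nat where "j = (if swapped then 8 else 2)"
  have 1: "1 \<in> carpet_letters" and j: "j \<in> carpet_letters" "1 \<noteq> j"
    by (simp_all add: carpet_letters_eq j_def)
  have G1: "G 1 = g" and Gj: "G j = h"
    by (rule ext, simp add: G_def X_def Y_def j_def letter_coordinates reflection_def \<sigma>\<sigma>)+
  have "\<bar>(\<integral>x. g x \<partial>m) - (\<integral>x. h x \<partial>m)\<bar> powr p
      \<le> 8 * 2 powr p * Cgap * r * (\<Sum>k\<in>carpet_letters. Es (G k))"
    using averages_of_glued_family[of G, OF G(1) G(2) compat 1 j] unfolding G1 Gj .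
  also have "\<dots> \<le> 8 * 2 powr p * Cgap * r * (8 * (Es g + Es h))"
    using sum_bounded_above[of carpet_letters "\<lambda>k. Es (G k)" "Es g + Es h"] G(3) Cgap r_pos
    by (intro mult_left_mono) simp_all
  finally show ?thesis by (simp add: algebra_simps)
qed

abbreviation edge_const :: real where
  "edge_const \<equiv> 64 * 2 powr p * Cgap * r"

definition nbhd :: "nat \<Rightarrow> nat list \<Rightarrow> nat list set" where
  "nbhd n u = {v \<in> carpet_words n. near_words u v}"

lemma finite_nbhd [simp]: "finite (nbhd n u)"
  by (simp add: nbhd_def)

lemma card_nbhd: "card (nbhd n u) \<le> 9"
  unfolding nbhd_def by (rule card_near_words)

lemma nbhd_mem: "v \<in> nbhd n u \<longleftrightarrow> v \<in> carpet_words n \<and> near_words u v"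
  by (simp add: nbhd_def)

text \<open>Each cell has at most nine neighbours, itself included.\<close>

lemma sum_nbhd_le:
  assumes "\<And>w. w \<in> carpet_words n \<Longrightarrow> 0 \<le> c w"
  shows "(\<Sum>u\<in>carpet_words n. \<Sum>w\<in>nbhd n u. c w) \<le> 9 * (\<Sum>w\<in>carpet_words n. c w :: real)"
proof -
  have "(\<Sum>u\<in>carpet_words n. \<Sum>w\<in>nbhd n u. c w) =
      (\<Sum>u\<in>carpet_words n. \<Sum>w\<in>{w \<in> carpet_words n. near_words u w}. c w)"
    by (simp add: nbhd_def)
  also have "\<dots> = (\<Sum>w\<in>carpet_words n. \<Sum>u\<in>{u \<in> carpet_words n. near_words u w}. c w)"
    by (rule sum.swap_restrict) simp_all
  also have "\<dots> = (\<Sum>w\<in>carpet_words n. real (card (nbhd n w)) * c w)"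
    by (simp add: nbhd_def near_words_sym)
  also have "\<dots> \<le> (\<Sum>w\<in>carpet_words n. 9 * c w)"
  proof (rule sum_mono)
    fix w assume "w \<in> carpet_words n"
    then show "real (card (nbhd n w)) * c w \<le> 9 * c w"
      using card_nbhd[of n w] assms by (intro mult_right_mono) auto
  qed
  finally show ?thesis by (simp add: sum_distrib_left)
qed

lemma graph_energy_le_sum:
  assumes c: "\<And>w. w \<in> carpet_words n \<Longrightarrow> 0 \<le> c w" and C: "0 \<le> C"
    and le: "\<And>u v. u \<in> carpet_words n \<Longrightarrow> v \<in> carpet_words n \<Longrightarrow> near_words u v \<Longrightarrow>
        \<bar>\<phi> u - \<phi> v\<bar> powr p \<le> C * (\<Sum>w\<in>nbhd n u. c w)"
  shows "graph_energy K p n \<phi> \<le> 81 * C * (\<Sum>w\<in>carpet_words n. c w)"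
proof -
  have nn: "0 \<le> (\<Sum>w\<in>nbhd n u. c w)" for u using c by (intro sum_nonneg) (simp add: nbhd_mem)
  have "(\<Sum>(u, v)\<in>carpet_adj K n. \<bar>\<phi> u - \<phi> v\<bar> powr p)
      \<le> (\<Sum>(u, v)\<in>(SIGMA u:carpet_words n. nbhd n u). \<bar>\<phi> u - \<phi> v\<bar> powr p)"
    by (rule sum_mono2) (auto simp: carpet_adj_iff nbhd_mem)
  also have "\<dots> = (\<Sum>u\<in>carpet_words n. \<Sum>v\<in>nbhd n u. \<bar>\<phi> u - \<phi> v\<bar> powr p)"
    by (simp add: sum.Sigma)
  also have "\<dots> \<le> (\<Sum>u\<in>carpet_words n. \<Sum>v\<in>nbhd n u. C * (\<Sum>w\<in>nbhd n u. c w))"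
    by (intro sum_mono le) (simp_all add: nbhd_mem)
  also have "\<dots> = (\<Sum>u\<in>carpet_words n. real (card (nbhd n u)) * (C * (\<Sum>w\<in>nbhd n u. c w)))" by simp
  also have "\<dots> \<le> (\<Sum>u\<in>carpet_words n. 9 * (C * (\<Sum>w\<in>nbhd n u. c w)))"
    using card_nbhd nn C by (intro sum_mono mult_right_mono) auto
  also have "\<dots> = 9 * C * (\<Sum>u\<in>carpet_words n. \<Sum>w\<in>nbhd n u. c w)"
    by (simp add: sum_distrib_left mult.assoc)
  also have "\<dots> \<le> 9 * C * (9 * (\<Sum>w\<in>carpet_words n. c w))"
    using sum_nbhd_le[of n c] c C by (intro mult_left_mono) auto
  finally have "(\<Sum>(u, v)\<in>carpet_adj K n. \<bar>\<phi> u - \<phi> v\<bar> powr p) \<le> 81 * C * (\<Sum>w\<in>carpet_words n. c w)"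
    by simp
  moreover have "0 \<le> (\<Sum>(u, v)\<in>carpet_adj K n. \<bar>\<phi> u - \<phi> v\<bar> powr p)"
    by (intro sum_nonneg) auto
  ultimately show ?thesis unfolding graph_energy_def by simp
qed

lemma averages_over_edge_neighbours:
  assumes f: "f \<in> Fs" "continuous_on K f" and u: "u \<in> carpet_words n" and v: "v \<in> carpet_words n"
    and uv: "\<bar>word_x u - word_x v\<bar> + \<bar>word_y u - word_y v\<bar> = 1"
  shows "\<bar>(\<integral>x. f (carpet_word_map u x) \<partial>m) - (\<integral>x. f (carpet_word_map v x) \<partial>m)\<bar> powr p
    \<le> edge_const * (Es (f \<circ> carpet_word_map u) + Es (f \<circ> carpet_word_map v))"
proof -
  let ?e = "\<lambda>w. Es (f \<circ> carpet_word_map w)"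
  let ?I = "\<lambda>w. \<integral>x. f (carpet_word_map w x) \<partial>m"
  have fw: "f \<circ> carpet_word_map w \<in> Fs" "continuous_on K (f \<circ> carpet_word_map w)"
    if "w \<in> carpet_words n" for w
    using Fs_word_map[OF f(1) that] continuous_on_comp_word_map[OF f(2) that] by auto
  have right: "\<bar>?I a - ?I b\<bar> powr p \<le> edge_const * (?e a + ?e b)"
    if a: "a \<in> carpet_words n" and b: "b \<in> carpet_words n"
      and "word_x b = word_x a + 1" "word_y b = word_y a" for a b
  proof -
    have "carpet_word_map a (1, y) = carpet_word_map b (-1, y)" for y
      using that(3,4) by (simp add: cells_meet_iff[OF a b])
    then show ?thesis
      using averages_across_edge[OF fw[OF a] fw[OF b], of False] by simp
  qed
  have up: "\<bar>?I a - ?I b\<bar> powr p \<le> edge_const * (?e a + ?e b)"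
    if a: "a \<in> carpet_words n" and b: "b \<in> carpet_words n"
      and "word_x b = word_x a" "word_y b = word_y a + 1" for a b
  proof -
    have "carpet_word_map a (x, 1) = carpet_word_map b (x, -1)" for x
      using that(3,4) by (simp add: cells_meet_iff[OF a b])
    then show ?thesis
      using averages_across_edge[OF fw[OF a] fw[OF b], of True] by simp
  qed
  have "word_y u = word_y v \<and> (word_x v = word_x u + 1 \<or> word_x u = word_x v + 1) \<or>
      word_x u = word_x v \<and> (word_y v = word_y u + 1 \<or> word_y u = word_y v + 1)"
    using uv by linarith
  then show ?thesis
    using right[OF u v] right[OF v u] up[OF u v] up[OF v u]
    by (auto simp: abs_minus_commute add.commute)
qed

text \<open>Across a corner the comparison goes through the common edge neighbour.\<close>

lemma averages_over_near_cells:
  assumes f: "f \<in> Fs" "continuous_on K f" and u: "u \<in> carpet_words n" and v: "v \<in> carpet_words n"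
    and uv: "near_words u v"
  shows "\<bar>(\<integral>x. f (carpet_word_map u x) \<partial>m) - (\<integral>x. f (carpet_word_map v x) \<partial>m)\<bar> powr p
    \<le> 4 * 2 powr p * edge_const * (\<Sum>w\<in>nbhd n u. Es (f \<circ> carpet_word_map w))"
proof -
  let ?e = "\<lambda>w. Es (f \<circ> carpet_word_map w)"
  let ?I = "\<lambda>w. \<integral>x. f (carpet_word_map w x) \<partial>m"
  let ?A = "\<Sum>w\<in>nbhd n u. ?e w"
  have e0: "0 \<le> ?e w" if "w \<in> carpet_words n" for w by (rule Es_nonneg[OF Fs_word_map[OF f(1) that]])
  have eA: "?e w \<le> ?A" if "w \<in> carpet_words n" "near_words u w" for w
    using that e0 by (intro member_le_sum) (auto simp: nbhd_mem)
  have A0: "0 \<le> ?A" using eA[OF u] e0[OF u] by simp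
  have C0: "0 \<le> edge_const" using Cgap r_pos by simp
  have two: "1 \<le> 2 powr p" using p powr_mono[of 0 p 2] by simp
  define dx where "dx = word_x v - word_x u"
  define dy where "dy = word_y v - word_y u"
  have dxy: "\<bar>dx\<bar> \<le> 1" "\<bar>dy\<bar> \<le> 1" using uv by (auto simp: near_words_def dx_def dy_def)
  then consider "dx = 0" "dy = 0" | "\<bar>dx\<bar> + \<bar>dy\<bar> = 1" | "\<bar>dx\<bar> = 1" "\<bar>dy\<bar> = 1" by linarith
  then show ?thesis
  proof cases
    case 1
    then have "u = v" using word_pos_inj[OF u v] by (simp add: dx_def dy_def)
    moreover have "0 \<le> 4 * 2 powr p * edge_const * ?A"
      using Cgap r_pos A0 by (intro mult_nonneg_nonneg) auto
    ultimately show ?thesis by (simp only: diff_self abs_zero powr_zero_eq_one powr_0)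
  next
    case 2
    have "\<bar>?I u - ?I v\<bar> powr p \<le> edge_const * (?e u + ?e v)"
      using averages_over_edge_neighbours[OF f u v] 2 by (simp add: dx_def dy_def abs_minus_commute)
    also have "\<dots> \<le> edge_const * (2 * ?A)"
      using eA[OF u] eA[OF v uv] C0 by (intro mult_left_mono) auto
    also have "\<dots> \<le> edge_const * (4 * 2 powr p * ?A)"
      using C0 A0 two by (intro mult_left_mono mult_right_mono) auto
    finally show ?thesis by (simp add: mult_ac)
  next
    case 3
    have "\<exists>w\<in>carpet_words n. (word_x w = word_x u + dx \<and> word_y w = word_y u) \<or>
        (word_x w = word_x u \<and> word_y w = word_y u + dy)"
      by (rule corner_common_neighbour[OF u v 3]) (simp_all add: dx_def dy_def)
    then obtain w where w: "w \<in> carpet_words n" "(word_x w = word_x u + dx \<and> word_y w = word_y u) \<or>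
        (word_x w = word_x u \<and> word_y w = word_y u + dy)" by blast
    have uw: "\<bar>word_x u - word_x w\<bar> + \<bar>word_y u - word_y w\<bar> = 1"
      using w(2) 3 by auto
    have wv: "\<bar>word_x w - word_x v\<bar> + \<bar>word_y w - word_y v\<bar> = 1"
      using w(2) 3 by (auto simp: dx_def dy_def)
    have near: "near_words u w" using uw by (auto simp: near_words_def)
    have "\<bar>?I u - ?I v\<bar> powr p \<le> 2 powr p * (\<bar>?I u - ?I w\<bar> powr p + \<bar>?I w - ?I v\<bar> powr p)"
      using powr_add_le[of p "?I u - ?I w" "?I w - ?I v"] p by simp
    also have "\<dots> \<le> 2 powr p * (edge_const * (?e u + ?e w) + edge_const * (?e w + ?e v))"
      using averages_over_edge_neighbours[OF f u w(1) uw] averages_over_edge_neighbours[OF f w(1) v wv]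
      by (intro mult_left_mono add_mono) auto
    also have "\<dots> \<le> 2 powr p * (edge_const * (2 * ?A) + edge_const * (2 * ?A))"
      using eA[OF u] eA[OF v uv] eA[OF w(1) near] C0
      by (intro mult_left_mono add_mono) auto
    finally show ?thesis by (simp add: mult_ac)
  qed
qed

text \<open>The factor 324 is 81, from two summations over at most nine neighbours, times 4, which together
  with \<open>2 powr p\<close> comes from the passage through a common neighbour.\<close>

definition upper_const :: real where
  "upper_const = 324 * 2 powr p * edge_const"

lemma upper_const_nonneg: "0 \<le> upper_const"
  using Cgap r_pos by (simp add: upper_const_def)

lemma graph_energy_nonneg: "0 \<le> graph_energy K p n \<phi>"
  unfolding graph_energy_def by (auto intro!: mult_nonneg_nonneg sum_nonneg)

lemma graph_energy_le_Es_continuous: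
  assumes f: "f \<in> Fs" "continuous_on K f"
  shows "r ^ n * graph_energy K p n (cell_average K m f) \<le> upper_const * Es f"
proof -
  have "graph_energy K p n (cell_average K m f) \<le>
      81 * (4 * 2 powr p * edge_const) * (\<Sum>w\<in>carpet_words n. Es (f \<circ> carpet_word_map w))"
  proof (rule graph_energy_le_sum)
    show "0 \<le> Es (f \<circ> carpet_word_map w)" if "w \<in> carpet_words n" for w
      by (rule Es_nonneg[OF Fs_word_map[OF f(1) that]])
    show "\<bar>cell_average K m f u - cell_average K m f v\<bar> powr p \<le>
        4 * 2 powr p * edge_const * (\<Sum>w\<in>nbhd n u. Es (f \<circ> carpet_word_map w))"
      if "u \<in> carpet_words n" "v \<in> carpet_words n" "near_words u v" for u v
      using averages_over_near_cells[OF f that] that by (simp add: cell_average_eq Fs_integrable[OF f(1)])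
  qed (use Cgap r_pos in simp)
  also have "\<dots> = upper_const * (\<Sum>w\<in>carpet_words n. Es (f \<circ> carpet_word_map w))"
    by (simp add: upper_const_def)
  finally have "r ^ n * graph_energy K p n (cell_average K m f) \<le>
      r ^ n * (upper_const * (\<Sum>w\<in>carpet_words n. Es (f \<circ> carpet_word_map w)))"
    using r_pos by (intro mult_left_mono) auto
  then show ?thesis unfolding Es_words[OF f(1), of n] by (simp add: mult_ac)
qed

lemma cell_average_diff_le:
  assumes "integrable m f" "integrable m h" "u \<in> carpet_words n"
  shows "\<bar>cell_average K m f u - cell_average K m h u\<bar> \<le> 8 ^ n * (\<integral>x. \<bar>f x - h x\<bar> \<partial>m)"
proof -
  let ?D = "\<lambda>w. \<integral>x. \<bar>f (carpet_word_map w x) - h (carpet_word_map w x)\<bar> \<partial>m"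
  have int: "integrable m (\<lambda>x. f (carpet_word_map u x))" "integrable m (\<lambda>x. h (carpet_word_map u x))"
    using integrable_comp_word_map assms by (auto simp: comp_def)
  have "\<bar>cell_average K m f u - cell_average K m h u\<bar> =
      \<bar>\<integral>x. f (carpet_word_map u x) - h (carpet_word_map u x) \<partial>m\<bar>"
    using int assms by (simp add: cell_average_eq)
  also have "\<dots> \<le> ?D u" by (rule integral_abs_bound)
  also have "\<dots> \<le> (\<Sum>w\<in>carpet_words n. ?D w)"
    using assms(3) by (intro member_le_sum) auto
  also have "\<dots> = 8 ^ n * (\<integral>x. \<bar>f x - h x\<bar> \<partial>m)"
    using integral_words[of "\<lambda>x. \<bar>f x - h x\<bar>" n] assms(1,2) by (simp add: power_one_over)
  finally show ?thesis .
qed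

lemma energy_norm_bounds:
  assumes "f \<in> Fs"
  shows "(\<integral>x. \<bar>f x\<bar> \<partial>m) \<le> energy_norm m p Es f" "Es f powr (1 / p) \<le> energy_norm m p Es f"
proof -
  let ?L = "\<integral>x. \<bar>f x\<bar> powr p \<partial>m"
  have L0: "0 \<le> ?L" by (rule Bochner_Integration.integral_nonneg) simp
  have N: "energy_norm m p Es f = (?L + Es f) powr (1 / p)"
    using p L0 by (simp add: energy_norm_def Lp_norm_def powr_powr)
  have abs: "(\<lambda>x. \<bar>f x\<bar>) \<in> Lp m p" using Fs_Lp[OF assms] by (auto simp: Lp_def)
  have "(\<integral>x. \<bar>f x\<bar> \<partial>m) powr p \<le> ?L"
    using Lp_jensen[OF prob_m _ abs] p by simp
  then have "((\<integral>x. \<bar>f x\<bar> \<partial>m) powr p) powr (1 / p) \<le> (?L + Es f) powr (1 / p)"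
    using p Es_nonneg[OF assms] by (intro powr_mono2) auto
  then show "(\<integral>x. \<bar>f x\<bar> \<partial>m) \<le> energy_norm m p Es f"
    using p by (simp add: N powr_powr)
  show "Es f powr (1 / p) \<le> energy_norm m p Es f"
    unfolding N using p L0 Es_nonneg[OF assms] by (intro powr_mono2) auto
qed

text \<open>For a general element of the domain both sides are limits along continuous functions that
  approximate it in the energy norm.\<close>

lemma graph_energy_le_Es:
  assumes f: "f \<in> Fs"
  shows "r ^ n * graph_energy K p n (cell_average K m f) \<le> upper_const * Es f"
proof -
  have "\<exists>h. h \<in> Fs \<and> continuous_on K h \<and> energy_norm m p Es (\<lambda>x. f x - h x) < 1 / Suc k" for k
    using c_norm[OF f, of "1 / Suc k"] by auto
  then obtain h where h: "\<And>k. h k \<in> Fs" "\<And>k. continuous_on K (h k)"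
    "\<And>k. energy_norm m p Es (\<lambda>x. f x - h k x) < 1 / Suc k" by metis
  have dF: "(\<lambda>x. f x - h k x) \<in> Fs" for k by (rule Fs_diff[OF f h(1)])
  have inv0: "(\<lambda>k. 1 / real (Suc k)) \<longlonglongrightarrow> 0"
    using LIMSEQ_inverse_real_of_nat by (simp add: inverse_eq_divide)
  have avg: "(\<lambda>k. cell_average K m (h k) u) \<longlonglongrightarrow> cell_average K m f u" if u: "u \<in> carpet_words n" for u
  proof (rule LIM_zero_cancel, rule Lim_null_comparison)
    show "(\<lambda>k. 8 ^ n * (1 / real (Suc k))) \<longlonglongrightarrow> 0"
      using tendsto_mult_right_zero[OF inv0] by simp
    have "norm (cell_average K m (h k) u - cell_average K m f u) \<le> 8 ^ n * (1 / Suc k)" for k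
    proof -
      have "\<bar>cell_average K m f u - cell_average K m (h k) u\<bar> \<le> 8 ^ n * (\<integral>x. \<bar>f x - h k x\<bar> \<partial>m)"
        by (rule cell_average_diff_le[OF Fs_integrable[OF f] Fs_integrable[OF h(1)] u])
      also have "\<dots> \<le> 8 ^ n * (1 / Suc k)"
        using energy_norm_bounds(1)[OF dF[of k]] h(3)[of k] by (intro mult_left_mono) auto
      finally show ?thesis by (simp add: abs_minus_commute)
    qed
    then show "eventually (\<lambda>k. norm (cell_average K m (h k) u - cell_average K m f u) \<le> 8 ^ n * (1 / Suc k)) sequentially"
      by simp
  qed
  have "(\<lambda>k. graph_energy K p n (cell_average K m (h k))) \<longlonglongrightarrow> graph_energy K p n (cell_average K m f)"
    unfolding graph_energy_def
  proof (intro tendsto_mult tendsto_const tendsto_sum)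
    fix uv assume "uv \<in> carpet_adj K n"
    then obtain u v where uv: "uv = (u, v)" "u \<in> carpet_words n" "v \<in> carpet_words n"
      by (cases uv) (auto simp: carpet_adj_iff)
    have "(\<lambda>k. \<bar>cell_average K m (h k) u - cell_average K m (h k) v\<bar> powr p)
        \<longlonglongrightarrow> \<bar>cell_average K m f u - cell_average K m f v\<bar> powr p"
      using p by (intro tendsto_powr' tendsto_rabs tendsto_diff avg uv tendsto_const) auto
    then show "(\<lambda>k. case uv of (u, v) \<Rightarrow> \<bar>cell_average K m (h k) u - cell_average K m (h k) v\<bar> powr p)
        \<longlonglongrightarrow> (case uv of (u, v) \<Rightarrow> \<bar>cell_average K m f u - cell_average K m f v\<bar> powr p)"
      by (simp add: uv(1))
  qed
  then have lhs: "(\<lambda>k. r ^ n * graph_energy K p n (cell_average K m (h k)))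
      \<longlonglongrightarrow> r ^ n * graph_energy K p n (cell_average K m f)"
    by (intro tendsto_mult tendsto_const)
  have "(\<lambda>k. upper_const * (Es f powr (1 / p) + 1 / real (Suc k)) powr p) \<longlonglongrightarrow>
      upper_const * (Es f powr (1 / p) + 0) powr p"
    using p by (intro tendsto_mult tendsto_powr' tendsto_add tendsto_const inv0) (auto intro!: always_eventually)
  then have rhs: "(\<lambda>k. upper_const * (Es f powr (1 / p) + 1 / real (Suc k)) powr p) \<longlonglongrightarrow> upper_const * Es f"
    using Es_eq_powr[OF f] by simp
  show ?thesis
  proof (rule LIMSEQ_le[OF lhs rhs], intro exI allI impI)
    fix k :: nat
    have neg: "(\<lambda>x. - 1 * (f x - h k x)) \<in> Fs" by (rule Fs_scale[OF dF])
    have "Es (h k) powr (1 / p) = Es (\<lambda>x. f x + - 1 * (f x - h k x)) powr (1 / p)" by simp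
    also have "\<dots> \<le> Es f powr (1 / p) + Es (\<lambda>x. - 1 * (f x - h k x)) powr (1 / p)"
      by (rule b_triangle[unfolded triangle_on_def, rule_format, OF f neg])
    also have "Es (\<lambda>x. - 1 * (f x - h k x)) = Es (\<lambda>x. f x - h k x)"
      using a_scale[OF dF[of k], of "-1"] by simp
    also have "Es (\<lambda>x. f x - h k x) powr (1 / p) \<le> 1 / Suc k"
      using energy_norm_bounds(2)[OF dF[of k]] h(3)[of k] by simp
    finally have "(Es (h k) powr (1 / p)) powr p \<le> (Es f powr (1 / p) + 1 / Suc k) powr p"
      using p by (intro powr_mono2) auto
    then have "Es (h k) \<le> (Es f powr (1 / p) + 1 / Suc k) powr p"
      using Es_eq_powr[OF h(1)[of k]] by simp
    then have "upper_const * Es (h k) \<le> upper_const * (Es f powr (1 / p) + 1 / Suc k) powr p"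
      using upper_const_nonneg by (intro mult_left_mono)
    then show "r ^ n * graph_energy K p n (cell_average K m (h k)) \<le>
        upper_const * (Es f powr (1 / p) + 1 / real (Suc k)) powr p"
      using graph_energy_le_Es_continuous[OF h(1)[of k] h(2)[of k], of n] by linarith
  qed
qed

end

section \<open>Interpolation from vertex values\<close>

text \<open>One coordinate of a vertex of the cell at position \<open>k\<close>, in units in which the side length of the
  cell is 2; the left or lower end is selected by \<open>True\<close>, in accordance with \<open>reflection\<close>, which
  maps the upper right vertex to the selected one.\<close>

definition corner :: "bool \<Rightarrow> int \<Rightarrow> int" where
  "corner s k = 2 * k + (if s then -1 else 1)"

lemma corner_shared: "\<bar>corner s k - 2 * l\<bar> = 1 \<Longrightarrow> \<bar>k - l\<bar> \<le> 1"
  unfolding corner_def by (cases s; simp only: if_True if_False; presburger)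

lemma sum_bool_pairs:
  "(\<Sum>st\<in>UNIV. h st) = h (False, False) + h (True, False) + h (False, True) + (h (True, True) :: real)"
proof -
  have *: "(UNIV :: (bool \<times> bool) set) = {(False, False), (True, False), (False, True), (True, True)}"
    by auto
  show ?thesis by (subst *) simp
qed

lemma card_bool_pairs: "card (UNIV :: (bool \<times> bool) set) = 4"
  by (simp add: card_prod)

context carpet_energy
begin

lemma Fs_comp_affine:
  assumes "f \<in> Fs" shows "(\<lambda>z. c * f z + a) \<in> Fs"
  using Fs_add[OF Fs_scale[OF assms] Fs_const] .

text \<open>Regularity provides a function close to the first coordinate; truncation makes it constant on
  the left and on the right side of the carpet. Averaging over reflections adds the symmetries.\<close>

lemma separating_function:
  "\<exists>a\<in>Fs. continuous_on K a \<and> (\<forall>z. 0 \<le> a z \<and> a z \<le> 1) \<and> (\<forall>x y. a (- x, y) = 1 - a (x, y)) \<and>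
     (\<forall>x y. a (x, - y) = a (x, y)) \<and> (\<forall>y. (-1, y) \<in> K \<longrightarrow> a (-1, y) = 0)"
proof -
  have "continuous_on K fst" by (intro continuous_intros)
  then obtain g where g: "g \<in> Fs" "continuous_on K g" "\<And>z. z \<in> K \<Longrightarrow> \<bar>fst z - g z\<bar> < 1 / 2"
    using c_uniform[of fst "1/2"] by auto
  \<comment> \<open>below \<open>-1/2\<close> on the left side and above \<open>1/2\<close> on the right side, \<open>g\<close> is cut off to 0 and 1\<close>
  define \<alpha> where "\<alpha> z = min (max (g z + 1 / 2) 0) 1" for z
  have \<alpha>: "\<alpha> \<in> Fs" "continuous_on K \<alpha>"
    unfolding \<alpha>_def using contraction[OF Fs_add[OF g(1) Fs_const[of "1/2"]]]
    by (auto intro!: continuous_intros g(2))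
  have \<alpha>01: "0 \<le> \<alpha> z" "\<alpha> z \<le> 1" for z by (simp_all add: \<alpha>_def)
  have \<alpha>_left: "\<alpha> (-1, y) = 0" if "(-1, y) \<in> K" for y
  proof -
    have "g (-1, y) + 1 / 2 \<le> 0" using g(3)[OF that] unfolding fst_conv by linarith
    then show ?thesis by (simp add: \<alpha>_def)
  qed
  have \<alpha>_right: "\<alpha> (1, y) = 1" if "(1, y) \<in> K" for y
  proof -
    have "1 \<le> g (1, y) + 1 / 2" using g(3)[OF that] unfolding fst_conv by linarith
    then show ?thesis by (simp add: \<alpha>_def)
  qed
  let ?R = "\<lambda>s t. \<alpha> \<circ> reflection s t"
  define a where "a z = 1 / 4 * ((?R False False z + ?R False True z) + (- 1) * (?R True False z + ?R True True z)) + 1 / 2" for z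
  have "a \<in> Fs" unfolding a_def
    by (intro Fs_comp_affine Fs_add Fs_scale reflection_Fs(1) \<alpha>)
  moreover have "continuous_on K a" unfolding a_def
    by (intro continuous_intros reflection_continuous \<alpha>)
  moreover have "0 \<le> a z \<and> a z \<le> 1" for z
    using \<alpha>01(1)[of "reflection False False z"] \<alpha>01(1)[of "reflection False True z"]
      \<alpha>01(1)[of "reflection True False z"] \<alpha>01(1)[of "reflection True True z"]
      \<alpha>01(2)[of "reflection False False z"] \<alpha>01(2)[of "reflection False True z"]
      \<alpha>01(2)[of "reflection True False z"] \<alpha>01(2)[of "reflection True True z"]
    unfolding a_def o_apply by (simp add: field_simps)
  moreover have "a (- x, y) = 1 - a (x, y)" "a (x, - y) = a (x, y)" for x y
    by (simp_all add: a_def reflection_def field_simps)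
  moreover have "a (-1, y) = 0" if y: "(-1, y) \<in> K" for y
  proof -
    have "(-1, - y) \<in> K" "(1, y) \<in> K" "(1, - y) \<in> K"
      using reflection_in_K[OF y, of False True] reflection_in_K[OF y, of True False]
        reflection_in_K[OF y, of True True] by (simp_all add: reflection_def)
    then show ?thesis using y by (simp add: a_def reflection_def \<alpha>_left \<alpha>_right)
  qed
  ultimately show ?thesis by blast
qed

text \<open>With coordinate-like functions \<open>a\<close> (rising from left to right) and \<open>b\<close> (rising upwards), products
  would give a partition of unity, but the domain is not known to be closed under products. The
  truncations of \<open>a + b - 1\<close> and of its reflections replace them. Writing \<open>s = 2 a - 1\<close> and
  \<open>t = 2 b - 1\<close>, they add up to the maximum of \<open>\<bar>s\<bar>\<close> and \<open>\<bar>t\<bar>\<close>. This is 1 on all four sides of the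
  square, and so the defect from 1 can be distributed equally among the four corners without
  disturbing the boundary values.\<close>

lemma corner_bump_exists:
  "\<exists>\<beta>. \<beta> \<in> Fs \<and> continuous_on K \<beta> \<and> (\<forall>z\<in>K. fst z = -1 \<or> snd z = -1 \<longrightarrow> \<beta> z = 0) \<and>
     (\<forall>z. (\<Sum>st\<in>UNIV. \<beta> (reflection (fst st) (snd st) z)) = 1)"
proof -
  obtain a where a: "a \<in> Fs" "continuous_on K a" "\<And>z. 0 \<le> a z" "\<And>z. a z \<le> 1"
    "\<And>x y. a (- x, y) = 1 - a (x, y)" "\<And>x y. a (x, - y) = a (x, y)"
    "\<And>y. (-1, y) \<in> K \<Longrightarrow> a (-1, y) = 0"
    using separating_function by blast
  define b where "b = a \<circ> swap_axes"
  have b: "b \<in> Fs" "continuous_on K b"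
    unfolding b_def using symmetry_Fs[OF a(1) carpet_symmetries_generators(3)]
      continuous_on_comp_symmetry(3)[OF a(2)] by blast+
  have b_eq: "b (x, y) = a (y, x)" for x y by (simp add: b_def)
  define t where "t z = min (max (a z + b z + (- 1)) 0) 1" for z
  have t: "t \<in> Fs" "continuous_on K t"
    unfolding t_def using contraction[OF Fs_add[OF Fs_add[OF a(1) b(1)] Fs_const[of "-1"]]]
    by (auto intro!: continuous_intros a(2) b(2))
  let ?S = "\<lambda>z. \<Sum>st\<in>UNIV. (t \<circ> reflection (fst st) (snd st)) z"
  define \<beta> where "\<beta> z = t z + (- 1 / 4 * ?S z + 1 / 4)" for z
  have "\<beta> \<in> Fs" unfolding \<beta>_def
    by (intro Fs_add Fs_comp_affine Fs_sum reflection_Fs(1) t) simp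
  moreover have "continuous_on K \<beta>" unfolding \<beta>_def
    by (intro continuous_intros reflection_continuous t)
  moreover have "\<beta> (x, y) = 0" if "(x, y) \<in> K" "x = -1 \<or> y = -1" for x y
  proof -
    have "a (x, y) = 0 \<or> a (y, x) = 0"
      using that a(7)[of y] a(7)[of x] reflect_in_K(3)[OF that(1)] by auto
    moreover have "0 \<le> a (x, y)" "a (x, y) \<le> 1" "0 \<le> a (y, x)" "a (y, x) \<le> 1"
      by (rule a)+
    ultimately show ?thesis
      by (elim disjE) (simp_all add: \<beta>_def sum_bool_pairs t_def reflection_def b_eq a(5,6) min_def max_def)
  qed
  moreover have "(\<Sum>st\<in>UNIV. \<beta> (reflection (fst st) (snd st) z)) = 1" for z
    by (simp add: \<beta>_def sum_bool_pairs reflection_def field_simps)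
  ultimately show ?thesis by (intro exI[of _ \<beta>]) auto
qed

text \<open>The bump belongs to the upper right vertex of the square; the other three are its reflections.\<close>

definition bump :: "plane \<Rightarrow> real" where
  "bump = (SOME \<beta>. \<beta> \<in> Fs \<and> continuous_on K \<beta> \<and> (\<forall>z\<in>K. fst z = -1 \<or> snd z = -1 \<longrightarrow> \<beta> z = 0) \<and>
     (\<forall>z. (\<Sum>st\<in>UNIV. \<beta> (reflection (fst st) (snd st) z)) = 1))"

lemma bump_Fs: "bump \<in> Fs" and bump_continuous: "continuous_on K bump"
  and bump_zero: "z \<in> K \<Longrightarrow> fst z = -1 \<or> snd z = -1 \<Longrightarrow> bump z = 0"
  and bump_partition: "(\<Sum>st\<in>UNIV. bump (reflection (fst st) (snd st) z)) = 1"
  using someI_ex[OF corner_bump_exists, folded bump_def] by blast+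

text \<open>Interpolation, in the cell of \<open>w\<close> and in the coordinates of the whole carpet, of the values that
  \<open>V\<close> takes at the four vertices of the cell.\<close>

definition cell_interp :: "(int \<Rightarrow> int \<Rightarrow> real) \<Rightarrow> nat list \<Rightarrow> plane \<Rightarrow> real" where
  "cell_interp V w z = (\<Sum>st\<in>UNIV. V (corner (fst st) (word_x w)) (corner (snd st) (word_y w)) *
     (bump \<circ> reflection (fst st) (snd st)) z)"

lemma cell_interp_Fs: "cell_interp V w \<in> Fs"
  unfolding cell_interp_def by (intro Fs_sum Fs_scale reflection_Fs(1) bump_Fs) simp

lemma cell_interp_continuous: "continuous_on K (cell_interp V w)"
  unfolding cell_interp_def by (intro continuous_intros reflection_continuous bump_continuous)

lemma cell_interp_shift:
  "cell_interp V w z = cell_interp (\<lambda>x y. V x y - c) w z + c"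
  using bump_partition[of z]
  by (simp add: cell_interp_def left_diff_distrib sum_subtractf flip: sum_distrib_left)

text \<open>On a side of a cell only the bumps of the two end points of this side are nonzero, and from the
  two cells at that side they are seen as the same function.\<close>

lemma cell_interp_compatible:
  assumes u: "u \<in> carpet_words n" and v: "v \<in> carpet_words n" and a: "a \<in> K" and b: "b \<in> K"
    and eq: "carpet_word_map u a = carpet_word_map v b"
  shows "cell_interp V u a = cell_interp V v b"
proof -
  have eqs: "fst a + 2 * real_of_int (word_x u) = fst b + 2 * real_of_int (word_x v)"
    "snd a + 2 * real_of_int (word_y u) = snd b + 2 * real_of_int (word_y v)"
    using eq cells_meet_iff[OF u v, of a b] by simp_all
  obtain a1 a2 b1 b2 where ab: "a = (a1, a2)" "b = (b1, b2)" by (metis surj_pair)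
  have zero: "bump (x, y) = 0" if "(x, y) \<in> {(a1, a2), (- a1, a2), (a1, - a2), (- a1, - a2),
      (b1, b2), (- b1, b2), (b1, - b2), (- b1, - b2)}" "x = -1 \<or> y = -1" for x y
  proof -
    have "(x, y) \<in> K"
      using that(1) a b reflection_in_K[OF a, of True False] reflection_in_K[OF a, of False True]
        reflection_in_K[OF a, of True True] reflection_in_K[OF b, of True False]
        reflection_in_K[OF b, of False True] reflection_in_K[OF b, of True True]
      unfolding ab by (auto simp: reflection_def)
    then show ?thesis using bump_zero[of "(x, y)"] that(2) by simp
  qed
  note simps = cell_interp_def sum_bool_pairs reflection_def corner_def ab
  show ?thesis
  proof (cases rule: shift_cases[OF K_subset_box(1)[OF a] K_subset_box(1)[OF b] eqs(1)])
    case x: 1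
    show ?thesis
      by (cases rule: shift_cases[OF K_subset_box(2)[OF a] K_subset_box(2)[OF b] eqs(2)])
         (use x zero in \<open>simp_all add: simps add.commute\<close>)
  next
    case x: 2
    show ?thesis
      by (cases rule: shift_cases[OF K_subset_box(2)[OF a] K_subset_box(2)[OF b] eqs(2)])
         (use x zero in \<open>simp_all add: simps add.commute\<close>)
  next
    case x: 3
    show ?thesis
      by (cases rule: shift_cases[OF K_subset_box(2)[OF a] K_subset_box(2)[OF b] eqs(2)])
         (use x zero in \<open>simp_all add: simps add.commute\<close>)
  qed
qed

definition interp_const :: real where "interp_const = 4 powr p * Es bump"

lemma interp_const_nonneg: "0 \<le> interp_const"
  using Es_nonneg[OF bump_Fs] by (simp add: interp_const_def)

text \<open>Since the bumps sum to 1, any constant may be subtracted from the vertex values.\<close>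

lemma Es_cell_interp_le:
  "Es (cell_interp V w) \<le> interp_const *
     (\<Sum>st\<in>UNIV. \<bar>V (corner (fst st) (word_x w)) (corner (snd st) (word_y w)) - c\<bar> powr p)"
proof -
  let ?V = "\<lambda>st. V (corner (fst st) (word_x w)) (corner (snd st) (word_y w)) - c"
  let ?b = "\<lambda>st. bump \<circ> reflection (fst st) (snd st)"
  have "cell_interp V w = (\<lambda>z. cell_interp (\<lambda>x y. V x y - c) w z + c)"
    by (rule ext) (rule cell_interp_shift)
  then have "Es (cell_interp V w) = Es (cell_interp (\<lambda>x y. V x y - c) w)"
    using a_shift[OF cell_interp_Fs] by metis
  also have "\<dots> = Es (\<lambda>z. \<Sum>st\<in>UNIV. ?V st * ?b st z)" by (simp add: cell_interp_def[abs_def])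
  also have "\<dots> \<le> real (card (UNIV :: (bool \<times> bool) set)) powr p * (\<Sum>st\<in>UNIV. Es (\<lambda>z. ?V st * ?b st z))"
    by (rule Es_sum_le) (simp_all only: finite_UNIV finite Fs_scale reflection_Fs(1) bump_Fs)
  also have "(\<Sum>st\<in>UNIV. Es (\<lambda>z. ?V st * ?b st z)) = (\<Sum>st\<in>UNIV. \<bar>?V st\<bar> powr p * Es bump)"
    by (intro sum.cong refl) (simp only: a_scale[OF reflection_Fs(1)[OF bump_Fs]] reflection_Fs(2)[OF bump_Fs])
  finally show ?thesis
    by (simp add: interp_const_def card_bool_pairs sum_distrib_right sum_distrib_left mult_ac)
qed

lemma interpolation_exists:
  obtains H where "H \<in> Fs" "continuous_on K H"
    "\<And>w x. w \<in> carpet_words n \<Longrightarrow> x \<in> K \<Longrightarrow> H (carpet_word_map w x) = cell_interp V w x"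
    "Es H = r ^ n * (\<Sum>w\<in>carpet_words n. Es (cell_interp V w))"
proof (rule glue_Fs[of n "cell_interp V", OF cell_interp_Fs cell_interp_continuous cell_interp_compatible])
  fix H assume "H \<in> Fs" "continuous_on K H"
    "\<And>w x. w \<in> carpet_words n \<Longrightarrow> x \<in> K \<Longrightarrow> H (carpet_word_map w x) = cell_interp V w x"
    "Es H = r ^ n * (\<Sum>w\<in>carpet_words n. Es (cell_interp V w))"
  then show thesis by (rule that)
qed assumption+

subsection \<open>Interpolation of a function on cells\<close>

text \<open>The value at a vertex is copied from an arbitrary one of the cells that have this vertex. All of
  these are neighbours of each other, so the choice is immaterial for the energy estimates.\<close>

definition vertex_value :: "nat \<Rightarrow> (nat list \<Rightarrow> real) \<Rightarrow> int \<Rightarrow> int \<Rightarrow> real" where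
  "vertex_value n \<phi> X Y =
     \<phi> (SOME v. v \<in> carpet_words n \<and> \<bar>X - 2 * word_x v\<bar> = 1 \<and> \<bar>Y - 2 * word_y v\<bar> = 1)"

lemma vertex_value_near:
  assumes "w \<in> carpet_words n"
  shows "\<exists>v\<in>nbhd n w. vertex_value n \<phi> (corner s (word_x w)) (corner t (word_y w)) = \<phi> v"
proof -
  let ?P = "\<lambda>v. v \<in> carpet_words n \<and> \<bar>corner s (word_x w) - 2 * word_x v\<bar> = 1 \<and>
      \<bar>corner t (word_y w) - 2 * word_y v\<bar> = 1"
  have "?P w" using assms by (simp add: corner_def)
  then have P: "?P (SOME v. ?P v)" by (rule someI)
  then have "(SOME v. ?P v) \<in> nbhd n w"
    unfolding nbhd_mem near_words_def by (elim conjE) (intro conjI corner_shared, assumption+)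
  then show ?thesis unfolding vertex_value_def by blast
qed

lemma bump_bounded:
  obtains B where "0 < B" "\<And>z. z \<in> K \<Longrightarrow> \<bar>bump z\<bar> \<le> B"
proof -
  obtain B where B: "\<And>z. z \<in> K \<Longrightarrow> \<bar>bump z\<bar> \<le> B" using continuous_bounded[OF bump_continuous] by blast
  show ?thesis
  proof (rule that)
    show "0 < max B 1" by simp
    show "\<bar>bump z\<bar> \<le> max B 1" if "z \<in> K" for z using B[OF that] by simp
  qed
qed

text \<open>A quantitative form of locality: the interpolation on a cell depends on the neighbours of
  this cell only.\<close>

lemma cell_interp_deviation:
  assumes w: "w \<in> carpet_words n" and x: "x \<in> K" and B: "0 < B" "\<And>z. z \<in> K \<Longrightarrow> \<bar>bump z\<bar> \<le> B"
  shows "\<bar>cell_interp (vertex_value n \<phi>) w x - c\<bar> \<le> 4 * B * (\<Sum>v\<in>nbhd n w. \<bar>\<phi> v - c\<bar>)"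
proof -
  let ?S = "\<Sum>v\<in>nbhd n w. \<bar>\<phi> v - c\<bar>"
  let ?t = "\<lambda>st. (vertex_value n \<phi> (corner (fst st) (word_x w)) (corner (snd st) (word_y w)) - c) *
      bump (reflection (fst st) (snd st) x)"
  have "cell_interp (vertex_value n \<phi>) w x - c = (\<Sum>st\<in>UNIV. ?t st)"
    by (subst cell_interp_shift[of _ _ _ c]) (simp add: cell_interp_def)
  also have "\<bar>\<dots>\<bar> \<le> (\<Sum>st\<in>UNIV. \<bar>?t st\<bar>)" by (rule sum_abs)
  also have "\<dots> \<le> (\<Sum>st\<in>(UNIV :: (bool \<times> bool) set). ?S * B)"
  proof (rule sum_mono)
    fix st :: "bool \<times> bool"
    obtain v where v: "v \<in> nbhd n w"
      "vertex_value n \<phi> (corner (fst st) (word_x w)) (corner (snd st) (word_y w)) = \<phi> v"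
      using vertex_value_near[OF w] by blast
    have "\<bar>\<phi> v - c\<bar> \<le> ?S" using v(1) by (intro member_le_sum) auto
    then show "\<bar>?t st\<bar> \<le> ?S * B"
      unfolding v(2) abs_mult using B(2)[OF reflection_in_K[OF x]]
      by (intro mult_mono) (auto intro: sum_nonneg)
  qed
  finally show ?thesis by (simp add: card_bool_pairs mult_ac)
qed

lemma cell_interp_const:
  assumes w: "w \<in> carpet_words n" and x: "x \<in> K" and c: "\<And>v. v \<in> nbhd n w \<Longrightarrow> \<phi> v = c"
  shows "cell_interp (vertex_value n \<phi>) w x = c"
proof -
  obtain B where B: "0 < B" "\<And>z. z \<in> K \<Longrightarrow> \<bar>bump z\<bar> \<le> B" using bump_bounded by blast
  have "(\<Sum>v\<in>nbhd n w. \<bar>\<phi> v - c\<bar>) = 0" using c by (intro sum.neutral) auto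
  then show ?thesis using cell_interp_deviation[OF w x B, of \<phi> c] by simp
qed

lemma sum_nbhd_eq_graph_energy:
  "(\<Sum>w\<in>carpet_words n. \<Sum>v\<in>nbhd n w. \<bar>\<phi> v - \<phi> w\<bar> powr p) = 2 * graph_energy K p n \<phi>"
proof -
  have "(\<Sum>w\<in>carpet_words n. \<Sum>v\<in>nbhd n w. \<bar>\<phi> v - \<phi> w\<bar> powr p) =
      (\<Sum>(w, v)\<in>(SIGMA w:carpet_words n. nbhd n w). \<bar>\<phi> w - \<phi> v\<bar> powr p)"
    by (simp add: sum.Sigma abs_minus_commute)
  also have "\<dots> = (\<Sum>(w, v)\<in>carpet_adj K n. \<bar>\<phi> w - \<phi> v\<bar> powr p)"
    using p by (intro sum.mono_neutral_right) (auto simp: carpet_adj_iff nbhd_mem)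
  finally show ?thesis by (simp add: graph_energy_def)
qed

text \<open>Four vertices contribute on each cell, and every edge is seen from both of its ends.\<close>

definition lower_const :: real where "lower_const = 8 * interp_const"

lemma lower_const_nonneg: "0 \<le> lower_const"
  using interp_const_nonneg by (simp add: lower_const_def)

lemma discrete_interpolation:
  obtains H where "H \<in> Fs" "continuous_on K H"
    "\<And>w x. w \<in> carpet_words n \<Longrightarrow> x \<in> K \<Longrightarrow>
        H (carpet_word_map w x) = cell_interp (vertex_value n \<phi>) w x"
    "Es H \<le> lower_const * (r ^ n * graph_energy K p n \<phi>)"
proof -
  obtain H where H: "H \<in> Fs" "continuous_on K H"
    "\<And>w x. w \<in> carpet_words n \<Longrightarrow> x \<in> K \<Longrightarrow>
        H (carpet_word_map w x) = cell_interp (vertex_value n \<phi>) w x"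
    "Es H = r ^ n * (\<Sum>w\<in>carpet_words n. Es (cell_interp (vertex_value n \<phi>) w))"
    using interpolation_exists[of n "vertex_value n \<phi>"] by blast
  have "Es (cell_interp (vertex_value n \<phi>) w) \<le> interp_const * (4 * (\<Sum>v\<in>nbhd n w. \<bar>\<phi> v - \<phi> w\<bar> powr p))"
    if w: "w \<in> carpet_words n" for w
  proof -
    let ?S = "\<Sum>v\<in>nbhd n w. \<bar>\<phi> v - \<phi> w\<bar> powr p"
    let ?V = "\<lambda>st. vertex_value n \<phi> (corner (fst st) (word_x w)) (corner (snd st) (word_y w))"
    have "(\<Sum>st\<in>UNIV. \<bar>?V st - \<phi> w\<bar> powr p) \<le> (\<Sum>st\<in>(UNIV :: (bool \<times> bool) set). ?S)"
    proof (rule sum_mono)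
      fix st :: "bool \<times> bool"
      obtain v where v: "v \<in> nbhd n w" "?V st = \<phi> v" using vertex_value_near[OF w] by blast
      show "\<bar>?V st - \<phi> w\<bar> powr p \<le> ?S" unfolding v(2) using v(1) by (intro member_le_sum) auto
    qed
    then have "(\<Sum>st\<in>UNIV. \<bar>?V st - \<phi> w\<bar> powr p) \<le> 4 * ?S" by (simp add: card_bool_pairs)
    then have "interp_const * (\<Sum>st\<in>UNIV. \<bar>?V st - \<phi> w\<bar> powr p) \<le> interp_const * (4 * ?S)"
      using interp_const_nonneg by (rule mult_left_mono)
    with Es_cell_interp_le[of "vertex_value n \<phi>" w "\<phi> w"] show ?thesis by (rule order_trans)
  qed
  then have "(\<Sum>w\<in>carpet_words n. Es (cell_interp (vertex_value n \<phi>) w)) \<le>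
      (\<Sum>w\<in>carpet_words n. interp_const * (4 * (\<Sum>v\<in>nbhd n w. \<bar>\<phi> v - \<phi> w\<bar> powr p)))"
    by (rule sum_mono)
  also have "\<dots> = lower_const * graph_energy K p n \<phi>"
    by (simp add: lower_const_def sum_nbhd_eq_graph_energy flip: sum_distrib_left)
  finally have "Es H \<le> r ^ n * (lower_const * graph_energy K p n \<phi>)"
    unfolding H(4) using r_pos by (intro mult_left_mono) auto
  then show ?thesis using H that by (simp add: mult_ac)
qed

end

section \<open>The scaling constant\<close>

lemma word_pos_bound:
  assumes "\<And>i. i \<in> carpet_letters \<Longrightarrow> \<bar>c i\<bar> \<le> 1"
  shows "w \<in> carpet_words n \<Longrightarrow> 2 * \<bar>word_pos c w\<bar> \<le> 3 ^ n - 1"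
proof (induction n arbitrary: w)
  case (Suc n)
  then obtain i v where w: "w = i # v" "i \<in> carpet_letters" "v \<in> carpet_words n"
    by (auto simp: carpet_words_Suc)
  have "\<bar>word_pos c w\<bar> \<le> \<bar>3 ^ n * c i\<bar> + \<bar>word_pos c v\<bar>"
    using abs_triangle_ineq by (simp add: w length_carpet_words[OF w(3)])
  moreover have "\<bar>3 ^ n * c i\<bar> \<le> 3 ^ n"
    using assms[OF w(2)] by (simp add: abs_mult mult_left_le)
  ultimately show ?case using Suc.IH[OF w(3)] by simp
qed simp

text \<open>If the first two digits of a balanced ternary number are both 1, or both -1, then neighbouring
  numbers of the same length have the same first digit.\<close>

lemma extreme_coordinate_rigid:
  assumes c: "\<And>i. i \<in> carpet_letters \<Longrightarrow> c i \<in> {-1, 0, 1}"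
    and u: "u \<in> carpet_words n" and v: "v \<in> carpet_words (Suc n)"
    and i: "i \<in> carpet_letters" "c i = 1 \<or> c i = -1" and j: "j \<in> carpet_letters"
    and near: "\<bar>word_pos c (i # i # u) - word_pos c (j # v)\<bar> \<le> 1"
  shows "c j = c i"
proof -
  have c1: "\<bar>c k\<bar> \<le> 1" if "k \<in> carpet_letters" for k using c[OF that] by auto
  \<comment> \<open>the leading digits contribute \<open>3 M + M\<close>, which no number with another first digit comes near to\<close>
  define M :: int where "M = 3 ^ n"
  have M: "1 \<le> M" by (simp add: M_def)
  have bu: "2 * \<bar>word_pos c u\<bar> \<le> M - 1"
    using word_pos_bound[of c u n] c1 u by (simp add: M_def)
  have bv: "2 * \<bar>word_pos c v\<bar> \<le> 3 * M - 1"
    using word_pos_bound[of c v "Suc n"] c1 v by (simp add: M_def)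
  have "\<bar>3 * M * c i + M * c i + word_pos c u - (3 * M * c j + word_pos c v)\<bar> \<le> 1"
    using near by (simp add: length_carpet_words[OF u] length_carpet_words[OF v] M_def algebra_simps)
  moreover have "c j = -1 \<or> c j = 0 \<or> c j = 1" using c[OF j] by auto
  ultimately show ?thesis using i(2) M bu bv by (elim disjE) simp_all
qed

text \<open>The cells 11 and 55 keep away from the other cells of level one by more than the size of
  a cell of a deeper level.\<close>

lemma near_twice_corner:
  assumes u: "u \<in> carpet_words n" and v: "v \<in> carpet_words (Suc (Suc n))"
    and i: "i = 1 \<or> i = 5" and near: "near_words (i # i # u) v"
  shows "take 1 v = [i]"
proof -
  obtain j v' where v': "v = j # v'" "j \<in> carpet_letters" "v' \<in> carpet_words (Suc n)"
    using v carpet_words_Suc[of "Suc n"] by auto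
  have il: "i \<in> carpet_letters" "letter_x i = 1 \<or> letter_x i = -1" "letter_y i = 1 \<or> letter_y i = -1"
    using i by (auto simp: carpet_letters_eq letter_coordinates)
  have "letter_x j = letter_x i"
    using near extreme_coordinate_rigid[of letter_x u n v' i j] letter_bounds(1) u v' il
    by (simp add: near_words_def)
  moreover have "letter_y j = letter_y i"
    using near extreme_coordinate_rigid[of letter_y u n v' i j] letter_bounds(2) u v' il
    by (simp add: near_words_def)
  ultimately show ?thesis using letter_inj[OF v'(2) il(1)] by (simp add: v'(1))
qed

lemma powr_bounded_tendsto_1:
  fixes q :: "nat \<Rightarrow> real"
  assumes "0 < c" "\<And>n. 1 \<le> n \<Longrightarrow> c \<le> q n" "\<And>n. 1 \<le> n \<Longrightarrow> q n \<le> C"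
  shows "(\<lambda>n. q n powr (- 1 / real n)) \<longlonglongrightarrow> 1"
proof -
  have C: "0 < C" using assms(1) assms(2,3)[of 1] by linarith
  have exp0: "(\<lambda>n. - 1 / real n) \<longlonglongrightarrow> 0"
    using tendsto_minus[OF lim_1_over_n] by simp
  have const: "(\<lambda>n. a powr (- 1 / real n)) \<longlonglongrightarrow> 1" if "0 < a" for a :: real
    using tendsto_powr[OF tendsto_const exp0, of a] that by simp
  show ?thesis
  proof (rule tendsto_sandwich[OF _ _ const[OF C] const[OF assms(1)]])
    show "eventually (\<lambda>n. C powr (- 1 / real n) \<le> q n powr (- 1 / real n)) sequentially"
      using eventually_ge_at_top[of 1]
    proof eventually_elim
      case (elim n)
      then show ?case using assms(1) assms(2,3)[OF elim] by (intro powr_mono2') auto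
    qed
    show "eventually (\<lambda>n. q n powr (- 1 / real n) \<le> c powr (- 1 / real n)) sequentially"
      using eventually_ge_at_top[of 1]
    proof eventually_elim
      case (elim n)
      then show ?case using assms(1) assms(2,3)[OF elim] by (intro powr_mono2') auto
    qed
  qed
qed

context carpet_energy
begin

abbreviation admissible :: "nat \<Rightarrow> nat list \<Rightarrow> (nat list \<Rightarrow> real) \<Rightarrow> bool" where
  "admissible n w \<phi> \<equiv> (\<forall>v\<in>carpet_descendants n w. \<phi> v = 0) \<and>
     (\<forall>v\<in>carpet_words (length w + n) -
        (\<Union>u\<in>{u \<in> carpet_words (length w). carpet_dist K (length w) u w \<le> 1}. carpet_descendants n u). \<phi> v = 1)"

lemma descendantsE:
  assumes "v \<in> carpet_words (l + n)"
  obtains u u' where "v = u @ u'" "u \<in> carpet_words l" "u' \<in> carpet_words n" "u = take l v"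
proof (rule that[of "take l v" "drop l v"])
  show "take l v \<in> carpet_words l" "drop l v \<in> carpet_words n"
    using assms by (auto simp: carpet_words_def dest: in_set_takeD in_set_dropD)
qed simp_all

text \<open>At most nine cells with four vertices each carry the energy of a cutoff function.\<close>

definition test_const :: real where "test_const = 36 * upper_const * interp_const"

text \<open>Interpolation of the vertex values that are 0 at the vertices of the cell \<open>w\<close> and 1 elsewhere:
  only the at most nine cells near \<open>w\<close> carry energy.\<close>

lemma cutoff_exists:
  assumes w: "w \<in> carpet_words l"
  obtains H where "H \<in> Fs" "\<And>x. x \<in> K \<Longrightarrow> H (carpet_word_map w x) = 0"
    "\<And>v x. v \<in> carpet_words l \<Longrightarrow> \<not> near_words v w \<Longrightarrow> x \<in> K \<Longrightarrow> H (carpet_word_map v x) = 1"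
    "Es H \<le> r ^ l * (36 * interp_const)"
proof -
  \<comment> \<open>value 0 exactly at the four vertices of the cell of \<open>w\<close>\<close>
  define V :: "int \<Rightarrow> int \<Rightarrow> real" where
    "V X Y = (if \<bar>X - 2 * word_x w\<bar> = 1 \<and> \<bar>Y - 2 * word_y w\<bar> = 1 then 0 else 1)" for X Y
  obtain H where H: "H \<in> Fs" "continuous_on K H"
    "\<And>v x. v \<in> carpet_words l \<Longrightarrow> x \<in> K \<Longrightarrow> H (carpet_word_map v x) = cell_interp V v x"
    "Es H = r ^ l * (\<Sum>v\<in>carpet_words l. Es (cell_interp V v))"
    using interpolation_exists[of l V] by blast
  have Vw: "V (corner s (word_x w)) (corner t (word_y w)) = 0" for s t
    by (simp add: V_def corner_def)
  have Vfar: "V (corner s (word_x v)) (corner t (word_y v)) = 1" if "\<not> near_words v w" for s t v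
    using that corner_shared by (auto simp: V_def near_words_def)
  have zero: "cell_interp V w x = 0" for x by (simp add: cell_interp_def Vw)
  have one: "cell_interp V v = (\<lambda>x. 1)" if "\<not> near_words v w" for v
    using bump_partition by (simp add: cell_interp_def[abs_def] Vfar[OF that])
  have "(\<Sum>v\<in>carpet_words l. Es (cell_interp V v)) = (\<Sum>v\<in>nbhd l w. Es (cell_interp V v))"
    by (rule sum.mono_neutral_right) (auto simp: nbhd_mem near_words_sym one Es_const)
  also have "\<dots> \<le> real (card (nbhd l w)) * (4 * interp_const)"
  proof (rule sum_bounded_above)
    fix v
    have "(\<Sum>st\<in>UNIV. \<bar>V (corner (fst st) (word_x v)) (corner (snd st) (word_y v)) - 1\<bar> powr p)
        \<le> (\<Sum>st\<in>(UNIV :: (bool \<times> bool) set). 1)"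
      using p by (intro sum_mono) (simp add: V_def)
    then have "(\<Sum>st\<in>UNIV. \<bar>V (corner (fst st) (word_x v)) (corner (snd st) (word_y v)) - 1\<bar> powr p) \<le> 4"
      by (simp add: card_bool_pairs)
    from mult_left_mono[OF this interp_const_nonneg] Es_cell_interp_le[of V v 1]
    show "Es (cell_interp V v) \<le> 4 * interp_const" by linarith
  qed
  also have "\<dots> \<le> 9 * (4 * interp_const)"
    using card_nbhd[of l w] interp_const_nonneg by (intro mult_right_mono) auto
  finally have "Es H \<le> r ^ l * (36 * interp_const)"
    unfolding H(4) using r_pos by (intro mult_left_mono) auto
  then show ?thesis using that[of H] H(1,3) w by (simp add: zero one)
qed

lemma test_function_exists:
  assumes w: "w \<in> carpet_words l"
  shows "\<exists>\<phi>. admissible n w \<phi> \<and> r ^ n * graph_energy K p (l + n) \<phi> \<le> test_const"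
proof -
  obtain H where H: "H \<in> Fs" "\<And>x. x \<in> K \<Longrightarrow> H (carpet_word_map w x) = 0"
    "\<And>v x. v \<in> carpet_words l \<Longrightarrow> \<not> near_words v w \<Longrightarrow> x \<in> K \<Longrightarrow> H (carpet_word_map v x) = 1"
    "Es H \<le> r ^ l * (36 * interp_const)"
    using cutoff_exists[OF w] by blast
  have lw: "length w = l" by (rule length_carpet_words[OF w])
  let ?\<phi> = "cell_average K m H"
  have avg: "?\<phi> (u @ u') = c"
    if u: "u \<in> carpet_words l" and u': "u' \<in> carpet_words n"
      and c: "\<And>x. x \<in> K \<Longrightarrow> H (carpet_word_map u x) = c" for u u' c
  proof -
    have "?\<phi> (u @ u') = (\<integral>x. H (carpet_word_map u (carpet_word_map u' x)) \<partial>m)"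
      using cell_average_eq[OF Fs_integrable[OF H(1)] append_carpet_words[OF u u']]
      by (simp add: carpet_word_map_append)
    also have "\<dots> = (\<integral>x. c \<partial>m)"
      using carpet_word_map_in_K[OF u'] by (intro Bochner_Integration.integral_cong) (simp_all add: c)
    finally show ?thesis using prob_space by simp
  qed
  have "admissible n w ?\<phi>"
  proof (intro conjI ballI)
    fix v assume "v \<in> carpet_descendants n w"
    then have v: "v \<in> carpet_words (l + n)" "take l v = w" by (auto simp: carpet_descendants_def lw)
    obtain u u' where u: "v = u @ u'" "u \<in> carpet_words l" "u' \<in> carpet_words n" "u = take l v"
      using descendantsE[OF v(1)] by blast
    have uw: "u = w" using u(4) v(2) by simp
    show "?\<phi> v = 0" unfolding u(1) by (rule avg[OF u(2,3)]) (simp add: uw H(2))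
  next
    fix v assume v: "v \<in> carpet_words (length w + n) -
        (\<Union>u\<in>{u \<in> carpet_words (length w). carpet_dist K (length w) u w \<le> 1}. carpet_descendants n u)"
    then have v1: "v \<in> carpet_words (l + n)" by (simp add: lw)
    obtain u u' where u: "v = u @ u'" "u \<in> carpet_words l" "u' \<in> carpet_words n" "u = take l v"
      using descendantsE[OF v1] by blast
    have "v \<in> carpet_descendants n u"
      unfolding carpet_descendants_def length_carpet_words[OF u(2)] using v1 u(4)[symmetric] by blast
    then have "\<not> near_words u w"
      using v u(2) carpet_dist_le_1_iff[OF u(2) w] by (auto simp: lw)
    then show "?\<phi> v = 1" unfolding u(1) by (intro avg[OF u(2,3)] H(3)[OF u(2)])
  qed
  moreover have "r ^ n * graph_energy K p (l + n) ?\<phi> \<le> test_const"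
  proof -
    have "r ^ (l + n) * graph_energy K p (l + n) ?\<phi> \<le> upper_const * Es H"
      by (rule graph_energy_le_Es[OF H(1)])
    also have "\<dots> \<le> upper_const * (r ^ l * (36 * interp_const))"
      by (rule mult_left_mono[OF H(4) upper_const_nonneg])
    finally have "r ^ l * (r ^ n * graph_energy K p (l + n) ?\<phi>) \<le> r ^ l * test_const"
      by (simp add: test_const_def power_add mult_ac)
    then show ?thesis using r_pos by simp
  qed
  ultimately show ?thesis by blast
qed

lemma conductance_alt:
  "w \<in> carpet_words l \<Longrightarrow>
     carpet_conductance K p n w = Inf {graph_energy K p (l + n) \<phi> | \<phi>. admissible n w \<phi>}"
  by (simp add: carpet_conductance_def length_carpet_words)

lemma conductance_upper:
  assumes w: "w \<in> carpet_words l"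
  shows "carpet_conductance K p n w \<le> test_const / r ^ n"
proof -
  obtain \<phi> where \<phi>: "admissible n w \<phi>" "r ^ n * graph_energy K p (l + n) \<phi> \<le> test_const"
    using test_function_exists[OF w] by blast
  have "carpet_conductance K p n w \<le> graph_energy K p (l + n) \<phi>"
    unfolding conductance_alt[OF w]
    by (rule cInf_lower) (use \<phi>(1) graph_energy_nonneg in \<open>auto intro!: bdd_belowI[of _ 0]\<close>)
  also have "\<dots> \<le> test_const / r ^ n"
    using \<phi>(2) r_pos by (simp add: pos_le_divide_eq mult.commute)
  finally show ?thesis .
qed

text \<open>The interpolation of a test function is nonconstant in a way that does not depend on \<open>n\<close>: it is 0
  on the cell 11 and 1 on the cell 55. By the spectral gap its energy is bounded below. Going down
  to the cells 11 and 55, instead of 1 and 5, avoids the influence of the neighbouring cells.\<close>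

lemma test_energy_lower:
  assumes adm: "admissible (Suc n) [1] \<phi>"
  shows "1 \<le> 64 * 2 powr p * Cgap * lower_const * r ^ (Suc (Suc n)) * graph_energy K p (Suc (Suc n)) \<phi>"
proof -
  let ?N = "Suc (Suc n)"
  obtain H where H: "H \<in> Fs" "continuous_on K H"
    "\<And>w x. w \<in> carpet_words ?N \<Longrightarrow> x \<in> K \<Longrightarrow>
        H (carpet_word_map w x) = cell_interp (vertex_value ?N \<phi>) w x"
    "Es H \<le> lower_const * (r ^ ?N * graph_energy K p ?N \<phi>)"
    using discrete_interpolation[of ?N \<phi>] by blast
  have w1: "[i] \<in> carpet_words 1" if "i = 1 \<or> i = 5" for i
    using that by (auto simp: carpet_words_def carpet_letters_eq)
  have far: "\<not> near_words [5] [1]" by (simp add: near_words_def letter_coordinates)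
  have \<phi>0: "\<phi> v = 0" if "v \<in> carpet_words ?N" "take 1 v = [1]" for v
    using adm that by (simp add: carpet_descendants_def)
  have \<phi>1: "\<phi> v = 1" if v: "v \<in> carpet_words ?N" "take 1 v = [5]" for v
  proof -
    have "v \<notin> carpet_descendants (Suc n) u"
      if "u \<in> carpet_words 1" "carpet_dist K 1 u [1] \<le> 1" for u
    proof
      assume "v \<in> carpet_descendants (Suc n) u"
      then have "u = [5]" using v(2) length_carpet_words[OF that(1)] by (simp add: carpet_descendants_def)
      then show False using that(2) far carpet_dist_le_1_iff[OF that(1) w1[of 1]] by simp
    qed
    then show ?thesis using adm v(1) by auto
  qed
  have deep: "H (carpet_word_map [i, i] x) = c"
    if i: "i = 1 \<or> i = 5" and c: "\<And>v. v \<in> carpet_words ?N \<Longrightarrow> take 1 v = [i] \<Longrightarrow> \<phi> v = c"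
      and x: "x \<in> K" for i c x
  proof -
    obtain u y where u: "u \<in> carpet_words n" "y \<in> K" "x = carpet_word_map u y"
      using K_cellE[OF x] by blast
    have il: "i \<in> carpet_letters" using i by (auto simp: carpet_letters_eq)
    have w: "i # i # u \<in> carpet_words ?N" using il u(1) by simp
    have "carpet_word_map [i, i] x = carpet_word_map (i # i # u) y"
      by (simp add: carpet_word_map_Cons u(3))
    also have "H \<dots> = cell_interp (vertex_value ?N \<phi>) (i # i # u) y" by (rule H(3)[OF w u(2)])
    also have "\<dots> = c"
    proof (rule cell_interp_const[OF w u(2)])
      fix v assume "v \<in> nbhd ?N (i # i # u)"
      then show "\<phi> v = c" using near_twice_corner[OF u(1) _ i] c by (simp add: nbhd_mem)
    qed
    finally show ?thesis .
  qed
  define a where "a = (\<integral>x. H x \<partial>m)"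
  have int: "integrable m (\<lambda>x. \<bar>H x - a\<bar> powr p)"
    using Lp_integrable(2)[OF prob_m _ Fs_Lp[OF Fs_diff[OF H(1) Fs_const]]] p by simp
  let ?I = "\<lambda>w. \<integral>x. \<bar>H (carpet_word_map w x) - a\<bar> powr p \<partial>m"
  have ww: "[1, 1] \<in> carpet_words 2" "[5, 5] \<in> carpet_words 2"
    by (simp_all add: carpet_words_def carpet_letters_eq)
  have "?I [1, 1] = (\<integral>x. \<bar>a\<bar> powr p \<partial>m)"
    using deep[of 1 0] \<phi>0 by (intro Bochner_Integration.integral_cong) simp_all
  then have I1: "?I [1, 1] = \<bar>a\<bar> powr p" using prob_space by simp
  have "?I [5, 5] = (\<integral>x. \<bar>1 - a\<bar> powr p \<partial>m)"
    using deep[of 5 1] \<phi>1 by (intro Bochner_Integration.integral_cong) simp_all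
  then have I5: "?I [5, 5] = \<bar>1 - a\<bar> powr p" using prob_space by simp
  have "(\<Sum>w\<in>{[1, 1], [5, 5]}. ?I w) = ?I [1, 1] + ?I [5, 5]" by simp
  then have I: "(\<Sum>w\<in>{[1, 1], [5, 5]}. ?I w) = \<bar>a\<bar> powr p + \<bar>1 - a\<bar> powr p"
    by (simp only: I1 I5)
  \<comment> \<open>whatever the mean \<open>a\<close> is, it is far from 0 or from 1\<close>
  have "1 \<le> 2 powr p * (\<bar>a\<bar> powr p + \<bar>1 - a\<bar> powr p)"
    using powr_add_le[of p a "1 - a"] p by simp
  also have "\<dots> = 2 powr p * (\<Sum>w\<in>{[1, 1], [5, 5]}. ?I w)" by (simp only: I)
  also have "\<dots> \<le> 2 powr p * (\<Sum>w\<in>carpet_words 2. ?I w)"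
    using ww by (intro mult_left_mono sum_mono2) auto
  also have "\<dots> = 2 powr p * (64 * (\<integral>x. \<bar>H x - a\<bar> powr p \<partial>m))"
    using integral_words[OF int, of 2] by (simp add: power2_eq_square)
  also have "\<dots> \<le> 2 powr p * (64 * (Cgap * (lower_const * (r ^ ?N * graph_energy K p ?N \<phi>))))"
    using order_trans[OF gap_integral[OF H(1)] mult_left_mono[OF H(4)]] Cgap
    by (intro mult_left_mono) (simp_all add: a_def)
  finally show ?thesis by (simp only: mult_ac)
qed

text \<open>In the supremum over all words, the bound from above is uniform and the bound from below comes
  from the single word 1.\<close>

lemma conductance_sup_bounds:
  obtains c where "0 < c"
    "\<And>n. 1 \<le> n \<Longrightarrow> c \<le> carpet_conductance_sup K p n * r ^ n"
    "\<And>n. 1 \<le> n \<Longrightarrow> carpet_conductance_sup K p n * r ^ n \<le> test_const"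
proof -
  let ?W = "\<Union>l\<in>{1..}. carpet_words l"
  define D where "D = 64 * 2 powr p * Cgap * lower_const * r"
  have w1: "[1] \<in> carpet_words 1" by (simp add: carpet_words_def carpet_letters_eq)
  then have w1W: "[1] \<in> ?W" by (intro UN_I[of 1]) simp_all
  have upper: "carpet_conductance K p n w \<le> test_const / r ^ n" if "w \<in> ?W" for n w
    using that conductance_upper by blast
  have bdd: "bdd_above (carpet_conductance K p n ` ?W)" for n
    by (rule bdd_aboveI2[of _ _ "test_const / r ^ n"]) (rule upper)
  have D0: "0 \<le> D" using Cgap r_pos lower_const_nonneg by (simp add: D_def)
  have low: "1 \<le> D * (r ^ n * graph_energy K p (1 + n) \<phi>)" if adm: "admissible n [1] \<phi>" and n: "1 \<le> n" for n \<phi>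
  proof -
    obtain k where k: "n = Suc k" using n by (cases n) auto
    have "1 \<le> 64 * 2 powr p * Cgap * lower_const * r ^ (Suc n) * graph_energy K p (Suc n) \<phi>"
      using test_energy_lower[of k \<phi>] adm unfolding k by blast
    then show ?thesis unfolding D_def by (simp add: mult_ac)
  qed
  have D: "0 < D"
  proof -
    obtain \<phi> where "admissible 1 [1] \<phi>" using test_function_exists[OF w1, of 1] by blast
    then have "1 \<le> D * (r ^ 1 * graph_energy K p (1 + 1) \<phi>)" by (rule low) simp
    then show ?thesis using D0 by (cases "D = 0") simp_all
  qed
  show ?thesis
  proof (rule that[of "1 / D"])
    show "0 < 1 / D" using D by simp
    fix n :: nat assume n: "1 \<le> n"
    have "1 / (D * r ^ n) \<le> carpet_conductance K p n [1]"
      unfolding conductance_alt[OF w1]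
    proof (rule cInf_greatest)
      show "{graph_energy K p (1 + n) \<phi> | \<phi>. admissible n [1] \<phi>} \<noteq> {}"
        using test_function_exists[OF w1, of n] by blast
      fix y assume "y \<in> {graph_energy K p (1 + n) \<phi> | \<phi>. admissible n [1] \<phi>}"
      then obtain \<phi> where \<phi>: "admissible n [1] \<phi>" "y = graph_energy K p (1 + n) \<phi>" by blast
      show "1 / (D * r ^ n) \<le> y"
        using low[OF \<phi>(1) n] D r_pos unfolding \<phi>(2) by (simp add: pos_divide_le_eq mult_ac)
    qed
    also have "\<dots> \<le> carpet_conductance_sup K p n"
      unfolding carpet_conductance_sup_def by (rule cSUP_upper[OF w1W bdd])
    finally show "1 / D \<le> carpet_conductance_sup K p n * r ^ n"
      using D r_pos by (simp add: field_simps)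
    have "carpet_conductance_sup K p n \<le> test_const / r ^ n"
      unfolding carpet_conductance_sup_def by (rule cSUP_least) (use w1W upper in blast)+
    then show "carpet_conductance_sup K p n * r ^ n \<le> test_const"
      using r_pos by (simp add: pos_le_divide_eq)
  qed
qed

lemma scaling_constant_unique:
  assumes "is_scaling_constant K p \<rho>"
  shows "\<rho> = r"
proof -
  let ?C = "carpet_conductance_sup K p"
  obtain c where c: "0 < c" "\<And>n. 1 \<le> n \<Longrightarrow> c \<le> ?C n * r ^ n" "\<And>n. 1 \<le> n \<Longrightarrow> ?C n * r ^ n \<le> test_const"
    using conductance_sup_bounds by blast
  have "(\<lambda>n. (?C n * r ^ n) powr (- 1 / real n) * r) \<longlonglongrightarrow> 1 * r"
    by (intro tendsto_mult tendsto_const powr_bounded_tendsto_1[OF c])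
  moreover have "eventually (\<lambda>n. (?C n * r ^ n) powr (- 1 / real n) * r = ?C n powr (- 1 / real n)) sequentially"
    using eventually_ge_at_top[of 1]
  proof eventually_elim
    case (elim n)
    have "0 < ?C n * r ^ n" using c(1) c(2)[OF elim] by linarith
    then have "0 < ?C n" using r_pos by (simp add: zero_less_mult_iff)
    moreover have "(r ^ n) powr (- 1 / real n) = 1 / r"
      using r_pos elim by (simp add: powr_powr powr_minus_divide flip: powr_realpow)
    ultimately show ?case using r_pos by (simp add: powr_mult)
  qed
  ultimately have "(\<lambda>n. ?C n powr (- 1 / real n)) \<longlonglongrightarrow> 1 * r"
    by (rule Lim_transform_eventually)
  then show ?thesis
    using assms LIMSEQ_unique unfolding is_scaling_constant_def by fastforce
qed

end

section \<open>Functions with bounded discrete energies\<close>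

context carpet_energy
begin

abbreviation N :: "(plane \<Rightarrow> real) \<Rightarrow> real" where "N \<equiv> energy_norm m p Es"

lemma N_nonneg: "0 \<le> N f"
  by (simp add: energy_norm_def)

lemma N_add: "f \<in> Fs \<Longrightarrow> g \<in> Fs \<Longrightarrow> N (\<lambda>x. f x + g x) \<le> N f + N g"
  using b_norm unfolding norm_on_def seminorm_on_def triangle_on_def by blast

lemma N_scale: "f \<in> Fs \<Longrightarrow> N (\<lambda>x. a * f x) = \<bar>a\<bar> * N f"
  using b_norm unfolding norm_on_def seminorm_on_def by blast

lemma N_ae: "f \<in> Fs \<Longrightarrow> g \<in> Fs \<Longrightarrow> AE x in m. f x = g x \<Longrightarrow> N f = N g"
  using b_norm unfolding norm_on_def seminorm_on_def nonneg_functional_def by blast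

lemma N_diff: "f \<in> Fs \<Longrightarrow> g \<in> Fs \<Longrightarrow> N (\<lambda>x. f x - g x) \<le> N f + N g"
  using N_add[OF _ Fs_scale[of g "-1"], of f] N_scale[of g "-1"] by simp

text \<open>Uniform convexity for vectors whose norms are only bounded by approximately \<open>d\<close> but whose sum
  almost has norm \<open>2 d\<close>. The triangle inequality forces both norms to be close to \<open>d\<close>, so that
  normalising the two vectors changes them little.\<close>

lemma close_of_almost_extremal_sum:
  assumes "0 < \<epsilon>" "0 < d"
  shows "\<exists>\<eta>>0. \<forall>f\<in>Fs. \<forall>g\<in>Fs. N f \<le> d + \<eta> \<and> N g \<le> d + \<eta> \<and> 2 * (d - \<eta>) \<le> N (\<lambda>x. f x + g x)
    \<longrightarrow> N (\<lambda>x. f x - g x) < \<epsilon>"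
proof -
  obtain \<delta> where \<delta>: "\<delta> > 0" "\<And>f g. f \<in> Fs \<Longrightarrow> g \<in> Fs \<Longrightarrow> N f = 1 \<Longrightarrow> N g = 1 \<Longrightarrow>
      \<epsilon> / (2 * d) \<le> N (\<lambda>x. f x - g x) \<Longrightarrow> N (\<lambda>x. f x + g x) \<le> 2 * (1 - \<delta>)"
  proof -
    have "\<epsilon> / (2 * d) > 0" using assms by simp
    then obtain \<delta> where "\<delta> > 0" "\<forall>f\<in>Fs. \<forall>g\<in>Fs.
        N f = 1 \<and> N g = 1 \<and> N (\<lambda>x. f x - g x) \<ge> \<epsilon> / (2 * d) \<longrightarrow> N (\<lambda>x. f x + g x) \<le> 2 * (1 - \<delta>)"
      using b_convex unfolding uniformly_convex_on_def by blast
    then show ?thesis using that by blast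
  qed
  \<comment> \<open>the three bounds keep the norms positive, the final estimate below \<open>\<epsilon>\<close>, and contradict uniform convexity\<close>
  define \<eta> where "\<eta> = min (d / 4) (min (\<epsilon> / 16) (d * \<delta> / 8))"
  have \<eta>: "0 < \<eta>" "\<eta> \<le> d / 4" "\<eta> \<le> \<epsilon> / 16" "\<eta> \<le> d * \<delta> / 8"
    using assms \<delta>(1) by (simp_all add: \<eta>_def)
  show ?thesis
  proof (intro exI[of _ \<eta>] conjI ballI impI)
    fix f g assume f: "f \<in> Fs" and g: "g \<in> Fs"
      and A': "N f \<le> d + \<eta> \<and> N g \<le> d + \<eta> \<and> 2 * (d - \<eta>) \<le> N (\<lambda>x. f x + g x)"
    have A: "N f \<le> d + \<eta>" "N g \<le> d + \<eta>" "2 * (d - \<eta>) \<le> N (\<lambda>x. f x + g x)"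
      using A' by simp_all
    have third: "d - 3 * \<eta> \<le> s \<and> d - 3 * \<eta> \<le> t"
      if "s \<le> d + \<eta>" "t \<le> d + \<eta>" "2 * (d - \<eta>) \<le> z" "z \<le> s + t" for s t z :: real
      using that by simp
    have Nf: "d - 3 * \<eta> \<le> N f" "N f \<le> d + \<eta>" and Ng: "d - 3 * \<eta> \<le> N g" "N g \<le> d + \<eta>"
      using third[OF A N_add[OF f g]] A(1,2) by blast+
    have pos: "0 < N f" "0 < N g" using Nf(1) Ng(1) \<eta>(1,2) assms(2) by linarith+
    define f' where "f' x = 1 / N f * f x" for x
    define g' where "g' x = 1 / N g * g x" for x
    have f': "f' \<in> Fs" "N f' = 1"
      unfolding f'_def[abs_def] using N_scale[OF f, of "1 / N f"] pos by (intro Fs_scale f, simp)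
    have g': "g' \<in> Fs" "N g' = 1"
      unfolding g'_def[abs_def] using N_scale[OF g, of "1 / N g"] pos by (intro Fs_scale g, simp)
    \<comment> \<open>\<open>f\<close> and \<open>g\<close> are close to the \<open>d\<close>-fold unit vectors\<close>
    define u where "u x = (1 - d / N f) * f x" for x
    define v where "v x = (1 - d / N g) * g x" for x
    have uF: "u \<in> Fs" and vF: "v \<in> Fs"
      using Fs_scale[OF f] Fs_scale[OF g] by (simp_all add: u_def[abs_def] v_def[abs_def])
    have "N u = \<bar>1 - d / N f\<bar> * \<bar>N f\<bar>" using N_scale[OF f, of "1 - d / N f"] pos by (simp add: u_def[abs_def])
    also have "\<dots> = \<bar>N f - d\<bar>" unfolding abs_mult[symmetric] using pos by (simp add: left_diff_distrib)
    finally have Nu: "N u \<le> 3 * \<eta>" using Nf \<eta>(1) by linarith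
    have "N v = \<bar>1 - d / N g\<bar> * \<bar>N g\<bar>" using N_scale[OF g, of "1 - d / N g"] pos by (simp add: v_def[abs_def])
    also have "\<dots> = \<bar>N g - d\<bar>" unfolding abs_mult[symmetric] using pos by (simp add: left_diff_distrib)
    finally have Nv: "N v \<le> 3 * \<eta>" using Ng \<eta>(1) by linarith
    have fu: "f x = d * f' x + u x" and gv: "g x = d * g' x + v x" for x
      by (simp_all add: f'_def u_def g'_def v_def left_diff_distrib)
    have "N (\<lambda>x. f' x - g' x) < \<epsilon> / (2 * d)"
    proof (rule ccontr)
      assume "\<not> N (\<lambda>x. f' x - g' x) < \<epsilon> / (2 * d)"
      then have le: "N (\<lambda>x. f' x + g' x) \<le> 2 * (1 - \<delta>)" using \<delta>(2)[OF f'(1) g'(1) f'(2) g'(2)] by simp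
      have "N (\<lambda>x. f x + g x) = N (\<lambda>x. d * (f' x + g' x) + (u x + v x))"
        by (simp add: fu gv algebra_simps)
      also have "\<dots> \<le> N (\<lambda>x. d * (f' x + g' x)) + N (\<lambda>x. u x + v x)"
        by (rule N_add[OF Fs_scale[OF Fs_add[OF f'(1) g'(1)]] Fs_add[OF uF vF]])
      also have "\<dots> \<le> d * N (\<lambda>x. f' x + g' x) + (N u + N v)"
        using N_scale[OF Fs_add[OF f'(1) g'(1)], of d] N_add[OF uF vF] assms(2) by simp
      also have "\<dots> \<le> d * (2 * (1 - \<delta>)) + 6 * \<eta>"
        using mult_left_mono[OF le, of d] assms(2) Nu Nv by linarith
      finally have "2 * (d - \<eta>) \<le> d * (2 * (1 - \<delta>)) + 6 * \<eta>" using A by linarith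
      then have "d * \<delta> \<le> 4 * \<eta>" by (simp add: algebra_simps)
      moreover have "0 < d * \<delta>" using assms(2) \<delta>(1) by simp
      ultimately show False using \<eta>(4) by linarith
    qed
    then have small: "d * N (\<lambda>x. f' x - g' x) < \<epsilon> / 2" using assms(2) by (simp add: field_simps)
    have "N (\<lambda>x. f x - g x) = N (\<lambda>x. d * (f' x - g' x) + (u x - v x))"
      by (simp add: fu gv algebra_simps)
    also have "\<dots> \<le> N (\<lambda>x. d * (f' x - g' x)) + N (\<lambda>x. u x - v x)"
      by (rule N_add[OF Fs_scale[OF Fs_diff[OF f'(1) g'(1)]] Fs_diff[OF uF vF]])
    also have "\<dots> \<le> d * N (\<lambda>x. f' x - g' x) + (N u + N v)"
      using N_scale[OF Fs_diff[OF f'(1) g'(1)], of d] N_diff[OF uF vF] assms(2) by simp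
    also have "\<dots> < \<epsilon>" using small Nu Nv \<eta>(3) assms(1) by linarith
    finally show "N (\<lambda>x. f x - g x) < \<epsilon>" .
  qed (rule \<eta>(1))
qed

text \<open>Lower semicontinuity of the norm under \<open>L\<^sup>1\<close> convergence. The sets
  \<open>A k\<close> of elements of \<open>Fs\<close> in shrinking \<open>L\<^sup>1\<close> balls around \<open>f\<close> are convex
  and decreasing, so the infima \<open>D k\<close> of the norm on them increase to some \<open>d \<le> B\<close>. Almost minimisers
  form a Cauchy sequence, because the midpoint of two of them lies in a set \<open>A M\<close> again and so
  cannot have a norm much smaller than \<open>d\<close>. The limit in the complete space must be \<open>f\<close>.\<close>

lemma mem_Fs_of_L1_limit:
  assumes f: "f \<in> Lp m p" and B: "0 \<le> B"
    and approx: "\<And>\<epsilon>. 0 < \<epsilon> \<Longrightarrow> \<exists>h\<in>Fs. (\<integral>x. \<bar>h x - f x\<bar> \<partial>m) \<le> \<epsilon> \<and> N h \<le> B"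
  shows "f \<in> Fs \<and> N f \<le> B"
proof -
  have fi: "integrable m f" using Lp_integrable(1)[OF prob_m _ f] p by simp
  define A where "A k = {h \<in> Fs. (\<integral>x. \<bar>h x - f x\<bar> \<partial>m) \<le> 1 / Suc k}" for k :: nat
  define D where "D k = Inf (N ` A k)" for k
  have bdd: "bdd_below (N ` A k)" for k by (rule bdd_belowI2[of _ 0]) (rule N_nonneg)
  have ne: "\<exists>h\<in>A k. N h \<le> B" for k
    using approx[of "1 / Suc k"] by (auto simp: A_def)
  then have neA: "N ` A k \<noteq> {}" for k by blast
  have mono: "A l \<subseteq> A k" if "k \<le> l" for k l
  proof
    fix h assume h: "h \<in> A l"
    have "1 / real (Suc l) \<le> 1 / real (Suc k)" using that by (simp add: frac_le)
    then show "h \<in> A k" using h unfolding A_def by (auto intro: order_trans)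
  qed
  have Dle: "D k \<le> N h" if "h \<in> A k" for k h unfolding D_def using that by (intro cInf_lower bdd) auto
  have DB: "D k \<le> B" for k using ne[of k] Dle[of _ k] by (blast intro: order_trans)
  have D0: "0 \<le> D k" for k unfolding D_def using neA[of k] by (intro cInf_greatest) (auto simp: N_nonneg)
  have Dmono: "D k \<le> D l" if "k \<le> l" for k l
    unfolding D_def using mono[OF that] neA[of l] bdd by (intro cInf_superset_mono) auto
  define d where "d = (SUP k. D k)"
  have bddD: "bdd_above (range D)" using DB by (intro bdd_aboveI2[of _ _ B])
  have Dd: "D k \<le> d" for k unfolding d_def by (rule cSUP_upper[OF _ bddD]) simp
  have dB: "d \<le> B" unfolding d_def using DB by (intro cSUP_least) auto
  have "\<exists>h. h \<in> A k \<and> N h \<le> D k + 1 / Suc k" for k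
  proof -
    have "\<exists>y\<in>N ` A k. y < D k + 1 / Suc k"
      using cInf_lessD[OF neA[of k], of "D k + 1 / Suc k"] unfolding D_def by simp
    then show ?thesis by (auto intro: less_imp_le)
  qed
  then obtain h where h: "\<And>k. h k \<in> A k" "\<And>k. N (h k) \<le> D k + 1 / Suc k" by metis
  have hF: "h k \<in> Fs" and hL: "(\<integral>x. \<bar>h k x - f x\<bar> \<partial>m) \<le> 1 / Suc k" for k
    using h(1)[of k] by (simp_all add: A_def)
  have arch: "\<exists>M. \<forall>k\<ge>M. 1 / real (Suc k) < \<eta>" if "0 < \<eta>" for \<eta> :: real
    using order_tendstoD(2)[OF LIMSEQ_inverse_real_of_nat that]
    by (simp add: eventually_sequentially inverse_eq_divide)
  have cauchy: "\<exists>M. \<forall>i\<ge>M. \<forall>j\<ge>M. N (\<lambda>x. h i x - h j x) < \<epsilon>" if \<epsilon>: "0 < \<epsilon>" for \<epsilon>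
  proof (cases "d = 0")
    case True
    obtain M where M: "\<And>k. M \<le> k \<Longrightarrow> 1 / real (Suc k) < \<epsilon> / 2" using arch[of "\<epsilon> / 2"] \<epsilon> by auto
    have small: "N (h k) < \<epsilon> / 2" if "M \<le> k" for k
      using h(2)[of k] M[OF that] Dd[of k] True by linarith
    show ?thesis
    proof (intro exI[of _ M] allI impI)
      fix i j assume "M \<le> i" "M \<le> j"
      then show "N (\<lambda>x. h i x - h j x) < \<epsilon>"
        using N_diff[OF hF[of i] hF[of j]] small[of i] small[of j] by linarith
    qed
  next
    case False
    then have d: "0 < d" using D0[of 0] Dd[of 0] by linarith
    obtain \<eta> where \<eta>: "\<eta> > 0" "\<And>f g. f \<in> Fs \<Longrightarrow> g \<in> Fs \<Longrightarrow> N f \<le> d + \<eta> \<Longrightarrow> N g \<le> d + \<eta> \<Longrightarrow>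
        2 * (d - \<eta>) \<le> N (\<lambda>x. f x + g x) \<Longrightarrow> N (\<lambda>x. f x - g x) < \<epsilon>"
      using close_of_almost_extremal_sum[OF \<epsilon> d] by blast
    obtain M1 where M1: "\<And>k. M1 \<le> k \<Longrightarrow> 1 / real (Suc k) < \<eta>" using arch[OF \<eta>(1)] by auto
    obtain M2 where M2: "d - \<eta> < D M2"
      using less_cSUP_iff[OF _ bddD, of "d - \<eta>"] \<eta>(1) unfolding d_def by auto
    define M where "M = max M1 M2"
    show ?thesis
    proof (intro exI[of _ M] allI impI)
      fix i j assume ij: "M \<le> i" "M \<le> j"
      have Nh: "N (h k) \<le> d + \<eta>" if "M \<le> k" for k
        using h(2)[of k] M1[of k] that Dd[of k] unfolding M_def by fastforce
      have hA: "h i \<in> A M" "h j \<in> A M" using mono h(1) ij by blast+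
      let ?c = "\<lambda>x. 1 / 2 * (h i x + h j x)"
      have "?c \<in> A M"
      proof -
        have "(\<integral>x. \<bar>?c x - f x\<bar> \<partial>m) \<le> (\<integral>x. 1 / 2 * \<bar>h i x - f x\<bar> + 1 / 2 * \<bar>h j x - f x\<bar> \<partial>m)"
        proof (rule integral_mono)
          fix x show "\<bar>?c x - f x\<bar> \<le> 1 / 2 * \<bar>h i x - f x\<bar> + 1 / 2 * \<bar>h j x - f x\<bar>"
            by (simp add: abs_if field_simps)
        qed (use fi Fs_integrable[OF hF] in auto)
        also have "\<dots> = 1 / 2 * (\<integral>x. \<bar>h i x - f x\<bar> \<partial>m) + 1 / 2 * (\<integral>x. \<bar>h j x - f x\<bar> \<partial>m)"
          using fi Fs_integrable[OF hF] by simp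
        also have "\<dots> \<le> 1 / Suc M" using hA by (simp add: A_def)
        finally have "(\<integral>x. \<bar>?c x - f x\<bar> \<partial>m) \<le> 1 / Suc M" .
        then show ?thesis
          unfolding A_def by (intro CollectI conjI Fs_scale Fs_add hF)
      qed
      then have "D M \<le> N ?c" by (rule Dle)
      also have "N ?c = 1 / 2 * N (\<lambda>x. h i x + h j x)" using N_scale[OF Fs_add[OF hF hF], of "1 / 2"] by simp
      finally have "2 * (d - \<eta>) \<le> N (\<lambda>x. h i x + h j x)"
        using M2 Dmono[of M2 M] by (simp add: M_def)
      then show "N (\<lambda>x. h i x - h j x) < \<epsilon>" by (rule \<eta>(2)[OF hF hF Nh[OF ij(1)] Nh[OF ij(2)]])
    qed
  qed
  obtain g where g: "g \<in> Fs" "(\<lambda>k. N (\<lambda>x. h k x - g x)) \<longlonglongrightarrow> 0"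
    using b_complete hF cauchy unfolding complete_norm_on_def by blast
  have inv0: "(\<lambda>k. 1 / real (Suc k)) \<longlonglongrightarrow> 0"
    using LIMSEQ_inverse_real_of_nat by (simp add: inverse_eq_divide)
  have gi: "integrable m g" by (rule Fs_integrable[OF g(1)])
  have "(\<integral>x. \<bar>f x - g x\<bar> \<partial>m) \<le> 1 / Suc k + N (\<lambda>x. h k x - g x)" for k
  proof -
    have "(\<integral>x. \<bar>f x - g x\<bar> \<partial>m) \<le> (\<integral>x. \<bar>h k x - f x\<bar> + \<bar>h k x - g x\<bar> \<partial>m)"
      using fi gi Fs_integrable[OF hF] by (intro integral_mono) auto
    also have "\<dots> = (\<integral>x. \<bar>h k x - f x\<bar> \<partial>m) + (\<integral>x. \<bar>h k x - g x\<bar> \<partial>m)"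
      using fi gi Fs_integrable[OF hF] by (intro Bochner_Integration.integral_add) auto
    finally show ?thesis
      using hL[of k] energy_norm_bounds(1)[OF Fs_diff[OF hF[of k] g(1)]] by linarith
  qed
  moreover have "(\<lambda>k. 1 / real (Suc k) + N (\<lambda>x. h k x - g x)) \<longlonglongrightarrow> 0 + 0"
    by (intro tendsto_add inv0 g(2))
  ultimately have "(\<integral>x. \<bar>f x - g x\<bar> \<partial>m) \<le> 0"
    by (intro LIMSEQ_le_const[of _ 0]) auto
  then have "(\<integral>x. \<bar>f x - g x\<bar> \<partial>m) = 0"
    by (intro antisym Bochner_Integration.integral_nonneg) auto
  then have "AE x in m. \<bar>f x - g x\<bar> = 0"
    using fi gi by (subst (asm) integral_nonneg_eq_0_iff_AE) auto
  then have ae: "AE x in m. g x = f x" by eventually_elim simp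
  have fF: "f \<in> Fs" by (rule Fs_ae[OF g(1) f ae])
  have "N g \<le> B + (1 / Suc k + N (\<lambda>x. h k x - g x))" for k
  proof -
    have "N g \<le> N (h k) + N (\<lambda>x. - 1 * (h k x - g x))"
      using N_add[OF hF[of k] Fs_scale[OF Fs_diff[OF hF[of k] g(1)]], of "-1"] by simp
    also have "N (\<lambda>x. - 1 * (h k x - g x)) = N (\<lambda>x. h k x - g x)"
      using N_scale[OF Fs_diff[OF hF[of k] g(1)], of "-1"] by simp
    finally show ?thesis using h(2)[of k] DB[of k] by linarith
  qed
  moreover have "(\<lambda>k. B + (1 / real (Suc k) + N (\<lambda>x. h k x - g x))) \<longlonglongrightarrow> B + (0 + 0)"
    by (intro tendsto_add tendsto_const inv0 g(2))
  ultimately have "N g \<le> B" by (intro LIMSEQ_le_const[of _ B]) auto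
  then show ?thesis using fF N_ae[OF g(1) fF ae] by simp
qed

lemma near_points_close:
  assumes v: "v \<in> carpet_words n" and w: "w \<in> carpet_words n" and near: "near_words v w"
    and x: "x \<in> K" and y: "y \<in> K"
  shows "dist (carpet_word_map v y) (carpet_word_map w x) \<le> 8 / 3 ^ n"
proof -
  have *: "\<bar>a + 2 * real_of_int k - (b + 2 * real_of_int l)\<bar> \<le> 4"
    if "\<bar>k - l\<bar> \<le> 1" "\<bar>a\<bar> \<le> 1" "\<bar>b\<bar> \<le> 1" for a b :: real and k l
  proof -
    have "\<bar>real_of_int k - real_of_int l\<bar> \<le> 1" using that(1) by linarith
    then show ?thesis using that(2,3) by linarith
  qed
  have "\<bar>fst y + 2 * real_of_int (word_x v) - (fst x + 2 * real_of_int (word_x w))\<bar> \<le> 4"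
    "\<bar>snd y + 2 * real_of_int (word_y v) - (snd x + 2 * real_of_int (word_y w))\<bar> \<le> 4"
    using near K_subset_box[OF x] K_subset_box[OF y] unfolding near_words_def by (auto intro!: *)
  then have "\<bar>fst (carpet_word_map v y) - fst (carpet_word_map w x)\<bar> \<le> 4 / 3 ^ n"
    "\<bar>snd (carpet_word_map v y) - snd (carpet_word_map w x)\<bar> \<le> 4 / 3 ^ n"
    by (simp_all add: carpet_word_map_pos[OF v] carpet_word_map_pos[OF w] divide_right_mono
          flip: diff_divide_distrib)
  moreover have "dist (carpet_word_map v y) (carpet_word_map w x) \<le>
      \<bar>fst (carpet_word_map v y) - fst (carpet_word_map w x)\<bar> +
      \<bar>snd (carpet_word_map v y) - snd (carpet_word_map w x)\<bar>"
    unfolding dist_prod_def dist_real_def power2_abs by (rule sqrt_sum_squares_le_sum_abs)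
  ultimately show ?thesis by simp
qed

text \<open>Interpolation after averaging is bounded on \<open>L\<^sup>1\<close> uniformly in \<open>n\<close>, and for a continuous function it
  converges uniformly; the general case follows by density.\<close>

lemma interpolations_converge:
  assumes f: "integrable m f" and \<epsilon>: "0 < \<epsilon>"
  shows "\<exists>n0. \<forall>n\<ge>n0. \<forall>H. continuous_on K H \<longrightarrow>
    (\<forall>w\<in>carpet_words n. \<forall>x\<in>K. H (carpet_word_map w x) = cell_interp (vertex_value n (cell_average K m f)) w x)
    \<longrightarrow> (\<integral>x. \<bar>H x - f x\<bar> \<partial>m) \<le> \<epsilon>"
proof -
  obtain B where B: "0 < B" "\<And>z. z \<in> K \<Longrightarrow> \<bar>bump z\<bar> \<le> B" using bump_bounded by blast
  \<comment> \<open>twice 36 from four vertices and nine neighbours: once for the averages, once for the oscillation; 1 for the cell itself\<close>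
  define \<delta> where "\<delta> = \<epsilon> / (72 * B + 1)"
  have \<delta>: "0 < \<delta>" "(72 * B + 1) * \<delta> = \<epsilon>" using \<epsilon> B(1) by (simp_all add: \<delta>_def add_pos_pos less_imp_neq[symmetric])
  obtain h where h: "continuous_on K h" "(\<integral>x. \<bar>f x - h x\<bar> \<partial>m) < \<delta>"
    using continuous_dense_L1[OF f \<delta>(1)] by blast
  have "uniformly_continuous_on K h" by (rule compact_uniformly_continuous[OF h(1) compact_K])
  then obtain \<tau> where \<tau>: "0 < \<tau>" "\<And>x y. x \<in> K \<Longrightarrow> y \<in> K \<Longrightarrow> dist y x < \<tau> \<Longrightarrow> dist (h y) (h x) < \<delta>"
    unfolding uniformly_continuous_on_def using \<delta>(1) by blast
  have "(\<lambda>n. 8 * (1 / 3) ^ n) \<longlonglongrightarrow> (8 * 0 :: real)"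
    by (intro tendsto_mult tendsto_const LIMSEQ_power_zero) simp
  then have "eventually (\<lambda>n. 8 * (1 / 3) ^ n < \<tau>) sequentially" using \<tau>(1) by (intro order_tendstoD) auto
  then obtain n0 where n0: "\<And>n. n0 \<le> n \<Longrightarrow> 8 / 3 ^ n < \<tau>"
    by (auto simp: eventually_sequentially power_one_over)
  have hi: "integrable m h" by (rule continuous_integrable[OF h(1)])
  show ?thesis
  proof (intro exI[of _ n0] allI impI)
    fix n H assume n: "n0 \<le> n" and Hc: "continuous_on K H"
      and H: "\<forall>w\<in>carpet_words n. \<forall>x\<in>K. H (carpet_word_map w x) = cell_interp (vertex_value n (cell_average K m f)) w x"
    have Hi: "integrable m H" by (rule continuous_integrable[OF Hc])
    let ?D = "\<lambda>v. \<integral>x. \<bar>f (carpet_word_map v x) - h (carpet_word_map v x)\<bar> \<partial>m"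
    have iw: "integrable m (\<lambda>x. g (carpet_word_map w x))" if "integrable m g" "w \<in> carpet_words n"
      for g :: "plane \<Rightarrow> real" and w using integrable_comp_word_map[OF that] by (simp add: comp_def)
    have avg: "\<bar>cell_average K m f v - h (carpet_word_map w x)\<bar> \<le> ?D v + \<delta>"
      if v: "v \<in> carpet_words n" and w: "w \<in> carpet_words n" and near: "near_words v w" and x: "x \<in> K" for v w x
    proof -
      have hv: "\<bar>h (carpet_word_map v y) - h (carpet_word_map w x)\<bar> \<le> \<delta>" if y: "y \<in> K" for y
      proof -
        have "dist (carpet_word_map v y) (carpet_word_map w x) < \<tau>"
          using near_points_close[OF v w near x y] n0[OF n] by linarith
        then show ?thesis
          using \<tau>(2)[OF carpet_word_map_in_K[OF w x] carpet_word_map_in_K[OF v y]]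
          by (simp add: dist_real_def)
      qed
      have "\<bar>cell_average K m f v - h (carpet_word_map w x)\<bar> =
          \<bar>\<integral>y. f (carpet_word_map v y) - h (carpet_word_map w x) \<partial>m\<bar>"
        using cell_average_eq[OF f v] iw[OF f v] prob_space by simp
      also have "\<dots> \<le> (\<integral>y. \<bar>f (carpet_word_map v y) - h (carpet_word_map w x)\<bar> \<partial>m)"
        by (rule integral_abs_bound)
      also have "\<dots> \<le> (\<integral>y. \<bar>f (carpet_word_map v y) - h (carpet_word_map v y)\<bar> + \<delta> \<partial>m)"
      proof (rule integral_mono)
        fix y assume "y \<in> space m"
        then show "\<bar>f (carpet_word_map v y) - h (carpet_word_map w x)\<bar> \<le>
            \<bar>f (carpet_word_map v y) - h (carpet_word_map v y)\<bar> + \<delta>"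
          using hv[of y] by simp
      qed (use iw[OF f v] iw[OF hi v] in auto)
      also have "\<dots> = ?D v + \<delta>"
        using iw[OF f v] iw[OF hi v] prob_space by simp
      finally show ?thesis .
    qed
    have cell: "(\<integral>x. \<bar>H (carpet_word_map w x) - f (carpet_word_map w x)\<bar> \<partial>m) \<le>
        4 * B * ((\<Sum>v\<in>nbhd n w. ?D v) + 9 * \<delta>) + ?D w" if w: "w \<in> carpet_words n" for w
    proof -
      let ?c = "4 * B * ((\<Sum>v\<in>nbhd n w. ?D v) + 9 * \<delta>)"
      have pt: "\<bar>H (carpet_word_map w x) - h (carpet_word_map w x)\<bar> \<le> ?c" if x: "x \<in> K" for x
      proof -
        have "\<bar>H (carpet_word_map w x) - h (carpet_word_map w x)\<bar> \<le>
            4 * B * (\<Sum>v\<in>nbhd n w. \<bar>cell_average K m f v - h (carpet_word_map w x)\<bar>)"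
          using cell_interp_deviation[OF w x B] H w x by simp
        also have "\<dots> \<le> 4 * B * (\<Sum>v\<in>nbhd n w. ?D v + \<delta>)"
          using B(1) avg[OF _ w _ x] by (intro mult_left_mono sum_mono) (auto simp: nbhd_mem near_words_sym)
        also have "\<dots> = 4 * B * ((\<Sum>v\<in>nbhd n w. ?D v) + real (card (nbhd n w)) * \<delta>)"
          by (simp add: sum.distrib)
        also have "\<dots> \<le> ?c"
          using B(1) card_nbhd[of n w] \<delta>(1) by (intro mult_left_mono add_left_mono mult_right_mono) auto
        finally show ?thesis .
      qed
      have "(\<integral>x. \<bar>H (carpet_word_map w x) - f (carpet_word_map w x)\<bar> \<partial>m) \<le>
          (\<integral>x. ?c + \<bar>f (carpet_word_map w x) - h (carpet_word_map w x)\<bar> \<partial>m)"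
      proof (rule integral_mono)
        fix x assume "x \<in> space m"
        then show "\<bar>H (carpet_word_map w x) - f (carpet_word_map w x)\<bar> \<le>
            ?c + \<bar>f (carpet_word_map w x) - h (carpet_word_map w x)\<bar>"
          using pt[of x] by simp
      qed (use iw[OF f w] iw[OF hi w] iw[OF Hi w] in auto)
      also have "\<dots> = ?c + ?D w"
        using iw[OF f w] iw[OF hi w] prob_space by simp
      finally show ?thesis .
    qed
    have D_total: "(1 / 8) ^ n * (\<Sum>v\<in>carpet_words n. ?D v) < \<delta>"
      using integral_words[of "\<lambda>x. \<bar>f x - h x\<bar>" n] f hi h(2) by simp
    have "(\<integral>x. \<bar>H x - f x\<bar> \<partial>m) =
        (1 / 8) ^ n * (\<Sum>w\<in>carpet_words n. \<integral>x. \<bar>H (carpet_word_map w x) - f (carpet_word_map w x)\<bar> \<partial>m)"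
      using f Hi by (intro integral_words) simp
    also have "\<dots> \<le> (1 / 8) ^ n * (\<Sum>w\<in>carpet_words n. 4 * B * ((\<Sum>v\<in>nbhd n w. ?D v) + 9 * \<delta>) + ?D w)"
      by (intro mult_left_mono sum_mono cell) auto
    also have "\<dots> = (1 / 8) ^ n * (4 * B * (\<Sum>w\<in>carpet_words n. \<Sum>v\<in>nbhd n w. ?D v)
        + 36 * B * \<delta> * 8 ^ n + (\<Sum>w\<in>carpet_words n. ?D w))"
      by (simp add: sum.distrib distrib_left card_carpet_words flip: sum_distrib_left)
    also have "\<dots> \<le> (1 / 8) ^ n * (4 * B * (9 * (\<Sum>v\<in>carpet_words n. ?D v))
        + 36 * B * \<delta> * 8 ^ n + (\<Sum>w\<in>carpet_words n. ?D w))"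
      using B(1) by (intro mult_left_mono add_mono order_refl sum_nbhd_le) auto
    also have "\<dots> = (36 * B + 1) * ((1 / 8) ^ n * (\<Sum>v\<in>carpet_words n. ?D v)) + 36 * B * \<delta>"
      by (simp add: distrib_left distrib_right add_divide_distrib power_one_over mult_ac)
    also have "\<dots> \<le> (36 * B + 1) * \<delta> + 36 * B * \<delta>"
      using D_total B(1) by (intro add_right_mono mult_left_mono) auto
    also have "\<dots> = \<epsilon>" using \<delta>(2) by (simp add: algebra_simps)
    finally show "(\<integral>x. \<bar>H x - f x\<bar> \<partial>m) \<le> \<epsilon>" .
  qed
qed

text \<open>Subtracting means before passing to the limit lets the spectral gap control the whole energy norm
  of the interpolations by their energies, so the resulting bound contains no \<open>L\<^sup>p\<close> norm of \<open>f\<close>.\<close>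

lemma bounded_discrete_energies:
  assumes f: "f \<in> Lp m p" and S: "\<And>n. 1 \<le> n \<Longrightarrow> r ^ n * graph_energy K p n (cell_average K m f) \<le> S"
  shows "f \<in> Fs \<and> Es f \<le> (Cgap + 1) * lower_const * S"
proof -
  have fi: "integrable m f" using Lp_integrable(1)[OF prob_m _ f] p by simp
  define a where "a = (\<integral>x. f x \<partial>m)"
  define B where "B = ((Cgap + 1) * lower_const * S) powr (1 / p)"
  have "0 \<le> r ^ 1 * graph_energy K p 1 (cell_average K m f)"
    using r_pos graph_energy_nonneg by simp
  then have S0: "0 \<le> S" using S[of 1] by linarith
  have "(\<lambda>x. f x - a) \<in> Lp m p"
  proof -
    have "integrable m (\<lambda>x. 2 powr p * (\<bar>f x\<bar> powr p + \<bar>- a\<bar> powr p))"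
      using f by (auto simp: Lp_def)
    then have "integrable m (\<lambda>x. \<bar>f x - a\<bar> powr p)"
    proof (rule Bochner_Integration.integrable_bound)
      show "(\<lambda>x. \<bar>f x - a\<bar> powr p) \<in> borel_measurable m" using f by (auto simp: Lp_def)
      show "AE x in m. norm (\<bar>f x - a\<bar> powr p) \<le> norm (2 powr p * (\<bar>f x\<bar> powr p + \<bar>- a\<bar> powr p))"
        using powr_add_le[of p _ "- a"] p by (intro AE_I2) auto
    qed
    then show ?thesis using f by (auto simp: Lp_def)
  qed
  moreover have "\<exists>h\<in>Fs. (\<integral>x. \<bar>h x - (f x - a)\<bar> \<partial>m) \<le> \<epsilon> \<and> N h \<le> B" if \<epsilon>: "0 < \<epsilon>" for \<epsilon>
  proof -
    have "0 < \<epsilon> / 2" using \<epsilon> by simp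
    from interpolations_converge[OF fi this] obtain n0 where n0: "\<forall>n\<ge>n0. \<forall>H. continuous_on K H \<longrightarrow>
        (\<forall>w\<in>carpet_words n. \<forall>x\<in>K. H (carpet_word_map w x) = cell_interp (vertex_value n (cell_average K m f)) w x)
        \<longrightarrow> (\<integral>x. \<bar>H x - f x\<bar> \<partial>m) \<le> \<epsilon> / 2" by blast
    define n where "n = Suc n0"
    obtain H where H: "H \<in> Fs" "continuous_on K H"
      "\<And>w x. w \<in> carpet_words n \<Longrightarrow> x \<in> K \<Longrightarrow> H (carpet_word_map w x) = cell_interp (vertex_value n (cell_average K m f)) w x"
      "Es H \<le> lower_const * (r ^ n * graph_energy K p n (cell_average K m f))"
      using discrete_interpolation[of n "cell_average K m f"] by blast
    have L: "(\<integral>x. \<bar>H x - f x\<bar> \<partial>m) \<le> \<epsilon> / 2" by (rule n0[rule_format, OF _ H(2,3)]) (simp_all add: n_def)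
    have Hi: "integrable m H" by (rule Fs_integrable[OF H(1)])
    define b where "b = (\<integral>x. H x \<partial>m)"
    have "b - a = (\<integral>x. H x - f x \<partial>m)" using Hi fi by (simp add: a_def b_def)
    then have ab: "\<bar>b - a\<bar> \<le> \<epsilon> / 2" using integral_abs_bound[of m "\<lambda>x. H x - f x"] L by linarith
    have hF: "(\<lambda>x. H x - b) \<in> Fs" by (rule Fs_diff[OF H(1) Fs_const])
    have "(\<integral>x. \<bar>H x - b - (f x - a)\<bar> \<partial>m) \<le> (\<integral>x. \<bar>H x - f x\<bar> + \<bar>b - a\<bar> \<partial>m)"
      using Hi fi by (intro integral_mono) auto
    also have "\<dots> = (\<integral>x. \<bar>H x - f x\<bar> \<partial>m) + \<bar>b - a\<bar>" using Hi fi prob_space by simp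
    finally have "(\<integral>x. \<bar>H x - b - (f x - a)\<bar> \<partial>m) \<le> \<epsilon>" using L ab by linarith
    moreover have "N (\<lambda>x. H x - b) \<le> B"
    proof -
      have "Es (\<lambda>x. H x - b) = Es H" using a_shift[OF H(1), of "- b"] by simp
      then have "Lp_norm m p (\<lambda>x. H x - b) powr p + Es (\<lambda>x. H x - b) \<le> (Cgap + 1) * Es H"
        using gap[OF H(1)] by (simp add: b_def algebra_simps)
      also have "\<dots> \<le> (Cgap + 1) * (lower_const * S)"
        using H(4) mult_left_mono[OF S[of n] lower_const_nonneg] Cgap
        by (intro mult_left_mono) (auto simp: n_def)
      finally show ?thesis
        unfolding energy_norm_def B_def using p Es_nonneg[OF hF]
        by (intro powr_mono2) (auto simp: mult.assoc)
    qed
    ultimately show ?thesis using hF by (intro bexI[of _ "\<lambda>x. H x - b"] conjI)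
  qed
  ultimately have fa: "(\<lambda>x. f x - a) \<in> Fs \<and> N (\<lambda>x. f x - a) \<le> B"
    by (intro mem_Fs_of_L1_limit) (simp_all add: B_def)
  have fF: "f \<in> Fs" using Fs_add[OF _ Fs_const, of "\<lambda>x. f x - a" a] fa by simp
  have "Es f = Es (\<lambda>x. f x - a)" using a_shift[OF fF, of "- a"] by simp
  also have "\<dots> = (Es (\<lambda>x. f x - a) powr (1 / p)) powr p" using fa by (intro Es_eq_powr) blast
  also have "\<dots> \<le> B powr p"
    using fa energy_norm_bounds(2)[of "\<lambda>x. f x - a"] p by (intro powr_mono2) auto
  also have "\<dots> = (Cgap + 1) * lower_const * S"
    using p Cgap lower_const_nonneg S0 by (simp add: B_def powr_powr)
  finally show ?thesis using fF by blast
qed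

lemma sobolev_space_eq: "sobolev_space K m p r = Fs"
proof (intro set_eqI iffI)
  fix f assume "f \<in> sobolev_space K m p r"
  then have f: "f \<in> Lp m p" "bdd_above (scaled_energy K m p r f ` {1..})"
    by (simp_all add: sobolev_space_def)
  from f(2) obtain S where "\<And>n. 1 \<le> n \<Longrightarrow> scaled_energy K m p r f n \<le> S"
    unfolding bdd_above_def by auto
  then show "f \<in> Fs" using bounded_discrete_energies[OF f(1), of S] by (simp add: scaled_energy_def)
next
  fix f assume f: "f \<in> Fs"
  have "bdd_above (scaled_energy K m p r f ` {1..})"
    by (rule bdd_aboveI2[of _ _ "upper_const * Es f"])
       (simp add: scaled_energy_def graph_energy_le_Es[OF f])
  then show "f \<in> sobolev_space K m p r" using Fs_Lp[OF f] by (simp add: sobolev_space_def)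
qed

lemma sobolev_seminorm_comparable:
  assumes f: "f \<in> Fs"
  shows "sobolev_seminorm K m p r f powr p \<le> upper_const * Es f"
    "Es f \<le> (Cgap + 1) * lower_const * sobolev_seminorm K m p r f powr p"
proof -
  let ?S = "SUP n\<in>{1..}. scaled_energy K m p r f n"
  have le: "scaled_energy K m p r f n \<le> upper_const * Es f" for n
    by (simp add: scaled_energy_def graph_energy_le_Es[OF f])
  have bdd: "bdd_above (scaled_energy K m p r f ` {1..})" by (rule bdd_aboveI2) (rule le)
  have up: "scaled_energy K m p r f n \<le> ?S" if "1 \<le> n" for n
    using that by (intro cSUP_upper[OF _ bdd]) simp
  have "0 \<le> scaled_energy K m p r f 1"
    using r_pos graph_energy_nonneg by (simp add: scaled_energy_def)
  then have "0 \<le> ?S" using up[of 1] by linarith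
  then have S: "sobolev_seminorm K m p r f powr p = ?S"
    using p by (simp add: sobolev_seminorm_def powr_powr)
  show "sobolev_seminorm K m p r f powr p \<le> upper_const * Es f"
    unfolding S by (rule cSUP_least) (simp_all add: le)
  show "Es f \<le> (Cgap + 1) * lower_const * sobolev_seminorm K m p r f powr p"
    unfolding S using bounded_discrete_energies[OF Fs_Lp[OF f], of ?S] up by (simp add: scaled_energy_def)
qed

end

section \<open>Uniqueness\<close>

theorem proposition1p6:
  fixes p \<rho> \<rho>' :: real
    and K :: "plane set" and m :: "plane measure"
    and Ep Es :: "(plane \<Rightarrow> real) \<Rightarrow> real"
    and Fs :: "(plane \<Rightarrow> real) set"
  assumes p: "1 < p"
    and K: "is_carpet K"
    and m: "is_carpet_measure K m"
    and \<rho>: "is_scaling_constant K p \<rho>"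
    and Ep: "is_carpet_p_energy K m p \<rho> Ep"
    and Fs: "Lp_subspace m p Fs"
    and Es: "nonneg_functional m Fs Es"
    and a_const: "{f \<in> Fs. Es f = 0} = {f \<in> Lp m p. ae_constant m f}"
    and a_shift: "\<And>a f. f \<in> Fs \<Longrightarrow> Es (\<lambda>x. f x + a) = Es f"
    and a_scale: "\<And>a f. f \<in> Fs \<Longrightarrow> Es (\<lambda>x. a * f x) = \<bar>a\<bar> powr p * Es f"
    and b_triangle: "triangle_on Fs (\<lambda>f. Es f powr (1 / p))"
    and b_norm: "norm_on m Fs (energy_norm m p Es)"
    and b_complete: "complete_norm_on Fs (energy_norm m p Es)"
    and b_convex: "uniformly_convex_on Fs (energy_norm m p Es)"
    and c_uniform: "\<And>f \<epsilon>. continuous_on K f \<Longrightarrow> \<epsilon> > 0 \<Longrightarrow>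
           \<exists>g\<in>Fs. continuous_on K g \<and> (\<forall>x\<in>K. \<bar>f x - g x\<bar> < \<epsilon>)"
    and c_norm: "\<And>f \<epsilon>. f \<in> Fs \<Longrightarrow> \<epsilon> > 0 \<Longrightarrow>
           \<exists>g\<in>Fs. continuous_on K g \<and> energy_norm m p Es (\<lambda>x. f x - g x) < \<epsilon>"
    and d: "symmetry_invariant Fs Es"
    and e_pos: "0 < \<rho>'"
    and e: "self_similar_energy K Fs Es \<rho>'"
    and f: "\<And>f. f \<in> Fs \<Longrightarrow> (\<lambda>x. min (max (f x) 0) 1) \<in> Fs \<and>
           Es (\<lambda>x. min (max (f x) 0) 1) \<le> Es f"
    and g: "\<exists>C>0. \<forall>f\<in>Fs. Lp_norm m p (\<lambda>x. f x - (\<integral>y. f y \<partial>m)) powr p \<le> C * Es f"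
  shows "\<rho>' = \<rho> \<and> sobolev_space K m p \<rho> = Fs \<and>
         (\<exists>C\<ge>1. \<forall>f\<in>Fs. Ep f / C \<le> Es f \<and> Es f \<le> C * Ep f)"
proof -
  obtain Cgap where Cgap: "0 < Cgap"
    "\<And>f. f \<in> Fs \<Longrightarrow> Lp_norm m p (\<lambda>x. f x - (\<integral>y. f y \<partial>m)) powr p \<le> Cgap * Es f"
    using g by blast
  interpret carpet_energy K m p \<rho>' Es Fs Cgap
    by unfold_locales (fact K m p Fs Es a_const a_shift a_scale b_triangle b_norm b_complete
      b_convex c_uniform c_norm d e_pos e f Cgap)+
  have \<rho>_eq: "\<rho> = \<rho>'" by (rule scaling_constant_unique[OF \<rho>])
  have space: "sobolev_space K m p \<rho> = Fs" unfolding \<rho>_eq by (rule sobolev_space_eq)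
  obtain C where C: "1 \<le> C" "\<And>f. f \<in> Fs \<Longrightarrow> sobolev_seminorm K m p \<rho> f / C \<le> Ep f powr (1 / p)"
    "\<And>f. f \<in> Fs \<Longrightarrow> Ep f powr (1 / p) \<le> C * sobolev_seminorm K m p \<rho> f"
    using Ep unfolding is_carpet_p_energy_def Let_def space by blast
  have Ep0: "\<And>f. f \<in> Fs \<Longrightarrow> 0 \<le> Ep f"
    using Ep unfolding is_carpet_p_energy_def Let_def space nonneg_functional_def by blast
  let ?s = "\<lambda>f. sobolev_seminorm K m p \<rho> f powr p"
  have s0: "0 \<le> sobolev_seminorm K m p \<rho> f" for f by (simp add: sobolev_seminorm_def)
  have Cp: "0 < C powr p" using C(1) by simp
  define L where "L = (Cgap + 1) * lower_const"
  have L0: "0 \<le> L" using Cgap(1) lower_const_nonneg by (simp add: L_def)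
  have lower: "Es f \<le> L * (C powr p * Ep f)" if f: "f \<in> Fs" for f
  proof -
    have "sobolev_seminorm K m p \<rho> f \<le> C * Ep f powr (1 / p)"
      using C(1) C(2)[OF f] by (simp add: pos_divide_le_eq mult.commute)
    then have "?s f \<le> (C * Ep f powr (1 / p)) powr p" using p s0 by (intro powr_mono2) auto
    also have "\<dots> = C powr p * Ep f" using p C(1) Ep0[OF f] by (simp add: powr_mult powr_powr)
    finally have "L * ?s f \<le> L * (C powr p * Ep f)" using L0 by (rule mult_left_mono)
    then show ?thesis
      using sobolev_seminorm_comparable(2)[OF f] unfolding L_def \<rho>_eq by linarith
  qed
  have upper: "Ep f \<le> C powr p * (upper_const * Es f)" if f: "f \<in> Fs" for f
  proof -
    have "Ep f = (Ep f powr (1 / p)) powr p" using p Ep0[OF f] by (simp add: powr_powr)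
    also have "\<dots> \<le> (C * sobolev_seminorm K m p \<rho> f) powr p"
      using p C(3)[OF f] by (intro powr_mono2) auto
    also have "\<dots> = C powr p * ?s f" using C(1) s0 by (simp add: powr_mult)
    also have "\<dots> \<le> C powr p * (upper_const * Es f)"
      using sobolev_seminorm_comparable(1)[OF f] unfolding \<rho>_eq by (intro mult_left_mono) auto
    finally show ?thesis .
  qed
  define M where "M = 1 + C powr p * upper_const + L * C powr p"
  have M: "1 \<le> M" "C powr p * upper_const \<le> M" "L * C powr p \<le> M"
    using Cp L0 upper_const_nonneg by (simp_all add: M_def)
  have "Ep f / M \<le> Es f \<and> Es f \<le> M * Ep f" if f: "f \<in> Fs" for f
  proof
    have "Ep f \<le> M * Es f"
      using upper[OF f] mult_right_mono[OF M(2) Es_nonneg[OF f]] by (simp add: mult.assoc)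
    then show "Ep f / M \<le> Es f" using M(1) by (simp add: pos_divide_le_eq mult.commute)
    show "Es f \<le> M * Ep f"
      using lower[OF f] mult_right_mono[OF M(3) Ep0[OF f]] by (simp add: mult.assoc)
  qed
  then show ?thesis using \<rho>_eq space M(1) by blast
qed

end
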